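(* Let $f_0\in\mathcal{C}^2([0,+\infty))$, $f_1\in\mathcal{C}^1([0,+\infty))$ be compactly supported functions with supports contained in $[0,R]$ for some $R>0$, with $f_0'(0)=0$. Let $\mu:[0,+\infty)\to[0,+\infty)$ be a modulus of continuity such that: (i) $\mu\in\mathcal{C}^2((0,+\infty))$ and there exists $\tau_1>0$ such that $|\mu^{(k)}(\tau)|\lesssim\tau^{-k}\mu(\tau)$ for any $\tau\in(0,\tau_1)$ and $k=1,2$; (ii) $\mu$ satisfies the Dini condition, i.e. $\int_0^{\tau_0}\frac{\mu(\tau)}{\tau}\,\mathrm{d}\tau<+\infty$ for some (and, then, for any) $\tau_0>0$. Then there exists $\varepsilon_0=\varepsilon_0(f_0,f_1,R,\mu)>0$ such that for any $\varepsilon\in(0,\varepsilon_0]$ the semilinear Cauchy problem (radially symmetric wave equation in space dimension $3$) $$\begin{cases}u_{tt}-u_{rr}-\frac{2}{r}u_r=|u_t|^2\mu(|u_t|),& r\geqslant 0,\ t>0,\\ u(0,r)=\varepsilon f_0(r),\quad u_t(0,r)=\varepsilon f_1(r),& r\geqslant 0,\end{cases}$$ has a uniquely determined global (in time) classical solution $u=u(t,r)$ such that $u\in\mathcal{C}^1([0,+\infty)^2)$ and $ru(t,r)\in\mathcal{C}^2([0,+\infty)^2)$, subject to the support condition $$\mathrm{supp}\,u\subset\{(t,r)\in[0,+\infty)^2:\ r\leqslant t+R\},$$ and satisfying, for any $t,r\geqslant 0$ with $r\leqslant t+R$, the estimates $$|\partial^\alpha u(t,r)|\lesssim\varepsilon\,\|(f_0,f_0',f_0'',f_1,f_1')\|_{L^\infty([0,+\infty))}\,(t-r+2R)^{-1}\qquad\forall\alpha\in\mathbb{N}^2:\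 |\alpha|=0,1,$$ $$|\partial^\alpha(ru(t,r))|\lesssim\varepsilon\,\|(f_0,f_0',f_0'',f_1,f_1')\|_{L^\infty([0,+\infty))}\,(t-r+2R)^{-1}\qquad\forall\alpha\in\mathbb{N}^2:\ |\alpha|=1,2,$$ where $\partial=(\partial_t,\partial_r)$.
   Context: A modulus of continuity is a continuous, concave and increasing function $\mu:[0,+\infty)\to[0,+\infty)$ with $\mu(0)=0$. The notation $f\lesssim g$ means that there is a positive constant $C$ with $f\leqslant Cg$; in hypothesis (i) $C$ is independent of $\tau$, and in the estimates for the solution $C$ is independent of $t$, $r$ and $\varepsilon$. Since $u$ is only required to be $\mathcal{C}^1$ with $ru\in\mathcal{C}^2$, the equation is understood in its equivalent form (multiplied by $r$) $(ru)_{tt}-(ru)_{rr}=r|u_t|^2\mu(|u_t|)$. *)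

theory Defs
  imports "HOL-Analysis.Analysis" "HOL-Probability.Essential_Supremum"
begin

text \<open>Derivatives are taken within the domain, hence one-sided at its boundary points.\<close>

definition deriv_on :: "real set \<Rightarrow> (real \<Rightarrow> real) \<Rightarrow> real \<Rightarrow> real" where
  "deriv_on S f x = vector_derivative f (at x within S)"

primrec Ck_on :: "nat \<Rightarrow> real set \<Rightarrow> (real \<Rightarrow> real) \<Rightarrow> bool" where
  "Ck_on 0 S f \<longleftrightarrow> continuous_on S f"
| "Ck_on (Suc k) S f \<longleftrightarrow>
     (\<forall>x\<in>S. f differentiable (at x within S)) \<and> Ck_on k S (deriv_on S f)"

text \<open>Functions of \<open>(t, r)\<close> are curried and considered only for \<open>t, r \<ge> 0\<close>;
  their values elsewhere are irrelevant.\<close>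

definition partial_t :: "(real \<Rightarrow> real \<Rightarrow> real) \<Rightarrow> real \<Rightarrow> real \<Rightarrow> real" where
  "partial_t g t r = deriv_on {0..} (\<lambda>s. g s r) t"

definition partial_r :: "(real \<Rightarrow> real \<Rightarrow> real) \<Rightarrow> real \<Rightarrow> real \<Rightarrow> real" where
  "partial_r g t r = deriv_on {0..} (\<lambda>s. g t s) r"

definition partial :: "nat \<times> nat \<Rightarrow> (real \<Rightarrow> real \<Rightarrow> real) \<Rightarrow> real \<Rightarrow> real \<Rightarrow> real" where
  "partial \<alpha> g = (partial_t ^^ fst \<alpha>) ((partial_r ^^ snd \<alpha>) g)"

text \<open>\<open>g\<close> is of class \<open>C^k\<close> on the closed quadrant: all iterated partial derivatives
  up to order \<open>k\<close>, taken in any order, exist and are (jointly) continuous.\<close>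

primrec Ck_quadrant :: "nat \<Rightarrow> (real \<Rightarrow> real \<Rightarrow> real) \<Rightarrow> bool" where
  "Ck_quadrant 0 g \<longleftrightarrow> continuous_on ({0..} \<times> {0..}) (\<lambda>(t, r). g t r)"
| "Ck_quadrant (Suc k) g \<longleftrightarrow>
     continuous_on ({0..} \<times> {0..}) (\<lambda>(t, r). g t r) \<and>
     (\<forall>t\<ge>0. \<forall>r\<ge>0. (\<lambda>s. g s r) differentiable (at t within {0..}) \<and>
                  (\<lambda>s. g t s) differentiable (at r within {0..})) \<and>
     Ck_quadrant k (partial_t g) \<and> Ck_quadrant k (partial_r g)"

text \<open>``Increasing'' is read in the weak sense, which only makes the class of moduli larger.\<close>

definition modulus_of_continuity :: "(real \<Rightarrow> real) \<Rightarrow> bool" where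
  "modulus_of_continuity \<mu> \<longleftrightarrow>
     (\<forall>\<tau>\<ge>0. 0 \<le> \<mu> \<tau>) \<and> \<mu> 0 = 0 \<and>
     continuous_on {0..} \<mu> \<and> concave_on {0..} \<mu> \<and> mono_on {0..} \<mu>"

definition Dini_condition :: "(real \<Rightarrow> real) \<Rightarrow> bool" where
  "Dini_condition \<mu> \<longleftrightarrow>
     (\<exists>\<tau>0>0. (\<integral>\<^sup>+\<tau>\<in>{0<..<\<tau>0}. ennreal (\<mu> \<tau> / \<tau>) \<partial>lborel) < \<infinity>)"

text \<open>The norm of the vector-valued function \<open>(f0, f0', f0'', f1, f1')\<close> in
  \<open>L^\<infinity>([0,\<infinity>))\<close>, with the Euclidean norm on the values.\<close>

definition data_norm :: "(real \<Rightarrow> real) \<Rightarrow> (real \<Rightarrow> real) \<Rightarrow> real" where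
  "data_norm f0 f1 = real_of_ereal (esssup (restrict_space lborel {0..})
     (\<lambda>r. ereal (norm (f0 r, deriv_on {0..} f0 r, (deriv_on {0..} ^^ 2) f0 r,
                       f1 r, deriv_on {0..} f1 r))))"

definition times_r :: "(real \<Rightarrow> real \<Rightarrow> real) \<Rightarrow> real \<Rightarrow> real \<Rightarrow> real" where
  "times_r u t r = r * u t r"

text \<open>Global classical solutions with data \<open>g0\<close>, \<open>g1\<close>. As \<open>u\<close> itself is only of class
  \<open>C^1\<close>, the equation is the one multiplied by \<open>r\<close>.\<close>

definition classical_solution ::
  "(real \<Rightarrow> real) \<Rightarrow> (real \<Rightarrow> real) \<Rightarrow> (real \<Rightarrow> real) \<Rightarrow> (real \<Rightarrow> real \<Rightarrow> real) \<Rightarrow> bool" where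
  "classical_solution \<mu> g0 g1 u \<longleftrightarrow>
     Ck_quadrant 1 u \<and> Ck_quadrant 2 (times_r u) \<and>
     (\<forall>t>0. \<forall>r\<ge>0. partial (2, 0) (times_r u) t r - partial (0, 2) (times_r u) t r
        = r * (\<bar>partial (1, 0) u t r\<bar>\<^sup>2 * \<mu> \<bar>partial (1, 0) u t r\<bar>)) \<and>
     (\<forall>r\<ge>0. u 0 r = g0 r \<and> partial (1, 0) u 0 r = g1 r)"

end

theory Submission
  imports Defs
begin

text \<open>
Put \<open>v = r u\<close>. Then \<open>v\<close> vanishes at \<open>r = 0\<close> and solves the one-dimensional wave equation
\<open>v_tt - v_rr = F\<close> with \<open>F = r G(v_t / r)\<close> and \<open>G(p) = |p|^2 \<mu>(|p|)\<close>. Extending \<open>v\<close> to an odd function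
of \<open>r\<close> removes the boundary. The function \<open>P = v_t + v_r\<close> is then transported along incoming
characteristics, \<open>P(t, r) = a(t + r) + \<integral>_0^t F(s, t + r - s) ds\<close>, and by oddness \<open>v_t - v_r\<close> is
\<open>- P(t, - r)\<close>; so \<open>P\<close> determines both first derivatives of \<open>v\<close>, and \<open>Q = P_r\<close> the second ones.

The unknown of the fixed point problem is \<open>q = v_tr\<close>, an even function of \<open>r\<close>. The velocity
\<open>p = u_t = v_t / r\<close> is the mean of \<open>q\<close> over \<open>[0, r]\<close>, so \<open>q\<close> alone determines \<open>F\<close> and
\<open>F_r = G(p) + G'(p) (q - p)\<close>, and the equation becomes \<open>q(t, r) = (Q(t, r) + Q(t, - r)) / 2\<close>.
No derivative of \<open>q\<close> occurs, and \<open>u\<close> is recovered as the mean of \<open>v_r\<close> over \<open>[0, r]\<close>, which is of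
class \<open>C^1\<close> up to \<open>r = 0\<close> because \<open>v_r\<close> is.

Decay is measured by \<open>\<omega>(t, r) = R + ||t| - |r||\<close>. If \<open>|v_t|, |q| \<le> \<kappa> / \<omega>\<close>, then \<open>|p|\<close> is at most
a multiple of \<open>\<kappa> / ((R + |r|) \<omega>)\<close>, and therefore \<open>|F|\<close> and \<open>|F_r|\<close> are at most a multiple of
\<open>\<kappa>^2 \<phi>(r) / \<omega>^2\<close> with \<open>\<phi>(r) = \<Lambda>(m_0 R / (R + |r|)) / (R + |r|)\<close> and \<open>\<Lambda>\<close> a multiple of \<open>\<mu>\<close>. The
substitution \<open>\<tau> = m_0 R / (R + r)\<close> turns \<open>\<integral> \<phi> dr\<close> into the Dini integral \<open>\<integral> \<Lambda>(\<tau>) / \<tau> d\<tau>\<close>. On the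
characteristic \<open>t + r = x\<close>, either \<open>\<omega>\<close> is comparable to \<open>R + |x|\<close> and \<open>\<phi>\<close> is integrable, or \<open>r\<close> is
comparable to \<open>x\<close>, whence \<open>\<phi> \<le> const / (R + |x|)\<close>, and \<open>\<omega>^{-2}\<close> is integrable. In both cases the integral
of the source over the characteristic is \<open>O(\<kappa>^2 / (R + |x|))\<close> (lemma \<open>ray_bound\<close>), which has the same
shape as the bound for the datum \<open>a\<close> and is at most \<open>O(\<kappa>^2 / \<omega>)\<close>. The bounds on \<open>\<mu>'\<close> and \<open>\<mu>''\<close> say
that \<open>G'\<close> is Lipschitz on \<open>[-m, m]\<close> with constant \<open>\<Lambda>(m)\<close>; so the same estimate holds for differences
(\<open>source_near\<close>), and for small \<open>\<kappa>\<close> the Picard map is a contraction with factor \<open>1/2\<close>.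

Uniqueness needs no decay. For two solutions, the difference \<open>d\<close> of their \<open>v_t\<close> obeys an integral inequality along the
characteristics inside each triangle \<open>t + r \<le> T\<close>, where \<open>G\<close> is Lipschitz on the compact range of both
velocities; iterating it gives \<open>|d| \<le> M (L t)^n / n!\<close> for every \<open>n\<close>.
\<close>

section \<open>Means, primitives and functions of two variables\<close>

text \<open>The mean of \<open>k\<close> over the segment from \<open>0\<close> to \<open>x\<close>, parametrised by \<open>[0, 1]\<close>. In this form it is defined and
continuous at \<open>x = 0\<close>, it makes no case distinction on the sign of \<open>x\<close>, and it can be differentiated
under the integral sign.\<close>

definition avg :: "(real \<Rightarrow> real) \<Rightarrow> real \<Rightarrow> real" where
  "avg k x = integral {0..1} (\<lambda>\<theta>. k (\<theta> * x))"

text \<open>The oriented integral of \<open>k\<close> from \<open>0\<close> to \<open>x\<close>, for \<open>x\<close> of either sign.\<close>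

definition prim :: "(real \<Rightarrow> real) \<Rightarrow> real \<Rightarrow> real" where
  "prim k x = x * avg k x"

definition jcont :: "(real \<Rightarrow> real \<Rightarrow> real) \<Rightarrow> bool" where
  "jcont f \<longleftrightarrow> continuous_on UNIV (\<lambda>z. f (fst z) (snd z))"

lemma jcont_compose:
  assumes "jcont f" "continuous_on S \<alpha>" "continuous_on S \<beta>"
  shows "continuous_on S (\<lambda>x. f (\<alpha> x) (\<beta> x))"
  using continuous_on_compose2[OF assms(1)[unfolded jcont_def] continuous_on_Pair[OF assms(2,3)]]
  by simp

lemma jcontI: "continuous_on UNIV (\<lambda>z. f (fst z) (snd z)) \<Longrightarrow> jcont f"
  by (simp add: jcont_def)

lemma jcont_section: "jcont f \<Longrightarrow> continuous_on S (f t)"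
  by (intro jcont_compose[of f S "\<lambda>_. t" "\<lambda>x. x"] continuous_intros)

lemma continuous_on_scale:
  fixes k :: "real \<Rightarrow> real"
  assumes "continuous_on UNIV k"
  shows "continuous_on S (\<lambda>\<theta>. k (\<theta> * x))"
  by (rule continuous_on_compose2[OF assms]) (auto intro!: continuous_intros)

lemma avg_0 [simp]: "avg k 0 = k 0"
  by (simp add: avg_def)

lemma prim_0 [simp]: "prim k 0 = 0"
  by (simp add: prim_def)

lemma avg_zero [simp]: "avg (\<lambda>s. 0) x = 0"
  by (simp add: avg_def)

lemma prim_zero [simp]: "prim (\<lambda>s. 0) x = 0"
  by (simp add: prim_def)

lemma avg_diff:
  assumes "continuous_on UNIV k" "continuous_on UNIV l"
  shows "avg (\<lambda>s. k s - l s) x = avg k x - avg l x"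
  unfolding avg_def
  by (intro integral_diff integrable_continuous_real continuous_on_scale assms)

lemma prim_diff:
  assumes "continuous_on UNIV k" "continuous_on UNIV l"
  shows "prim (\<lambda>s. k s - l s) x = prim k x - prim l x"
  by (simp add: prim_def avg_diff[OF assms] right_diff_distrib)

lemma avg_bound:
  assumes "continuous_on UNIV k" and "\<And>\<theta>. 0 \<le> \<theta> \<Longrightarrow> \<theta> \<le> 1 \<Longrightarrow> \<bar>k (\<theta> * x)\<bar> \<le> B"
  shows "\<bar>avg k x\<bar> \<le> B"
proof -
  have "norm (integral {0..1} (\<lambda>\<theta>. k (\<theta> * x))) \<le> integral {0..1} (\<lambda>\<theta>::real. B)"
  proof (rule integral_norm_bound_integral)
    show "(\<lambda>\<theta>. k (\<theta> * x)) integrable_on {0..1}"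
      by (intro integrable_continuous_real continuous_on_scale assms)
  qed (use assms in auto)
  then show ?thesis by (simp add: avg_def)
qed

lemma avg_eq_0:
  assumes "\<And>\<theta>. 0 \<le> \<theta> \<Longrightarrow> \<theta> \<le> 1 \<Longrightarrow> k (\<theta> * x) = 0"
  shows "avg k x = 0"
proof -
  have "integral {0..1} (\<lambda>\<theta>. k (\<theta> * x)) = integral {0..1} (\<lambda>\<theta>::real. 0)"
    by (rule Henstock_Kurzweil_Integration.integral_cong) (use assms in auto)
  then show ?thesis by (simp add: avg_def)
qed

lemma avg_minus: "avg (\<lambda>s. k (- s)) x = avg k (- x)"
  by (simp add: avg_def)

lemma prim_minus: "prim (\<lambda>s. k (- s)) x = - prim k (- x)"
  by (simp add: prim_def avg_minus)

lemma prim_eqI: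
  assumes W: "\<And>x. (W has_real_derivative k x) (at x)" and k: "continuous_on UNIV k"
  shows "prim k x = W x - W 0"
proof -
  have "((\<lambda>\<theta>. k (\<theta> * x) * x) has_integral (W (1 * x) - W (0 * x))) {0..1}"
  proof (rule fundamental_theorem_of_calculus)
    fix \<theta> :: real
    have "((\<lambda>\<theta>. W (\<theta> * x)) has_real_derivative k (\<theta> * x) * x) (at \<theta> within {0..1})"
      by (rule DERIV_chain2[OF W]) (auto intro!: derivative_eq_intros)
    then show "((\<lambda>\<theta>. W (\<theta> * x)) has_vector_derivative k (\<theta> * x) * x) (at \<theta> within {0..1})"
      by (simp add: has_real_derivative_iff_has_vector_derivative)
  qed simp
  then have "integral {0..1} (\<lambda>\<theta>. k (\<theta> * x) * x) = W x - W 0"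
    by (intro integral_unique) simp
  then show ?thesis
    by (simp only: prim_def avg_def integral_mult_left mult.commute[of x])
qed

lemma DERIV_prim:
  assumes k: "continuous_on UNIV k"
  shows "(prim k has_real_derivative k x) (at x)"
proof -
  define M where "M = \<bar>x\<bar> + 1"
  have "continuous_on {-M..M} k" using k continuous_on_subset by blast
  then obtain g where g: "\<And>y. y \<in> {-M..M} \<Longrightarrow> (g has_vector_derivative k y) (at y within {-M..M})"
    using antiderivative_continuous by blast
  have eq: "prim k y = g y - g 0" if y: "y \<in> {-M<..<M}" for y
  proof -
    have "((\<lambda>\<theta>. k (\<theta> * y) * y) has_integral (g (1 * y) - g (0 * y))) {0..1}"
    proof (rule fundamental_theorem_of_calculus)
      fix \<theta> :: real assume \<theta>: "\<theta> \<in> {0..1}"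
      have "\<bar>\<theta> * y\<bar> \<le> 1 * \<bar>y\<bar>" unfolding abs_mult using \<theta> by (intro mult_right_mono) auto
      then have in_M: "\<theta> * y \<in> {-M<..<M}" using y by auto
      then have "(g has_vector_derivative k (\<theta> * y)) (at (\<theta> * y) within {-M<..<M})"
        by (intro has_vector_derivative_within_subset[OF g[of "\<theta> * y"]]) auto
      then have "(g has_real_derivative k (\<theta> * y)) (at (\<theta> * y))"
        unfolding at_within_open[OF in_M open_greaterThanLessThan]
        by (simp only: has_real_derivative_iff_has_vector_derivative)
      then have "((\<lambda>\<theta>. g (\<theta> * y)) has_real_derivative k (\<theta> * y) * y) (at \<theta> within {0..1})"
        by (rule DERIV_chain2) (auto intro!: derivative_eq_intros)
      then show "((\<lambda>\<theta>. g (\<theta> * y)) has_vector_derivative k (\<theta> * y) * y) (at \<theta> within {0..1})"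
        by (simp add: has_real_derivative_iff_has_vector_derivative)
    qed simp
    then have "integral {0..1} (\<lambda>\<theta>. k (\<theta> * y) * y) = g y - g 0"
      by (intro integral_unique) simp
    then show ?thesis
      by (simp only: prim_def avg_def integral_mult_left mult.commute[of y])
  qed
  have x: "x \<in> {-M<..<M}" by (auto simp: M_def)
  then have "(g has_vector_derivative k x) (at x within {-M<..<M})"
    by (intro has_vector_derivative_within_subset[OF g[of x]]) auto
  then have "(g has_real_derivative k x) (at x)"
    unfolding at_within_open[OF x open_greaterThanLessThan]
    by (simp only: has_real_derivative_iff_has_vector_derivative)
  then have "((\<lambda>y. g y - g 0) has_real_derivative k x) (at x)"
    by (auto intro!: derivative_eq_intros)
  moreover have "((\<lambda>y. g y - g 0) has_real_derivative k x) (at x) \<longleftrightarrow>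
      (prim k has_real_derivative k x) (at x)"
    by (rule DERIV_cong_ev)
       (use x eq in \<open>auto intro!: eventually_mono[OF eventually_nhds_in_open[OF open_greaterThanLessThan x]]\<close>)
  ultimately show ?thesis by simp
qed

lemma DERIV_avg:
  assumes k: "continuous_on UNIV k" and x: "x \<noteq> 0"
  shows "(avg k has_real_derivative (k x - avg k x) / x) (at x)"
proof -
  have "((\<lambda>y. prim k y / y) has_real_derivative (k x - avg k x) / x) (at x)"
    by (rule DERIV_cong[OF DERIV_divide[OF DERIV_prim[OF k] DERIV_ident x]])
       (use x in \<open>simp add: prim_def field_simps\<close>)
  moreover have "((\<lambda>y. prim k y / y) has_real_derivative (k x - avg k x) / x) (at x) \<longleftrightarrow>
      (avg k has_real_derivative (k x - avg k x) / x) (at x)"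
  proof (rule DERIV_cong_ev)
    have "\<forall>\<^sub>F y in nhds x. y \<in> - {0}"
      using x by (intro eventually_nhds_in_open) auto
    then show "\<forall>\<^sub>F y in nhds x. prim k y / y = avg k y"
      by eventually_elim (simp add: prim_def)
  qed simp_all
  ultimately show ?thesis by simp
qed

text \<open>The integral of \<open>|k|\<close> is controlled by any antiderivative \<open>Z\<close> of a pointwise bound; explicit
antiderivatives then replace the evaluation of integrals.\<close>

lemma prim_diff_bound:
  assumes k: "continuous_on UNIV k" and t: "0 \<le> t"
    and Z: "\<And>s. 0 < s \<Longrightarrow> s < t \<Longrightarrow> (Z has_real_derivative z s) (at s)"
    and Zc: "continuous_on {0..t} Z"
    and b: "\<And>s. 0 < s \<Longrightarrow> s < t \<Longrightarrow> \<bar>k s\<bar> \<le> z s"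
  shows "\<bar>prim k t\<bar> \<le> Z t - Z 0"
proof (cases "t = 0")
  case False
  with t have "0 < t" by simp
  then have "norm (prim k t - prim k 0) \<le> Z t - Z 0"
  proof (rule differentiable_bound_general[where f' = k and \<phi>' = z])
    show "continuous_on {0..t} (prim k)"
      by (intro continuous_at_imp_continuous_on ballI DERIV_isCont[OF DERIV_prim[OF k]])
    fix s assume s: "0 < s" "s < t"
    show "(prim k has_vector_derivative k s) (at s)"
      using DERIV_prim[OF k, of s] by (simp add: has_real_derivative_iff_has_vector_derivative)
    show "(Z has_vector_derivative z s) (at s)"
      using Z[OF s] by (simp add: has_real_derivative_iff_has_vector_derivative)
  qed (use Zc b in auto)
  then show ?thesis by simp
qed simp

lemma jcont_avg:
  assumes "jcont q"
  shows "jcont (\<lambda>t. avg (q t))"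
proof -
  have "continuous_on (UNIV \<times> cbox 0 1) (\<lambda>(z::real \<times> real, \<theta>::real). q (fst z) (\<theta> * snd z))"
    unfolding split_beta by (intro jcont_compose[OF assms] continuous_intros)
  from integral_continuous_on_param[OF this] show ?thesis
    by (intro jcontI) (simp add: avg_def cbox_interval)
qed

lemma jcont_prim: "jcont q \<Longrightarrow> jcont (\<lambda>t. prim (q t))"
  using jcont_avg[of q] unfolding prim_def jcont_def
  by (intro continuous_intros)

lemma DERIV_avg_param:
  assumes d: "\<And>t r. ((\<lambda>t. f t r) has_real_derivative f' t r) (at t)"
    and f: "jcont f" and f': "jcont f'"
  shows "((\<lambda>t. avg (f t) r) has_real_derivative avg (f' t) r) (at t)"
proof -
  have "((\<lambda>t. integral (cbox 0 1) (\<lambda>\<theta>. f t (\<theta> * r))) has_real_derivative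
      integral (cbox 0 1) (\<lambda>\<theta>. f' t (\<theta> * r))) (at t within UNIV)"
  proof (rule leibniz_rule_field_derivative)
    show "(\<lambda>\<theta>. f t (\<theta> * r)) integrable_on cbox 0 1" for t
      by (intro integrable_continuous jcont_compose[OF f] continuous_intros)
    show "continuous_on (UNIV \<times> cbox 0 1) (\<lambda>(t, \<theta>). f' t (\<theta> * r))"
      unfolding split_beta by (intro jcont_compose[OF f'] continuous_intros)
  qed (use d in auto)
  then show ?thesis by (simp add: avg_def cbox_interval)
qed

lemma DERIV_avg_C1:
  assumes d: "\<And>r. (f has_real_derivative f' r) (at r)" and f': "continuous_on UNIV f'"
  shows "(avg f has_real_derivative integral {0..1} (\<lambda>\<theta>. \<theta> * f' (\<theta> * r))) (at r)"
proof -
  have f: "continuous_on UNIV f"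
    by (intro continuous_at_imp_continuous_on ballI DERIV_isCont[OF d])
  have "((\<lambda>r. integral (cbox 0 1) (\<lambda>\<theta>. f (\<theta> * r))) has_real_derivative
      integral (cbox 0 1) (\<lambda>\<theta>. \<theta> * f' (\<theta> * r))) (at r within UNIV)"
  proof (rule leibniz_rule_field_derivative)
    fix x \<theta> :: real
    have "((\<lambda>r. f (\<theta> * r)) has_real_derivative f' (\<theta> * x) * \<theta>) (at x)"
      by (rule DERIV_chain2[OF d]) (auto intro!: derivative_eq_intros)
    then show "((\<lambda>r. f (\<theta> * r)) has_real_derivative \<theta> * f' (\<theta> * x)) (at x within UNIV)"
      by (simp add: mult.commute)
  next
    show "(\<lambda>\<theta>. f (\<theta> * r)) integrable_on cbox 0 1" for r
      by (intro integrable_continuous continuous_on_compose2[OF f] continuous_intros) auto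
    show "continuous_on (UNIV \<times> cbox 0 1) (\<lambda>(r, \<theta>). \<theta> * f' (\<theta> * r))"
      unfolding split_beta by (intro continuous_on_compose2[OF f'] continuous_intros) auto
  qed auto
  then show ?thesis by (simp add: avg_def[abs_def] cbox_interval)
qed

lemma DERIV_two_variables:
  fixes f fx fy :: "real \<Rightarrow> real \<Rightarrow> real"
  assumes op: "open X" "open Y" "convex Y"
    and fx: "\<And>x y. x \<in> X \<Longrightarrow> y \<in> Y \<Longrightarrow> ((\<lambda>x. f x y) has_real_derivative fx x y) (at x)"
    and fy: "\<And>x y. x \<in> X \<Longrightarrow> y \<in> Y \<Longrightarrow> ((\<lambda>y. f x y) has_real_derivative fy x y) (at y)"
    and cont: "continuous_on (X \<times> Y) (\<lambda>z. fy (fst z) (snd z))"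
    and s: "\<alpha> s \<in> X" "\<beta> s \<in> Y"
    and \<alpha>: "(\<alpha> has_real_derivative \<alpha>') (at s)" and \<beta>: "(\<beta> has_real_derivative \<beta>') (at s)"
  shows "((\<lambda>s. f (\<alpha> s) (\<beta> s)) has_real_derivative \<alpha>' * fx (\<alpha> s) (\<beta> s) + \<beta>' * fy (\<alpha> s) (\<beta> s)) (at s)"
proof -
  let ?x = "\<alpha> s" and ?y = "\<beta> s"
  have "((\<lambda>(x, y). f x y) has_derivative (\<lambda>(tx, ty). fx ?x ?y * tx + blinfun_mult_right (fy ?x ?y) ty))
      (at (?x, ?y) within X \<times> Y)"
  proof (rule has_derivative_partialsI)
    show "((\<lambda>x. f x ?y) has_derivative (*) (fx ?x ?y)) (at ?x within X)"
      using fx[OF s] by (simp add: has_field_derivative_def has_derivative_at_withinI)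
    show "((\<lambda>y. f x y) has_derivative blinfun_apply (blinfun_mult_right (fy x y))) (at y within Y)"
      if "x \<in> X" "y \<in> Y" for x y
      using fy[OF that] by (simp add: has_field_derivative_def has_derivative_at_withinI)
    have "continuous_on (X \<times> Y) (\<lambda>(x, y). blinfun_mult_right (fy x y))"
      unfolding split_beta by (intro continuous_intros cont)
    then show "continuous (at (?x, ?y) within X \<times> Y) (\<lambda>(x, y). blinfun_mult_right (fy x y))"
      using s by (auto simp: continuous_on_eq_continuous_within)
  qed (use s op in auto)
  then have *: "((\<lambda>z. f (fst z) (snd z)) has_derivative
      (\<lambda>z. fx ?x ?y * fst z + fy ?x ?y * snd z)) (at (?x, ?y))"
    unfolding at_within_open[OF SigmaI[OF s] open_Times[OF op(1,2)]] split_beta'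
    by (simp only: blinfun_mult_right.rep_eq)
  have "((\<lambda>s. (\<alpha> s, \<beta> s)) has_derivative (\<lambda>h. (\<alpha>' * h, \<beta>' * h))) (at s)"
    using \<alpha> \<beta> by (auto simp: has_field_derivative_def intro!: has_derivative_Pair)
  note d = has_derivative_compose[OF this *]
  have e: "(\<lambda>h. fx ?x ?y * (\<alpha>' * h) + fy ?x ?y * (\<beta>' * h))
      = (*) (\<alpha>' * fx ?x ?y + \<beta>' * fy ?x ?y)"
    by (simp add: algebra_simps fun_eq_iff)
  from d show ?thesis
    unfolding has_field_derivative_def fst_conv snd_conv e .
qed

text \<open>The Schwarz theorem. The mean value theorem, applied twice in either order, writes the second difference
over a small rectangle as its area times each of the two mixed derivatives, at points that tend to \<open>(a, b)\<close>.\<close>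

lemma mixed_partials_eq:
  fixes f fx fy fxy fyx :: "real \<Rightarrow> real \<Rightarrow> real"
  assumes op: "open X" "open Y"
    and fx: "\<And>x y. x \<in> X \<Longrightarrow> y \<in> Y \<Longrightarrow> ((\<lambda>x. f x y) has_real_derivative fx x y) (at x)"
    and fy: "\<And>x y. x \<in> X \<Longrightarrow> y \<in> Y \<Longrightarrow> ((\<lambda>y. f x y) has_real_derivative fy x y) (at y)"
    and fxy: "\<And>x y. x \<in> X \<Longrightarrow> y \<in> Y \<Longrightarrow> ((\<lambda>y. fx x y) has_real_derivative fxy x y) (at y)"
    and fyx: "\<And>x y. x \<in> X \<Longrightarrow> y \<in> Y \<Longrightarrow> ((\<lambda>x. fy x y) has_real_derivative fyx x y) (at x)"
    and cxy: "continuous_on (X \<times> Y) (\<lambda>z. fxy (fst z) (snd z))"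
    and cyx: "continuous_on (X \<times> Y) (\<lambda>z. fyx (fst z) (snd z))"
    and ab: "a \<in> X" "b \<in> Y"
  shows "fxy a b = fyx a b"
proof (rule ccontr)
  assume "fxy a b \<noteq> fyx a b"
  define e where "e = \<bar>fxy a b - fyx a b\<bar> / 2"
  have e: "e > 0" using \<open>fxy a b \<noteq> fyx a b\<close> by (simp add: e_def)
  have opXY: "open (X \<times> Y)" using op by (rule open_Times)
  have abXY: "(a, b) \<in> X \<times> Y" using ab by simp
  have "isCont (\<lambda>z. fxy (fst z) (snd z)) (a, b)" "isCont (\<lambda>z. fyx (fst z) (snd z)) (a, b)"
    using cxy cyx continuous_on_eq_continuous_at[OF opXY] abXY by blast+
  then have "filterlim (\<lambda>z. fxy (fst z) (snd z)) (nhds (fxy a b)) (nhds (a, b))"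
    "filterlim (\<lambda>z. fyx (fst z) (snd z)) (nhds (fyx a b)) (nhds (a, b))"
    using tendsto_at_iff_tendsto_nhds[of "\<lambda>z. fxy (fst z) (snd z)" "(a, b)"]
      tendsto_at_iff_tendsto_nhds[of "\<lambda>z. fyx (fst z) (snd z)" "(a, b)"]
    by (simp_all add: continuous_at)
  from tendstoD[OF this(1) e] tendstoD[OF this(2) e]
  eventually_nhds_in_open[OF opXY abXY]
  have "\<forall>\<^sub>F z in nhds (a, b). z \<in> X \<times> Y \<and> dist (fxy (fst z) (snd z)) (fxy a b) < e \<and>
      dist (fyx (fst z) (snd z)) (fyx a b) < e"
    by eventually_elim auto
  then obtain d where d: "d > 0" and D: "\<And>z. dist z (a, b) < d \<Longrightarrow> z \<in> X \<times> Y \<and>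
      dist (fxy (fst z) (snd z)) (fxy a b) < e \<and> dist (fyx (fst z) (snd z)) (fyx a b) < e"
    unfolding eventually_nhds_metric by blast
  define h where "h = d / 3"
  have h: "h > 0" using d by (simp add: h_def)
  have near: "dist (x, y) (a, b) < d" if "a \<le> x" "x \<le> a + h" "b \<le> y" "y \<le> b + h" for x y
  proof -
    have "dist (x, y) (a, b) \<le> \<bar>x - a\<bar> + \<bar>y - b\<bar>"
      by (simp add: dist_Pair_Pair dist_real_def sqrt_sum_squares_le_sum_abs)
    also have "\<dots> \<le> 2 * h" using that by auto
    also have "\<dots> < d" using d by (simp add: h_def)
    finally show ?thesis .
  qed
  have X: "x \<in> X" if "a \<le> x" "x \<le> a + h" for x
    using D[OF near[of x b]] that h by auto
  have Y: "y \<in> Y" if "b \<le> y" "y \<le> b + h" for y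
    using D[OF near[of a y]] that h by auto
  define \<Delta> where "\<Delta> = f (a + h) (b + h) - f a (b + h) - (f (a + h) b - f a b)"
  \<comment> \<open>the second difference, by increments first in \<open>x\<close> and then in \<open>y\<close>\<close>
  obtain \<xi> \<eta> where 1: "a < \<xi>" "\<xi> < a + h" "b < \<eta>" "\<eta> < b + h" "\<Delta> = h * (h * fxy \<xi> \<eta>)"
  proof -
    have "\<exists>\<xi>>a. \<xi> < a + h \<and> (f (a + h) (b + h) - f (a + h) b) - (f a (b + h) - f a b)
        = (a + h - a) * (fx \<xi> (b + h) - fx \<xi> b)"
      by (rule MVT2) (use h X Y in \<open>auto intro!: DERIV_diff fx\<close>)
    then obtain \<xi> where \<xi>: "a < \<xi>" "\<xi> < a + h" "\<Delta> = h * (fx \<xi> (b + h) - fx \<xi> b)"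
      by (auto simp: \<Delta>_def)
    have "\<exists>\<eta>>b. \<eta> < b + h \<and> fx \<xi> (b + h) - fx \<xi> b = (b + h - b) * fxy \<xi> \<eta>"
      by (rule MVT2) (use h X Y \<xi> in \<open>auto intro!: fxy\<close>)
    then show ?thesis using \<xi> that by auto
  qed
  \<comment> \<open>the same second difference, by increments first in \<open>y\<close> and then in \<open>x\<close>\<close>
  obtain \<xi>' \<eta>' where 2: "a < \<xi>'" "\<xi>' < a + h" "b < \<eta>'" "\<eta>' < b + h" "\<Delta> = h * (h * fyx \<xi>' \<eta>')"
  proof -
    have "\<exists>\<eta>>b. \<eta> < b + h \<and> (f (a + h) (b + h) - f a (b + h)) - (f (a + h) b - f a b)
        = (b + h - b) * (fy (a + h) \<eta> - fy a \<eta>)"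
      by (rule MVT2) (use h X Y in \<open>auto intro!: DERIV_diff fy\<close>)
    then obtain \<eta> where \<eta>: "b < \<eta>" "\<eta> < b + h" "\<Delta> = h * (fy (a + h) \<eta> - fy a \<eta>)"
      by (auto simp: \<Delta>_def)
    have "\<exists>\<xi>>a. \<xi> < a + h \<and> fy (a + h) \<eta> - fy a \<eta> = (a + h - a) * fyx \<xi> \<eta>"
      by (rule MVT2) (use h X Y \<eta> in \<open>auto intro!: fyx\<close>)
    then show ?thesis using \<eta> that by auto
  qed
  have eq: "fxy \<xi> \<eta> = fyx \<xi>' \<eta>'" using 1(5) 2(5) h by simp
  have "dist (fxy \<xi> \<eta>) (fxy a b) < e" using D[OF near[of \<xi> \<eta>]] 1 by auto
  moreover have "dist (fyx \<xi>' \<eta>') (fyx a b) < e" using D[OF near[of \<xi>' \<eta>']] 2 by auto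
  ultimately have "\<bar>fxy a b - fyx a b\<bar> < 2 * e"
    unfolding eq dist_real_def by linarith
  then show False by (simp add: e_def)
qed

section \<open>Transport along characteristics and the source terms\<close>

text \<open>The integral of \<open>F\<close> over the incoming characteristic \<open>s + r = x\<close> between the times \<open>0\<close> and \<open>t\<close>.\<close>

definition ray :: "(real \<Rightarrow> real \<Rightarrow> real) \<Rightarrow> real \<Rightarrow> real \<Rightarrow> real" where
  "ray F t x = prim (\<lambda>s. F s (x - s)) t"

lemma ray_0 [simp]: "ray F 0 x = 0"
  by (simp add: ray_def)

lemma ray_diff:
  assumes "jcont F" "jcont H"
  shows "ray (\<lambda>s r. F s r - H s r) t x = ray F t x - ray H t x"
  unfolding ray_def
  by (rule prim_diff) (intro jcont_compose[OF assms(1)] jcont_compose[OF assms(2)] continuous_intros)+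

lemma jcont_ray:
  assumes F: "jcont F"
  shows "jcont (ray F)"
proof -
  have "continuous_on (UNIV \<times> cbox 0 1)
      (\<lambda>(z::real \<times> real, \<theta>::real). F (\<theta> * fst z) (snd z - \<theta> * fst z))"
    unfolding split_beta by (intro jcont_compose[OF F] continuous_intros)
  from integral_continuous_on_param[OF this]
  have "continuous_on UNIV
      (\<lambda>z::real \<times> real. fst z * integral {0..1} (\<lambda>\<theta>. F (\<theta> * fst z) (snd z - \<theta> * fst z)))"
    by (intro continuous_intros) (simp add: cbox_interval)
  then show ?thesis
    by (intro jcontI) (simp add: ray_def prim_def avg_def)
qed

lemma DERIV_ray_t:
  assumes F: "jcont F"
  shows "((\<lambda>t. ray F t x) has_real_derivative F t (x - t)) (at t)"
proof -
  have "continuous_on UNIV (\<lambda>s. F s (x - s))"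
    by (intro jcont_compose[OF F] continuous_intros)
  from DERIV_prim[OF this] show ?thesis by (simp add: ray_def)
qed

lemma DERIV_ray_x:
  assumes F: "jcont F" and F': "jcont F'"
    and d: "\<And>t r. ((\<lambda>r. F t r) has_real_derivative F' t r) (at r)"
  shows "((\<lambda>x. ray F t x) has_real_derivative ray F' t x) (at x)"
proof -
  have "((\<lambda>x. integral (cbox 0 1) (\<lambda>\<theta>. F (\<theta> * t) (x - \<theta> * t))) has_real_derivative
      integral (cbox 0 1) (\<lambda>\<theta>. F' (\<theta> * t) (x - \<theta> * t))) (at x within UNIV)"
  proof (rule leibniz_rule_field_derivative)
    fix x \<theta> :: real
    have "((\<lambda>x. F (\<theta> * t) (x - \<theta> * t)) has_real_derivative F' (\<theta> * t) (x - \<theta> * t) * 1) (at x)"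
      by (rule DERIV_chain2[OF d]) (auto intro!: derivative_eq_intros)
    then show "((\<lambda>x. F (\<theta> * t) (x - \<theta> * t)) has_real_derivative F' (\<theta> * t) (x - \<theta> * t))
        (at x within UNIV)" by simp
  next
    show "(\<lambda>\<theta>. F (\<theta> * t) (x - \<theta> * t)) integrable_on cbox 0 1" for x
      by (intro integrable_continuous jcont_compose[OF F] continuous_intros)
    show "continuous_on (UNIV \<times> cbox 0 1) (\<lambda>(x, \<theta>). F' (\<theta> * t) (x - \<theta> * t))"
      unfolding split_beta by (intro jcont_compose[OF F'] continuous_intros)
  qed auto
  from DERIV_cmult[OF this, of t] show ?thesis
    by (simp add: ray_def prim_def avg_def cbox_interval)
qed

text \<open>The solution of \<open>P_t - P_r = F\<close> with \<open>P(0, r) = a(r)\<close>.\<close>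

definition transport :: "(real \<Rightarrow> real) \<Rightarrow> (real \<Rightarrow> real \<Rightarrow> real) \<Rightarrow> real \<Rightarrow> real \<Rightarrow> real" where
  "transport a F t r = a (t + r) + ray F t (t + r)"

lemma jcont_transport:
  assumes a: "continuous_on UNIV a" and F: "jcont F"
  shows "jcont (transport a F)"
  unfolding transport_def
  by (intro jcontI continuous_on_add jcont_compose[OF jcont_ray[OF F]] continuous_on_compose2[OF a]
      continuous_intros) auto

lemma DERIV_transport_r:
  assumes F: "jcont F" and F': "jcont F'"
    and d: "\<And>t r. ((\<lambda>r. F t r) has_real_derivative F' t r) (at r)"
    and a: "\<And>x. (a has_real_derivative b x) (at x)"
  shows "((\<lambda>r. transport a F t r) has_real_derivative transport b F' t r) (at r)"
proof -
  have s: "((\<lambda>r. t + r) has_real_derivative 1) (at r)" by (auto intro!: derivative_eq_intros)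
  show ?thesis
    using DERIV_add[OF DERIV_chain2[OF a s] DERIV_chain2[OF DERIV_ray_x[OF F F' d] s]]
    by (simp add: transport_def)
qed

text \<open>At fixed \<open>r\<close> both the time and the label \<open>x = t + r\<close> of the characteristic move; the first contributes
\<open>F\<close>, the second the derivative in \<open>r\<close>.\<close>

lemma DERIV_transport_t:
  assumes F: "jcont F" and F': "jcont F'"
    and d: "\<And>t r. ((\<lambda>r. F t r) has_real_derivative F' t r) (at r)"
    and a: "\<And>x. (a has_real_derivative b x) (at x)"
  shows "((\<lambda>t. transport a F t r) has_real_derivative transport b F' t r + F t r) (at t)"
proof -
  have s: "((\<lambda>t. t + r) has_real_derivative 1) (at t)" by (auto intro!: derivative_eq_intros)
  have "((\<lambda>t. ray F t (t + r)) has_real_derivative 1 * F t (t + r - t) + 1 * ray F' t (t + r)) (at t)"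
  proof (rule DERIV_two_variables[where X = UNIV and Y = UNIV and f = "ray F" and fy = "ray F'"
        and fx = "\<lambda>t x. F t (x - t)" and \<alpha> = "\<lambda>t. t"])
    show "continuous_on (UNIV \<times> UNIV) (\<lambda>z. ray F' (fst z) (snd z))"
      using jcont_ray[OF F'] by (simp add: jcont_def)
  qed (use DERIV_ray_t[OF F] DERIV_ray_x[OF F F' d] s in auto)
  from DERIV_add[OF DERIV_chain2[OF a s] this] show ?thesis
    by (simp add: transport_def algebra_simps)
qed

locale nonlinearity =
  fixes G g :: "real \<Rightarrow> real"
  assumes DERIV_G: "(G has_real_derivative g p) (at p)"
    and cont_g: "continuous_on UNIV g"
    and G_0 [simp]: "G 0 = 0"
begin

lemma cont_G: "continuous_on UNIV G"
  by (intro continuous_at_imp_continuous_on ballI DERIV_isCont[OF DERIV_G])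

text \<open>For \<open>q = v_tr\<close> the mean \<open>avg (q t) r\<close> is \<open>v_t / r = u_t\<close>; hence \<open>src q\<close> is the right-hand side
of the equation for \<open>v = r u\<close>, and \<open>dsrc q\<close> is its derivative in \<open>r\<close>, by \<open>(v_t / r)_r = (q - v_t / r) / r\<close>.\<close>

definition src :: "(real \<Rightarrow> real \<Rightarrow> real) \<Rightarrow> real \<Rightarrow> real \<Rightarrow> real" where
  "src q t r = r * G (avg (q t) r)"

definition dsrc :: "(real \<Rightarrow> real \<Rightarrow> real) \<Rightarrow> real \<Rightarrow> real \<Rightarrow> real" where
  "dsrc q t r = G (avg (q t) r) + g (avg (q t) r) * (q t r - avg (q t) r)"

lemma jcont_src:
  assumes q: "jcont q"
  shows "jcont (src q)"
proof -
  have "continuous_on UNIV (\<lambda>z. snd z * G (avg (q (fst z)) (snd z)))"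
    by (intro continuous_on_mult continuous_on_compose2[OF cont_G] jcont_compose[OF jcont_avg[OF q]]
        continuous_on_fst continuous_on_snd continuous_on_id subset_UNIV)
  then show ?thesis by (simp add: jcont_def src_def)
qed

lemma jcont_dsrc:
  assumes q: "jcont q"
  shows "jcont (dsrc q)"
proof -
  have "continuous_on UNIV (\<lambda>z. G (avg (q (fst z)) (snd z)) +
      g (avg (q (fst z)) (snd z)) * (q (fst z) (snd z) - avg (q (fst z)) (snd z)))"
    by (intro continuous_on_mult continuous_on_add continuous_on_diff
        continuous_on_compose2[OF cont_G] continuous_on_compose2[OF cont_g]
        jcont_compose[OF jcont_avg[OF q]] jcont_compose[OF q]
        continuous_on_fst continuous_on_snd continuous_on_id subset_UNIV)
  then show ?thesis by (simp add: jcont_def dsrc_def)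
qed

lemma DERIV_src:
  assumes q: "jcont q"
  shows "((\<lambda>r. src q t r) has_real_derivative dsrc q t r) (at r)"
proof (cases "r = 0")
  case False
  have "((\<lambda>r. r * G (avg (q t) r)) has_real_derivative
      1 * G (avg (q t) r) + g (avg (q t) r) * ((q t r - avg (q t) r) / r) * r) (at r)"
    by (intro DERIV_mult DERIV_ident DERIV_chain2[OF DERIV_G] DERIV_avg jcont_section q False)
  with False show ?thesis by (simp add: src_def dsrc_def)
next
  case True
  have "isCont (\<lambda>r. G (avg (q t) r)) 0"
    using continuous_on_compose2[OF cont_G jcont_section[OF jcont_avg[OF q], of UNIV t]]
    by (auto simp: continuous_on_eq_continuous_at)
  then have "(\<lambda>r. G (avg (q t) r)) \<midarrow>0\<rightarrow> G (avg (q t) 0)"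
    by (simp add: isCont_def)
  moreover have "\<forall>\<^sub>F h in at (0::real). G (avg (q t) h) = (src q t h - src q t 0) / (h - 0)"
    by (simp add: eventually_at_filter src_def)
  ultimately have "(\<lambda>h. (src q t h - src q t 0) / (h - 0)) \<midarrow>0\<rightarrow> G (avg (q t) 0)"
    by (rule Lim_transform_eventually)
  then show ?thesis
    using True by (simp add: has_field_derivative_iff dsrc_def)
qed

lemma src_zero [simp]: "src (\<lambda>t r. 0) t r = 0" and dsrc_zero [simp]: "dsrc (\<lambda>t r. 0) t r = 0"
  by (simp_all add: src_def dsrc_def)

text \<open>With \<open>Q\<close> the transported function of datum \<open>b = a'\<close> and source \<open>dsrc q\<close>, this is \<open>v_tr\<close> computed from
\<open>v_r(t, r) = (P(t, r) + P(t, - r)) / 2\<close>.\<close>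

definition picard :: "(real \<Rightarrow> real) \<Rightarrow> (real \<Rightarrow> real \<Rightarrow> real) \<Rightarrow> real \<Rightarrow> real \<Rightarrow> real" where
  "picard b q t r = (transport b (dsrc q) t r + transport b (dsrc q) t (- r)) / 2"

lemma jcont_picard:
  assumes b: "continuous_on UNIV b" and q: "jcont q"
  shows "jcont (picard b q)"
proof -
  note Q = jcont_compose[OF jcont_transport[OF b jcont_dsrc[OF q]]]
  have "continuous_on UNIV (\<lambda>z. (transport b (dsrc q) (fst z) (snd z) +
      transport b (dsrc q) (fst z) (- snd z)) / 2)"
    by (intro continuous_on_divide continuous_on_add Q continuous_on_minus continuous_on_const
        continuous_on_fst continuous_on_snd continuous_on_id) simp
  then show ?thesis by (simp add: jcont_def picard_def)
qed

text \<open>One more integration in \<open>r\<close> yields \<open>v_t\<close> itself as a transport integral, whose source \<open>src q\<close> involves no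
\<open>q\<close> outside the mean. Bounding \<open>v_t\<close> in this way avoids the logarithm that integrating the decay of
\<open>q\<close> over \<open>[0, r]\<close> would cost.\<close>

lemma prim_picard:
  assumes a: "\<And>x. (a has_real_derivative b x) (at x)" and b: "continuous_on UNIV b" and q: "jcont q"
  shows "prim (picard b q t) r = (transport a (src q) t r - transport a (src q) t (- r)) / 2"
proof -
  let ?P = "transport a (src q) t" and ?Q = "transport b (dsrc q) t"
  have d: "(?P has_real_derivative ?Q r) (at r)" for r
    by (intro DERIV_transport_r jcont_src jcont_dsrc q DERIV_src a)
  have "((\<lambda>r. ?P (- r)) has_real_derivative ?Q (- r) * - 1) (at r)" for r
    by (rule DERIV_chain2[OF d]) (auto intro!: derivative_eq_intros)
  then have "((\<lambda>r. (?P r - ?P (- r)) / 2) has_real_derivative picard b q t r) (at r)" for r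
    using d unfolding picard_def by (auto intro!: derivative_eq_intros)
  from prim_eqI[OF this jcont_section[OF jcont_picard[OF b q]]] show ?thesis by simp
qed

end

section \<open>Dini nonlinearities and decay along characteristics\<close>

text \<open>What is used of the nonlinearity: \<open>Lam m\<close> is a Lipschitz constant of \<open>G'\<close> on \<open>[-m, m]\<close>, and it is a
monotone function of \<open>m\<close> that satisfies the Dini condition, with a bound \<open>D\<close> on its Dini integral.\<close>

locale dini_nonlinearity = nonlinearity +
  fixes R m0 D :: real and Lam :: "real \<Rightarrow> real"
  assumes R_pos: "0 < R" and m0_pos: "0 < m0"
    and Lam_nonneg: "\<And>m. 0 \<le> m \<Longrightarrow> m \<le> m0 \<Longrightarrow> 0 \<le> Lam m"
    and Lam_mono: "\<And>m n. 0 \<le> m \<Longrightarrow> m \<le> n \<Longrightarrow> n \<le> m0 \<Longrightarrow> Lam m \<le> Lam n"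
    and Lam_cont: "continuous_on {0..m0} Lam"
    and Lam_Dini: "\<And>y. 0 < y \<Longrightarrow> y \<le> m0 \<Longrightarrow> integral {y..m0} (\<lambda>\<tau>. Lam \<tau> / \<tau>) \<le> D"
    and g_0 [simp]: "g 0 = 0"
    and g_lipschitz: "\<And>m p p'. m \<le> m0 \<Longrightarrow> \<bar>p\<bar> \<le> m \<Longrightarrow> \<bar>p'\<bar> \<le> m \<Longrightarrow>
        \<bar>g p - g p'\<bar> \<le> Lam m * \<bar>p - p'\<bar>"
begin

lemma D_nonneg: "0 \<le> D"
  using Lam_Dini[of m0] m0_pos by simp

lemma g_bound:
  assumes "m \<le> m0" "\<bar>p\<bar> \<le> m"
  shows "\<bar>g p\<bar> \<le> Lam m * m"
proof -
  have m: "0 \<le> m" using assms by linarith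
  have "\<bar>g p\<bar> \<le> Lam m * \<bar>p\<bar>"
    using g_lipschitz[of m p 0] assms m by simp
  also have "\<dots> \<le> Lam m * m"
    using Lam_nonneg[of m] m assms by (intro mult_left_mono) auto
  finally show ?thesis .
qed

lemma G_lipschitz:
  assumes "m \<le> m0" "\<bar>p\<bar> \<le> m" "\<bar>p'\<bar> \<le> m"
  shows "\<bar>G p - G p'\<bar> \<le> Lam m * m * \<bar>p - p'\<bar>"
proof -
  have "norm (G p - G p') \<le> (Lam m * m) * norm (p - p')"
  proof (rule field_differentiable_bound)
    show "(G has_field_derivative g x) (at x within {-m..m})" for x
      using DERIV_G by (rule has_field_derivative_at_within)
    show "norm (g x) \<le> Lam m * m" if "x \<in> {-m..m}" for x
      using g_bound[of m x] assms that by auto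
  qed (use assms in auto)
  then show ?thesis by simp
qed

text \<open>Comparable to \<open>t - r + 2 R\<close> inside the support \<open>r \<le> t + R\<close>, but positive in the whole plane and even in both
variables, so that the estimates need neither the support condition nor a sign of \<open>t\<close>.\<close>

definition cone_weight :: "real \<Rightarrow> real \<Rightarrow> real" where
  "cone_weight t r = R + \<bar>\<bar>t\<bar> - \<bar>r\<bar>\<bar>"

text \<open>The decay in \<open>r\<close> of the source: a velocity of size \<open>m0 R / (R + |r|)\<close> is inserted in \<open>Lam\<close>.\<close>

definition profile :: "real \<Rightarrow> real" where
  "profile r = Lam (m0 * R / (R + \<bar>r\<bar>)) / (R + \<bar>r\<bar>)"

lemma cone_weight_ge: "R \<le> cone_weight t r" and cone_weight_pos: "0 < cone_weight t r" and cone_weight_minus [simp]: "cone_weight t (- r) = cone_weight t r"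
  "cone_weight (- t) r = cone_weight t r"
  using R_pos by (auto simp: cone_weight_def)

text \<open>Decay in the label \<open>x = t + r\<close> of a characteristic is stronger than decay in the distance to the light cone;
this is why all transport estimates are stated with \<open>R + |x|\<close>.\<close>

lemma cone_weight_le: "cone_weight t r \<le> R + \<bar>t + r\<bar>"
  unfolding cone_weight_def by linarith

lemma profile_arg: "0 < m0 * R / (R + \<bar>r\<bar>)" "m0 * R / (R + \<bar>r\<bar>) \<le> m0"
  using m0_pos R_pos by (auto simp: field_simps intro!: mult_nonneg_nonneg add_pos_nonneg)

lemma profile_minus [simp]: "profile (- r) = profile r"
  by (simp add: profile_def)

lemma profile_nonneg: "0 \<le> profile r"
  using profile_arg[of r] R_pos by (auto simp: profile_def intro!: divide_nonneg_nonneg Lam_nonneg)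

lemma profile_le: "profile r \<le> Lam m0 / (R + \<bar>r\<bar>)"
  unfolding profile_def using profile_arg[of r] R_pos
  by (intro divide_right_mono Lam_mono) auto

lemma Lam_m0_nonneg: "0 \<le> Lam m0"
  using Lam_nonneg[of m0] m0_pos by simp

lemma profile_cont: "continuous_on UNIV profile"
proof -
  have "continuous_on UNIV (\<lambda>r. Lam (m0 * R / (R + \<bar>r\<bar>)))"
  proof (rule continuous_on_compose2[OF Lam_cont])
    show "continuous_on UNIV (\<lambda>r. m0 * R / (R + \<bar>r\<bar>))"
      using R_pos by (intro continuous_intros) (auto simp: add_pos_nonneg less_imp_neq[symmetric])
    show "(\<lambda>r. m0 * R / (R + \<bar>r\<bar>)) ` UNIV \<subseteq> {0..m0}"
      using profile_arg by (auto simp: less_imp_le[OF profile_arg(1)] simp del: zero_le_divide_iff)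
  qed
  then show ?thesis
    unfolding profile_def
    using R_pos by (intro continuous_intros) (auto simp: add_pos_nonneg less_imp_neq[symmetric])
qed

text \<open>The substitution \<open>\<tau> = m0 R / (R + r)\<close> turns the integral of the profile into the Dini integral.\<close>

lemma prim_profile_bound: "\<bar>prim profile y\<bar> \<le> D"
proof -
  have pos: "\<bar>prim profile t\<bar> \<le> D" if t: "0 \<le> t" for t
  proof -
    define \<sigma> where "\<sigma> s = m0 * R / (R + s)" for s
    define h where "h \<tau> = Lam \<tau> / \<tau>" for \<tau>
    define J where "J s = integral {\<sigma> s..m0} h" for s
    have \<sigma>t: "0 < \<sigma> t" using m0_pos R_pos t by (simp add: \<sigma>_def)
    have \<sigma>in: "\<sigma> s \<in> {\<sigma> t..m0}" if "s \<in> {0..t}" for s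
    proof -
      have "m0 * R / (R + t) \<le> m0 * R / (R + s)"
        using that R_pos m0_pos by (intro divide_left_mono) auto
      moreover have "m0 * R / (R + s) \<le> m0"
        using profile_arg(2)[of s] that by simp
      ultimately show ?thesis by (simp add: \<sigma>_def)
    qed
    have hc: "continuous_on {\<sigma> t..m0} h"
      unfolding h_def using \<sigma>t
      by (intro continuous_on_divide continuous_on_subset[OF Lam_cont] continuous_on_id) auto
    note dI = integral_has_vector_derivative'[OF hc]
    have \<sigma>c: "continuous_on {0..t} \<sigma>"
      unfolding \<sigma>_def using R_pos by (intro continuous_intros) auto
    have "continuous_on {\<sigma> t..m0} (\<lambda>u. integral {u..m0} h)"
      using dI by (auto simp: continuous_on_eq_continuous_within intro!: has_vector_derivative_continuous[OF dI] simp del: atLeastAtMost_iff)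
    then have Jc: "continuous_on {0..t} J"
      unfolding J_def using \<sigma>c by (rule continuous_on_compose2) (use \<sigma>in in auto)
    have dJ: "(J has_real_derivative profile s) (at s)" if s: "0 < s" "s < t" for s
    proof -
      have less: "\<sigma> t < \<sigma> s" "\<sigma> s < m0"
        using s m0_pos R_pos by (auto simp: \<sigma>_def field_simps)
      have "((\<lambda>u. integral {u..m0} h) has_vector_derivative - h (\<sigma> s)) (at (\<sigma> s) within {\<sigma> t<..<m0})"
        by (rule has_vector_derivative_within_subset[OF dI]) (use less in auto)
      moreover have "\<sigma> s \<in> {\<sigma> t<..<m0}" using less by simp
      note at_within_open[OF this open_greaterThanLessThan]
      ultimately have "((\<lambda>u. integral {u..m0} h) has_real_derivative - h (\<sigma> s)) (at (\<sigma> s))"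
        by (simp only: has_real_derivative_iff_has_vector_derivative)
      moreover have "(\<sigma> has_real_derivative - (\<sigma> s / (R + s))) (at s)"
        unfolding \<sigma>_def using s R_pos
        by (auto intro!: derivative_eq_intros simp: field_simps power2_eq_square)
      ultimately have "(J has_real_derivative - h (\<sigma> s) * - (\<sigma> s / (R + s))) (at s)"
        unfolding J_def by (rule DERIV_chain2)
      moreover have "0 < \<sigma> s" using less \<sigma>t by linarith
      ultimately show ?thesis
        using s R_pos by (simp add: h_def profile_def \<sigma>_def[symmetric] abs_of_pos)
    qed
    have "\<bar>prim profile t\<bar> \<le> J t - J 0"
      by (rule prim_diff_bound[OF profile_cont t dJ Jc]) (simp_all add: profile_nonneg)
    also have "J 0 = 0" using R_pos by (simp add: J_def \<sigma>_def)
    also have "J t - 0 \<le> D"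
      using Lam_Dini[OF \<sigma>t] \<sigma>in[of t] t by (simp add: J_def h_def[abs_def])
    finally show ?thesis .
  qed
  show ?thesis
  proof (cases "0 \<le> y")
    case True then show ?thesis by (rule pos)
  next
    case False
    have "prim profile y = - prim profile (- y)"
      using prim_minus[of profile y] by simp
    then show ?thesis using pos[of "- y"] False by simp
  qed
qed

text \<open>On the characteristic \<open>s + r = x\<close> the weight is \<open>R + |2 s - x|\<close> as long as \<open>0 \<le> s \<le> x\<close>, and equal to
\<open>R + |x|\<close> afterwards or for \<open>x < 0\<close>. Once \<open>s \<ge> 3 x / 4\<close> it exceeds \<open>(R + |x|) / 2\<close>; before that time
\<open>r \<ge> x / 4\<close>, and the profile is small. The sum of the two bounds has an explicit antiderivative in \<open>s\<close>.\<close>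

lemma ray_weight_le:
  assumes s: "0 \<le> s"
  shows "profile (x - s) / (cone_weight s (x - s))\<^sup>2
    \<le> 4 * profile (x - s) / (R + \<bar>x\<bar>)\<^sup>2 + 4 * Lam m0 / (R + \<bar>x\<bar>) * (1 / (R\<^sup>2 + (2 * s - x)\<^sup>2))"
proof -
  let ?X = "R + \<bar>x\<bar>"
  have X: "0 < ?X" using R_pos by simp
  have Q: "0 < R\<^sup>2 + (2 * s - x)\<^sup>2" using R_pos by (simp add: add_pos_nonneg)
  have second: "0 \<le> 4 * Lam m0 / ?X * (1 / (R\<^sup>2 + (2 * s - x)\<^sup>2))"
    using Lam_m0_nonneg X Q by simp
  have first: "0 \<le> 4 * profile (x - s) / ?X\<^sup>2"
    using profile_nonneg by simp
  show ?thesis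
  proof (cases "x < 0 \<or> 3 * x \<le> 4 * s")
    case True
    then have "?X \<le> 2 * cone_weight s (x - s)"
      using s R_pos unfolding cone_weight_def by (smt (verit))
    then have "?X / 2 \<le> cone_weight s (x - s)" by simp
    then have "(?X / 2)\<^sup>2 \<le> (cone_weight s (x - s))\<^sup>2" using X by (intro power_mono) auto
    then have "profile (x - s) / (cone_weight s (x - s))\<^sup>2 \<le> profile (x - s) / (?X / 2)\<^sup>2"
      using X cone_weight_pos[of s "x - s"] profile_nonneg[of "x - s"]
      by (intro divide_left_mono mult_pos_pos zero_less_power) auto
    also have "\<dots> = 4 * profile (x - s) / ?X\<^sup>2" by (simp add: power_divide)
    finally show ?thesis using second by linarith
  next
    case False
    then have x: "0 \<le> x" "4 * s < 3 * x" by auto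
    have "?X \<le> 4 * (R + \<bar>x - s\<bar>)" using x R_pos by (smt (verit))
    then have "?X / 4 \<le> R + \<bar>x - s\<bar>" by simp
    then have "Lam m0 / (R + \<bar>x - s\<bar>) \<le> Lam m0 / (?X / 4)"
      using X R_pos Lam_m0_nonneg by (intro divide_left_mono) auto
    with profile_le[of "x - s"] have p: "profile (x - s) \<le> 4 * Lam m0 / ?X"
      by (simp add: mult.commute)
    have "cone_weight s (x - s) = R + \<bar>2 * s - x\<bar>" using x s unfolding cone_weight_def by linarith
    then have "R\<^sup>2 + (2 * s - x)\<^sup>2 \<le> (cone_weight s (x - s))\<^sup>2"
      using R_pos by (simp add: power2_sum)
    then have "profile (x - s) / (cone_weight s (x - s))\<^sup>2 \<le> (4 * Lam m0 / ?X) / (R\<^sup>2 + (2 * s - x)\<^sup>2)"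
      using p Q Lam_m0_nonneg X by (intro frac_le) auto
    then show ?thesis using first by simp
  qed
qed

definition ray_const :: real where
  "ray_const = (8 * D + 2 * pi * Lam m0) / R"

lemma ray_const_nonneg: "0 \<le> ray_const"
  using D_nonneg Lam_m0_nonneg R_pos by (simp add: ray_const_def)

text \<open>The central decay estimate. Both terms of \<open>ray_weight_le\<close> have a bounded integral over all times: the
first by the Dini condition, the second because its antiderivative is an arctangent.\<close>

lemma ray_bound:
  assumes F: "jcont F" and B: "0 \<le> B"
    and b: "\<And>s r. \<bar>F s r\<bar> \<le> B * (profile r / (cone_weight s r)\<^sup>2)"
  shows "\<bar>ray F t x\<bar> \<le> B * ray_const / (R + \<bar>x\<bar>)"
proof -
  have pos: "\<bar>ray F t x\<bar> \<le> B * ray_const / (R + \<bar>x\<bar>)"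
    if F: "jcont F" and b: "\<And>s r. \<bar>F s r\<bar> \<le> B * (profile r / (cone_weight s r)\<^sup>2)" and t: "0 \<le> t"
    for F t x
  proof -
    define X where "X = R + \<bar>x\<bar>"
    have X: "0 < X" "R \<le> X" using R_pos by (auto simp: X_def)
    \<comment> \<open>\<open>Z\<close> is an antiderivative of the bound \<open>z\<close> that \<open>ray_weight_le\<close> provides\<close>
    define Z where "Z s = B * (- 4 / X\<^sup>2 * prim profile (x - s)
        + 2 * Lam m0 / (R * X) * arctan ((2 * s - x) / R))" for s :: real
    define z where "z s = B * (4 * profile (x - s) / X\<^sup>2
        + 4 * Lam m0 / X * (1 / (R\<^sup>2 + (2 * s - x)\<^sup>2)))" for s :: real
    have dZ: "(Z has_real_derivative z s) (at s)" for s :: real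
    proof -
      have 1: "((\<lambda>s. prim profile (x - s)) has_real_derivative profile (x - s) * - 1) (at s)"
        by (rule DERIV_chain2[OF DERIV_prim[OF profile_cont]]) (auto intro!: derivative_eq_intros)
      have 2: "((\<lambda>s. (2 * s - x) / R) has_real_derivative 2 / R) (at s)"
        using R_pos by (auto intro!: derivative_eq_intros)
      have 3: "((\<lambda>s. arctan ((2 * s - x) / R)) has_real_derivative
          inverse (1 + ((2 * s - x) / R)\<^sup>2) * (2 / R)) (at s)"
        by (rule DERIV_chain2[OF DERIV_arctan 2])
      have "inverse (1 + ((2 * s - x) / R)\<^sup>2) * (2 / R) = 2 * R * (1 / (R\<^sup>2 + (2 * s - x)\<^sup>2))"
      proof -
        have "1 + ((2 * s - x) / R)\<^sup>2 = (R\<^sup>2 + (2 * s - x)\<^sup>2) / R\<^sup>2"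
          using R_pos by (simp add: power_divide add_divide_distrib)
        then show ?thesis using R_pos by (simp add: power2_eq_square)
      qed
      with 3 have 3: "((\<lambda>s. arctan ((2 * s - x) / R)) has_real_derivative
          2 * R * (1 / (R\<^sup>2 + (2 * s - x)\<^sup>2))) (at s)" by simp
      have "(Z has_real_derivative B * (- 4 / X\<^sup>2 * (profile (x - s) * - 1)
          + 2 * Lam m0 / (R * X) * (2 * R * (1 / (R\<^sup>2 + (2 * s - x)\<^sup>2))))) (at s)"
        unfolding Z_def by (intro DERIV_cmult DERIV_add 1 3)
      then show ?thesis using R_pos by (simp add: z_def)
    qed
    have "\<bar>ray F t x\<bar> \<le> Z t - Z 0"
      unfolding ray_def
    proof (rule prim_diff_bound[OF _ t dZ])
      show "continuous_on UNIV (\<lambda>s. F s (x - s))"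
        by (intro jcont_compose[OF F] continuous_intros)
      show "continuous_on {0..t} Z"
        by (intro continuous_at_imp_continuous_on ballI DERIV_isCont[OF dZ])
      fix s :: real assume "0 < s"
      then have "B * (profile (x - s) / (cone_weight s (x - s))\<^sup>2) \<le> z s"
        unfolding z_def X_def by (intro mult_left_mono ray_weight_le B) auto
      with b[of s "x - s"] show "\<bar>F s (x - s)\<bar> \<le> z s" by linarith
    qed
    also have "Z t - Z 0 = B * (4 / X\<^sup>2 * (prim profile x - prim profile (x - t))
        + 2 * Lam m0 / (R * X) * (arctan ((2 * t - x) / R) - arctan ((2 * 0 - x) / R)))"
      by (simp add: Z_def algebra_simps)
    also have "\<dots> \<le> B * (4 / X\<^sup>2 * (2 * D) + 2 * Lam m0 / (R * X) * pi)"
    proof -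
      have "prim profile x - prim profile (x - t) \<le> 2 * D"
        using prim_profile_bound[of x] prim_profile_bound[of "x - t"] by linarith
      moreover have "arctan ((2 * t - x) / R) - arctan ((2 * 0 - x) / R) \<le> pi"
        using arctan_ubound[of "(2 * t - x) / R"] arctan_lbound[of "(2 * 0 - x) / R"] by linarith
      ultimately show ?thesis
        using B X R_pos Lam_m0_nonneg by (intro mult_left_mono add_mono) auto
    qed
    also have "\<dots> \<le> B * (4 / (R * X) * (2 * D) + 2 * Lam m0 / (R * X) * pi)"
    proof -
      have "4 / X\<^sup>2 \<le> 4 / (R * X)"
        using X R_pos by (intro divide_left_mono) (auto simp: power2_eq_square)
      then show ?thesis using B D_nonneg by (intro mult_left_mono add_mono mult_right_mono) auto
    qed
    also have "\<dots> = B * ray_const / X"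
      using X R_pos by (simp add: ray_const_def field_simps)
    finally show ?thesis by (simp add: X_def)
  qed
  show ?thesis
  proof (cases "0 \<le> t")
    case True then show ?thesis by (rule pos[OF F b])
  next
    case False
    \<comment> \<open>reflect in both variables; weight and profile are even\<close>
    have "ray F t x = - ray (\<lambda>s r. F (- s) (- r)) (- t) (- x)"
      using prim_minus[of "\<lambda>s. F (- s) (x + s)" t] by (simp add: ray_def add.commute)
    moreover have "\<bar>ray (\<lambda>s r. F (- s) (- r)) (- t) (- x)\<bar> \<le> B * ray_const / (R + \<bar>- x\<bar>)"
    proof (rule pos)
      show "jcont (\<lambda>s r. F (- s) (- r))"
        by (intro jcontI jcont_compose[OF F] continuous_intros)
      show "\<bar>F (- s) (- r)\<bar> \<le> B * (profile r / (cone_weight s r)\<^sup>2)" for s r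
        using b[of "- s" "- r"] by simp
    qed (use False in simp)
    ultimately show ?thesis by simp
  qed
qed

text \<open>Closeness of two candidates for \<open>v_tr\<close> in the weighted norm. The primitives, that is the two candidates for
\<open>v_t\<close>, are measured in addition, since their decay does not follow from that of \<open>q\<close>.\<close>

definition near :: "real \<Rightarrow> (real \<Rightarrow> real \<Rightarrow> real) \<Rightarrow> (real \<Rightarrow> real \<Rightarrow> real) \<Rightarrow> bool" where
  "near \<delta> q q' \<longleftrightarrow> (\<forall>t r. \<bar>q t r - q' t r\<bar> \<le> \<delta> / cone_weight t r \<and>
     \<bar>prim (q t) r - prim (q' t) r\<bar> \<le> \<delta> / cone_weight t r)"

definition supported :: "(real \<Rightarrow> real \<Rightarrow> real) \<Rightarrow> bool" where
  "supported q \<longleftrightarrow> (\<forall>t r. 0 \<le> t \<longrightarrow> t + R < \<bar>r\<bar> \<longrightarrow> q t r = 0 \<and> prim (q t) r = 0)"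

definition admissible :: "real \<Rightarrow> (real \<Rightarrow> real \<Rightarrow> real) \<Rightarrow> bool" where
  "admissible \<kappa> q \<longleftrightarrow> jcont q \<and> near \<kappa> q (\<lambda>t r. 0) \<and> supported q"

definition avg_const :: real where "avg_const = 4 * R + 2"

lemma avg_const_pos: "0 < avg_const"
  using R_pos by (simp add: avg_const_def)

text \<open>For \<open>|r| > R\<close> divide the bound on the primitive by \<open>|r|\<close>; for \<open>|r| \<le> R\<close> average the bound on \<open>q\<close>, since the
weight at \<open>r\<close> is at most twice its value anywhere on the segment from \<open>0\<close> to \<open>r\<close>. Together this gains a factor \<open>1 / (R + |r|)\<close>.\<close>

lemma avg_near:
  assumes q: "jcont q" "jcont q'" and n: "near \<delta> q q'" and \<delta>: "0 \<le> \<delta>"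
  shows "\<bar>avg (q t) r - avg (q' t) r\<bar> \<le> avg_const * \<delta> / ((R + \<bar>r\<bar>) * cone_weight t r)"
proof (cases "\<bar>r\<bar> \<le> R")
  case True
  have "\<bar>avg (\<lambda>r. q t r - q' t r) r\<bar> \<le> 2 * \<delta> / cone_weight t r"
  proof (rule avg_bound)
    show "continuous_on UNIV (\<lambda>r. q t r - q' t r)"
      by (intro continuous_on_diff jcont_section q)
    fix \<theta> :: real assume \<theta>: "0 \<le> \<theta>" "\<theta> \<le> 1"
    have "\<bar>\<theta> * r\<bar> = \<theta> * \<bar>r\<bar>" using \<theta> by (simp add: abs_mult)
    moreover have "0 \<le> \<theta> * \<bar>r\<bar>" "\<theta> * \<bar>r\<bar> \<le> \<bar>r\<bar>"
      using \<theta> by (auto intro: mult_left_le_one_le)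
    ultimately have "cone_weight t r \<le> 2 * cone_weight t (\<theta> * r)"
      using True unfolding cone_weight_def by (smt (verit))
    then have "cone_weight t r / 2 \<le> cone_weight t (\<theta> * r)" by simp
    then have "\<delta> / cone_weight t (\<theta> * r) \<le> \<delta> / (cone_weight t r / 2)"
      using \<delta> cone_weight_pos by (intro divide_left_mono) auto
    moreover have "\<bar>q t (\<theta> * r) - q' t (\<theta> * r)\<bar> \<le> \<delta> / cone_weight t (\<theta> * r)"
      using n by (simp add: near_def)
    ultimately have "\<bar>q t (\<theta> * r) - q' t (\<theta> * r)\<bar> \<le> \<delta> / (cone_weight t r / 2)" by linarith
    then show "\<bar>q t (\<theta> * r) - q' t (\<theta> * r)\<bar> \<le> 2 * \<delta> / cone_weight t r" by (simp add: mult.commute)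
  qed
  also have "2 * \<delta> / cone_weight t r \<le> avg_const * \<delta> / ((R + \<bar>r\<bar>) * cone_weight t r)"
  proof -
    have "2 * (R + \<bar>r\<bar>) \<le> avg_const" using True by (simp add: avg_const_def)
    then have "2 * (R + \<bar>r\<bar>) * \<delta> \<le> avg_const * \<delta>" using \<delta> by (rule mult_right_mono)
    then have "2 * (R + \<bar>r\<bar>) * \<delta> / ((R + \<bar>r\<bar>) * cone_weight t r) \<le> avg_const * \<delta> / ((R + \<bar>r\<bar>) * cone_weight t r)"
      using cone_weight_pos[of t r] R_pos by (intro divide_right_mono) auto
    moreover have "2 * (R + \<bar>r\<bar>) * \<delta> / ((R + \<bar>r\<bar>) * cone_weight t r) = 2 * \<delta> / cone_weight t r"
    proof -
      have "2 * y * \<delta> / (y * cone_weight t r) = 2 * \<delta> / cone_weight t r" if "0 < y" for y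
        using that by simp
      from this[of "R + \<bar>r\<bar>"] show ?thesis using R_pos by linarith
    qed
    ultimately show ?thesis by simp
  qed
  finally show ?thesis by (simp add: avg_diff jcont_section q)
next
  case False
  then have r: "R < \<bar>r\<bar>" "0 < \<bar>r\<bar>" using R_pos by auto
  have "\<bar>r * (avg (q t) r - avg (q' t) r)\<bar> \<le> \<delta> / cone_weight t r"
    using n by (simp add: near_def prim_def right_diff_distrib)
  then have "\<bar>avg (q t) r - avg (q' t) r\<bar> \<le> \<delta> / (\<bar>r\<bar> * cone_weight t r)"
    using r cone_weight_pos[of t r] unfolding abs_mult by (simp add: pos_le_divide_eq mult_ac)
  also have "\<dots> \<le> avg_const * \<delta> / ((R + \<bar>r\<bar>) * cone_weight t r)"
  proof -
    have "\<delta> / (\<bar>r\<bar> * cone_weight t r) = 2 * \<delta> / ((2 * \<bar>r\<bar>) * cone_weight t r)" by simp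
    also have "\<dots> \<le> avg_const * \<delta> / ((R + \<bar>r\<bar>) * cone_weight t r)"
      using r \<delta> R_pos cone_weight_pos[of t r]
      by (intro frac_le mult_right_mono mult_nonneg_nonneg mult_pos_pos) (auto simp: avg_const_def)
    finally show ?thesis .
  qed
  finally show ?thesis .
qed

end

section \<open>Picard iteration\<close>

context dini_nonlinearity begin

definition source_const :: real where
  "source_const = avg_const\<^sup>2 + avg_const\<^sup>2 / R + 2 * avg_const * (1 + avg_const / R)"

lemma source_const_pos: "0 < source_const"
  using avg_const_pos R_pos by (auto simp: source_const_def intro!: add_pos_nonneg)

lemma near_sym: "near \<delta> q q' \<Longrightarrow> near \<delta> q' q"
  by (simp add: near_def abs_minus_commute)

lemma near_trans: "near \<delta> q q' \<Longrightarrow> near \<delta>' q' q'' \<Longrightarrow> near (\<delta> + \<delta>') q q''"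
  unfolding near_def add_divide_distrib by (smt (verit))

lemma admissible_zero: "0 \<le> \<kappa> \<Longrightarrow> admissible \<kappa> (\<lambda>t r. 0)"
  using cone_weight_pos by (auto simp: admissible_def near_def supported_def jcont_def less_imp_le)

text \<open>The source is quadratic in the velocity up to the factor \<open>Lam\<close>: each term of the difference contains one
factor bounded through \<open>\<kappa>\<close>, one factor bounded through \<open>\<delta>\<close>, and the value of \<open>Lam\<close> at the velocity
bound \<open>m\<close>. The case \<open>q' = 0\<close> is the bound on the source itself.\<close>

lemma source_near:
  assumes q: "admissible \<kappa> q" "admissible \<kappa> q'" and n: "near \<delta> q q'"
    and \<kappa>: "0 \<le> \<kappa>" "avg_const * \<kappa> \<le> m0 * R\<^sup>2" and \<delta>: "0 \<le> \<delta>"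
  shows "\<bar>src q t r - src q' t r\<bar> \<le> source_const * \<kappa> * \<delta> * (profile r / (cone_weight t r)\<^sup>2)"
    and "\<bar>dsrc q t r - dsrc q' t r\<bar> \<le> source_const * \<kappa> * \<delta> * (profile r / (cone_weight t r)\<^sup>2)"
proof -
  define c where "c = avg_const"
  define W where "W = R + \<bar>r\<bar>"
  define w where "w = cone_weight t r"
  define p p' where "p = avg (q t) r" and "p' = avg (q' t) r"
  define m where "m = c * \<kappa> / (W * w)"
  define d where "d = c * \<delta> / (W * w)"
  define l where "l = Lam (m0 * R / W)"
  have c: "0 < c" by (simp add: c_def avg_const_pos)
  have W: "0 < W" "R \<le> W" "\<bar>r\<bar> \<le> W" using R_pos by (auto simp: W_def)
  have w: "0 < w" "R \<le> w" using cone_weight_pos cone_weight_ge by (auto simp: w_def)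
  have jq: "jcont q" "jcont q'" using q by (auto simp: admissible_def)
  have nz: "near \<kappa> q (\<lambda>t r. 0)" "near \<kappa> q' (\<lambda>t r. 0)" using q by (auto simp: admissible_def)
  have j0: "jcont (\<lambda>t r. 0)" by (simp add: jcont_def)
  have p: "\<bar>p\<bar> \<le> m" "\<bar>p'\<bar> \<le> m"
    using avg_near[OF jq(1) j0 nz(1) \<kappa>(1), of t r] avg_near[OF jq(2) j0 nz(2) \<kappa>(1), of t r]
    by (simp_all add: p_def p'_def m_def c_def W_def w_def)
  have pd: "\<bar>p - p'\<bar> \<le> d"
    using avg_near[OF jq n \<delta>, of t r] by (simp add: p_def p'_def d_def c_def W_def w_def)
  have m_le: "m \<le> m0 * R / W"
  proof -
    have "m \<le> m0 * R\<^sup>2 / (W * R)"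
      unfolding m_def using \<kappa> c W w R_pos m0_pos
      by (intro frac_le mult_left_mono mult_pos_pos) (auto simp: c_def)
    then show ?thesis using R_pos by (simp add: power2_eq_square)
  qed
  have m0R: "m0 * R / W \<le> m0" using profile_arg(2)[of r] by (simp add: W_def)
  have m: "0 \<le> m" "m \<le> m0" using m_le m0R \<kappa> c W w by (auto simp: m_def)
  have Lm: "Lam m \<le> l" "0 \<le> l" "0 \<le> Lam m"
    using Lam_mono[OF m(1) m_le m0R] Lam_nonneg[OF m] by (auto simp: l_def)
  have d0: "0 \<le> d" using \<delta> c W w by (simp add: d_def)
  have prof: "profile r = l / W" by (simp add: profile_def l_def W_def)
  have dG: "\<bar>G p - G p'\<bar> \<le> l * m * d"
  proof -
    have "\<bar>G p - G p'\<bar> \<le> Lam m * m * \<bar>p - p'\<bar>" by (rule G_lipschitz[OF m(2) p])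
    also have "\<dots> \<le> l * m * d" using Lm m d0 pd by (intro mult_mono) auto
    finally show ?thesis .
  qed
  have dg: "\<bar>g p - g p'\<bar> \<le> l * d"
  proof -
    have "\<bar>g p - g p'\<bar> \<le> Lam m * \<bar>p - p'\<bar>" by (rule g_lipschitz[OF m(2) p])
    also have "\<dots> \<le> l * d" using Lm pd by (intro mult_mono) auto
    finally show ?thesis .
  qed
  have gp: "\<bar>g p\<bar> \<le> l * m"
  proof -
    have "\<bar>g p\<bar> \<le> Lam m * m" by (rule g_bound[OF m(2) p(1)])
    also have "\<dots> \<le> l * m" using Lm m by (intro mult_right_mono) auto
    finally show ?thesis .
  qed
  have frac: "c * x / (W * w) \<le> c / R * x / w" if "0 \<le> x" for x
  proof -
    have "c * x / (W * w) \<le> c * x / (R * w)"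
      using that c W w R_pos by (intro divide_left_mono mult_right_mono) auto
    then show ?thesis by simp
  qed
  have qd: "\<bar>(q t r - p) - (q' t r - p')\<bar> \<le> (1 + c / R) * \<delta> / w"
  proof -
    have "\<bar>q t r - q' t r\<bar> \<le> \<delta> / w" using n by (simp add: near_def w_def)
    then have "\<bar>(q t r - p) - (q' t r - p')\<bar> \<le> \<delta> / w + d" using pd by linarith
    also have "\<dots> \<le> \<delta> / w + c / R * \<delta> / w" using frac[OF \<delta>] by (simp add: d_def)
    finally show ?thesis by (simp add: distrib_right add_divide_distrib)
  qed
  have q'b: "\<bar>q' t r - p'\<bar> \<le> (1 + c / R) * \<kappa> / w"
  proof -
    have "\<bar>q' t r\<bar> \<le> \<kappa> / w" using nz(2) by (simp add: near_def w_def)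
    then have "\<bar>q' t r - p'\<bar> \<le> \<kappa> / w + m" using p(2) by linarith
    also have "\<dots> \<le> \<kappa> / w + c / R * \<kappa> / w" using frac[OF \<kappa>(1)] by (simp add: m_def)
    finally show ?thesis by (simp add: distrib_right add_divide_distrib)
  qed
  define B where "B = \<kappa> * \<delta> * (profile r / w\<^sup>2)"
  have B0: "0 \<le> B" using \<kappa> \<delta> profile_nonneg by (simp add: B_def)
  have BW: "\<kappa> * \<delta> * l / (W * w * w) = B"
    by (simp add: B_def prof power2_eq_square mult.assoc)
  have lmd: "W * (l * m * d) = c\<^sup>2 * B"
    using W w unfolding BW[symmetric] m_def d_def by (simp add: power2_eq_square field_simps)
  have K: "c\<^sup>2 \<le> source_const"
    "c\<^sup>2 / R + 2 * (c * (1 + c / R)) \<le> source_const"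
    using c R_pos by (auto simp: source_const_def c_def)
  have "\<bar>src q t r - src q' t r\<bar> = \<bar>r\<bar> * \<bar>G p - G p'\<bar>"
    by (simp add: src_def p_def p'_def abs_mult flip: right_diff_distrib)
  also have "\<dots> \<le> W * (l * m * d)" using W dG by (intro mult_mono) auto
  also have "\<dots> = c\<^sup>2 * B" by (rule lmd)
  also have "\<dots> \<le> source_const * B" using K(1) B0 by (rule mult_right_mono)
  finally show "\<bar>src q t r - src q' t r\<bar> \<le> source_const * \<kappa> * \<delta> * (profile r / (cone_weight t r)\<^sup>2)"
    by (simp add: B_def w_def mult.assoc)
  have 1: "\<bar>G p - G p'\<bar> \<le> c\<^sup>2 / R * B"
  proof -
    have "R * (l * m * d) \<le> W * (l * m * d)"
      using W Lm m d0 by (intro mult_right_mono) auto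
    then have "l * m * d \<le> c\<^sup>2 / R * B" using R_pos lmd by (simp add: field_simps)
    with dG show ?thesis by linarith
  qed
  have 2: "\<bar>g p * ((q t r - p) - (q' t r - p'))\<bar> \<le> c * (1 + c / R) * B"
  proof -
    have "\<bar>g p * ((q t r - p) - (q' t r - p'))\<bar> \<le> (l * m) * ((1 + c / R) * \<delta> / w)"
      unfolding abs_mult using gp qd Lm m by (intro mult_mono) auto
    also have "\<dots> = c * (1 + c / R) * B"
      using W w unfolding BW[symmetric] m_def by simp
    finally show ?thesis .
  qed
  have 3: "\<bar>(g p - g p') * (q' t r - p')\<bar> \<le> c * (1 + c / R) * B"
  proof -
    have "\<bar>(g p - g p') * (q' t r - p')\<bar> \<le> (l * d) * ((1 + c / R) * \<kappa> / w)"
      unfolding abs_mult using dg q'b Lm d0 by (intro mult_mono) auto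
    also have "\<dots> = c * (1 + c / R) * B"
      using W w unfolding BW[symmetric] d_def by simp
    finally show ?thesis .
  qed
  have "dsrc q t r - dsrc q' t r = (G p - G p') + g p * ((q t r - p) - (q' t r - p'))
      + (g p - g p') * (q' t r - p')"
    by (simp add: dsrc_def p_def p'_def algebra_simps)
  with 1 2 3 have "\<bar>dsrc q t r - dsrc q' t r\<bar> \<le> c\<^sup>2 / R * B + 2 * (c * (1 + c / R) * B)"
    by linarith
  also have "\<dots> = (c\<^sup>2 / R + 2 * (c * (1 + c / R))) * B" by (simp add: distrib_right)
  also have "\<dots> \<le> source_const * B" using K(2) B0 by (rule mult_right_mono)
  finally show "\<bar>dsrc q t r - dsrc q' t r\<bar> \<le> source_const * \<kappa> * \<delta> * (profile r / (cone_weight t r)\<^sup>2)"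
    by (simp add: B_def w_def mult.assoc)
qed

text \<open>The first bound keeps all velocities below \<open>m0\<close>, where \<open>Lam\<close> is available; the second makes
the Picard map a contraction with factor \<open>1/2\<close>.\<close>

definition small :: "real \<Rightarrow> bool" where
  "small \<kappa> \<longleftrightarrow> 0 \<le> \<kappa> \<and> avg_const * \<kappa> \<le> m0 * R\<^sup>2 \<and> source_const * \<kappa> * ray_const \<le> 1 / 2"

definition small_bound :: real where
  "small_bound = min (m0 * R\<^sup>2 / avg_const) (1 / (2 * (source_const * ray_const + 1)))"

lemma small_bound_pos: "0 < small_bound"
proof -
  have "0 < m0 * R\<^sup>2 / avg_const" using m0_pos R_pos avg_const_pos by simp
  moreover have "0 < source_const * ray_const + 1"
    using source_const_pos ray_const_nonneg by (intro add_nonneg_pos mult_nonneg_nonneg) auto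
  ultimately show ?thesis by (simp add: small_bound_def)
qed

lemma smallI:
  assumes "0 \<le> \<kappa>" "\<kappa> \<le> small_bound"
  shows "small \<kappa>"
proof -
  have k: "\<kappa> \<le> m0 * R\<^sup>2 / avg_const" "\<kappa> \<le> 1 / (2 * (source_const * ray_const + 1))"
    using assms(2) by (auto simp: small_bound_def)
  have pos: "0 \<le> source_const * ray_const" using source_const_pos ray_const_nonneg by simp
  have "source_const * ray_const * \<kappa> \<le> (source_const * ray_const + 1) * (1 / (2 * (source_const * ray_const + 1)))"
    using pos assms(1) k(2) by (intro mult_mono) auto
  also have "\<dots> = 1 / 2" using pos by (simp add: field_simps)
  finally have "source_const * \<kappa> * ray_const \<le> 1 / 2" by (simp add: mult_ac)
  moreover have "avg_const * \<kappa> \<le> m0 * R\<^sup>2"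
    using k(1) avg_const_pos by (simp add: pos_le_divide_eq mult.commute)
  ultimately show ?thesis using assms(1) by (simp add: small_def)
qed

lemma ray_near:
  assumes q: "admissible \<kappa> q" "admissible \<kappa> q'" and n: "near \<delta> q q'"
    and \<kappa>: "small \<kappa>" and \<delta>: "0 \<le> \<delta>"
  shows "\<bar>ray (src q) t x - ray (src q') t x\<bar> \<le> \<delta> / 2 / (R + \<bar>x\<bar>)"
    and "\<bar>ray (dsrc q) t x - ray (dsrc q') t x\<bar> \<le> \<delta> / 2 / (R + \<bar>x\<bar>)"
proof -
  have k: "0 \<le> \<kappa>" "avg_const * \<kappa> \<le> m0 * R\<^sup>2" "source_const * \<kappa> * ray_const \<le> 1 / 2"
    using \<kappa> by (auto simp: small_def)
  have jq: "jcont q" "jcont q'" using q by (auto simp: admissible_def)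
  have B: "0 \<le> source_const * \<kappa> * \<delta>"
    using k \<delta> source_const_pos by simp
  have "source_const * \<kappa> * \<delta> * ray_const / (R + \<bar>x\<bar>) = (source_const * \<kappa> * ray_const) * (\<delta> / (R + \<bar>x\<bar>))"
    by simp
  also have "\<dots> \<le> 1 / 2 * (\<delta> / (R + \<bar>x\<bar>))"
    using k \<delta> R_pos by (intro mult_right_mono) auto
  finally have *: "source_const * \<kappa> * \<delta> * ray_const / (R + \<bar>x\<bar>) \<le> \<delta> / 2 / (R + \<bar>x\<bar>)" by simp
  note js = jcont_src[OF jq(1)] jcont_src[OF jq(2)] jcont_dsrc[OF jq(1)] jcont_dsrc[OF jq(2)]
  have "jcont (\<lambda>t r. src q t r - src q' t r)" "jcont (\<lambda>t r. dsrc q t r - dsrc q' t r)"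
    using js by (auto simp: jcont_def intro!: continuous_on_diff)
  from ray_bound[OF this(1) B source_near(1)[OF q n k(1,2) \<delta>], of t x]
    ray_bound[OF this(2) B source_near(2)[OF q n k(1,2) \<delta>], of t x] *
  show "\<bar>ray (src q) t x - ray (src q') t x\<bar> \<le> \<delta> / 2 / (R + \<bar>x\<bar>)"
    and "\<bar>ray (dsrc q) t x - ray (dsrc q') t x\<bar> \<le> \<delta> / 2 / (R + \<bar>x\<bar>)"
    unfolding ray_diff[OF js(1,2)] ray_diff[OF js(3,4)] by linarith+
qed

lemma divide_cone_weight_mono: "0 \<le> c \<Longrightarrow> c / (R + \<bar>t + r\<bar>) \<le> c / cone_weight t r"
  using cone_weight_le[of t r] cone_weight_pos[of t r] R_pos by (intro divide_left_mono) auto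

lemma transport_near:
  assumes q: "admissible \<kappa> q" "admissible \<kappa> q'" and n: "near \<delta> q q'"
    and \<kappa>: "small \<kappa>" and \<delta>: "0 \<le> \<delta>"
  shows "\<bar>transport a (src q) t r - transport a (src q') t r\<bar> \<le> \<delta> / 2 / cone_weight t r"
    and "\<bar>transport b (dsrc q) t r - transport b (dsrc q') t r\<bar> \<le> \<delta> / 2 / cone_weight t r"
  using ray_near[OF assms, of t "t + r"] divide_cone_weight_mono[of "\<delta> / 2" t r] \<delta>
  by (auto simp: transport_def)

end

lemma vanishing_derivative:
  fixes a :: "real \<Rightarrow> real"
  assumes d: "(a has_real_derivative b) (at x)" and a: "\<And>x. R < \<bar>x\<bar> \<Longrightarrow> a x = 0" and x: "R < \<bar>x\<bar>"
  shows "b = 0"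
proof -
  have "open {x. R < \<bar>x\<bar>}" by (intro open_Collect_less continuous_intros)
  from eventually_nhds_in_open[OF this, of x] x have "\<forall>\<^sub>F y in nhds x. a y = 0"
    by (auto elim!: eventually_mono simp: a)
  with DERIV_cong_ev[OF refl this refl] have "((\<lambda>x. 0) has_real_derivative b) (at x)"
    using d by blast
  then show ?thesis using DERIV_unique DERIV_const by blast
qed

text \<open>The datum \<open>a = (v_t + v_r)(0, \<cdot>)\<close> on the whole line and its derivative. Half of the budget \<open>\<kappa>\<close> is left to the data,
the other half to the nonlinear term.\<close>

locale dini_data = dini_nonlinearity +
  fixes a b :: "real \<Rightarrow> real" and \<kappa> :: real
  assumes DERIV_a: "\<And>x. (a has_real_derivative b x) (at x)"
    and cont_b: "continuous_on UNIV b"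
    and a_bound: "\<And>x. \<bar>a x\<bar> \<le> \<kappa> / 2 / (R + \<bar>x\<bar>)"
    and b_bound: "\<And>x. \<bar>b x\<bar> \<le> \<kappa> / 2 / (R + \<bar>x\<bar>)"
    and a_support: "\<And>x. R < \<bar>x\<bar> \<Longrightarrow> a x = 0"
    and \<kappa>_small: "small \<kappa>"
begin

lemma b_support: "R < \<bar>x\<bar> \<Longrightarrow> b x = 0"
  using vanishing_derivative[OF DERIV_a a_support] .

lemma \<kappa>_nonneg: "0 \<le> \<kappa>" using \<kappa>_small by (simp add: small_def)

lemma picard_near:
  assumes q: "admissible \<kappa> q" "admissible \<kappa> q'" and n: "near \<delta> q q'" and \<delta>: "0 \<le> \<delta>"
  shows "near (\<delta> / 2) (picard b q) (picard b q')"
  unfolding near_def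
proof (intro allI conjI)
  have jq: "jcont q" "jcont q'" using q by (auto simp: admissible_def)
  note tn = transport_near[OF q n \<kappa>_small \<delta>]
  show "\<bar>picard b q t r - picard b q' t r\<bar> \<le> \<delta> / 2 / cone_weight t r" for t r
    using tn(2)[of b t r] tn(2)[of b t "- r"] unfolding picard_def cone_weight_minus by argo
  show "\<bar>prim (picard b q t) r - prim (picard b q' t) r\<bar> \<le> \<delta> / 2 / cone_weight t r" for t r
    using tn(1)[of a t r] tn(1)[of a t "- r"]
    unfolding prim_picard[OF DERIV_a cont_b jq(1)] prim_picard[OF DERIV_a cont_b jq(2)] cone_weight_minus
    by argo
qed

lemma transport_bound:
  assumes q: "admissible \<kappa> q"
  shows "\<bar>transport a (src q) t r\<bar> \<le> \<kappa> / cone_weight t r" "\<bar>transport b (dsrc q) t r\<bar> \<le> \<kappa> / cone_weight t r"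
proof -
  have "near \<kappa> q (\<lambda>t r. 0)" using q by (simp add: admissible_def)
  note tn = transport_near[OF q admissible_zero[OF \<kappa>_nonneg] this \<kappa>_small \<kappa>_nonneg, of _ t r]
  have z: "transport c (src (\<lambda>t r. 0)) t r = c (t + r)" "transport c (dsrc (\<lambda>t r. 0)) t r = c (t + r)" for c
    by (simp_all add: transport_def ray_def)
  have "\<bar>a (t + r)\<bar> \<le> \<kappa> / 2 / cone_weight t r" "\<bar>b (t + r)\<bar> \<le> \<kappa> / 2 / cone_weight t r"
    using a_bound[of "t + r"] b_bound[of "t + r"] divide_cone_weight_mono[of "\<kappa> / 2" t r] \<kappa>_nonneg by auto
  moreover have "\<kappa> / 2 / cone_weight t r + \<kappa> / 2 / cone_weight t r = \<kappa> / cone_weight t r" by simp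
  ultimately show "\<bar>transport a (src q) t r\<bar> \<le> \<kappa> / cone_weight t r" "\<bar>transport b (dsrc q) t r\<bar> \<le> \<kappa> / cone_weight t r"
    using tn(1)[of a] tn(2)[of b] unfolding z by linarith+
qed

lemma supported_sources:
  assumes q: "supported q" and s: "0 \<le> s" "s + R < \<bar>r\<bar>"
  shows "src q s r = 0" "dsrc q s r = 0"
proof -
  have "r \<noteq> 0" using s R_pos by auto
  then have "avg (q s) r = 0" "q s r = 0"
    using q s by (auto simp: supported_def prim_def)
  then show "src q s r = 0" "dsrc q s r = 0" by (auto simp: src_def dsrc_def)
qed

text \<open>Finite speed of propagation: a characteristic through a point with \<open>|r| > t + R\<close> stays in the region
\<open>|r| > s + R\<close> at all earlier times \<open>s\<close>.\<close>

lemma transport_supported: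
  assumes F: "\<And>s r. 0 \<le> s \<Longrightarrow> s + R < \<bar>r\<bar> \<Longrightarrow> F s r = 0"
    and c: "\<And>x. R < \<bar>x\<bar> \<Longrightarrow> c x = 0" and t: "0 \<le> t" "t + R < \<bar>r\<bar>"
  shows "transport c F t r = 0"
proof -
  have "avg (\<lambda>s. F s (t + r - s)) t = 0"
  proof (rule avg_eq_0)
    fix \<theta> :: real assume \<theta>: "0 \<le> \<theta>" "\<theta> \<le> 1"
    then have "0 \<le> \<theta> * t" "\<theta> * t \<le> t" using t by (auto intro: mult_left_le_one_le)
    then show "F (\<theta> * t) (t + r - \<theta> * t) = 0"
      using t by (intro F) (auto simp: abs_if split: if_splits)
  qed
  moreover have "c (t + r) = 0"
    using t R_pos by (intro c) (auto simp: abs_if split: if_splits)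
  ultimately show ?thesis by (simp add: transport_def ray_def prim_def)
qed

lemma admissible_picard:
  assumes q: "admissible \<kappa> q"
  shows "admissible \<kappa> (picard b q)"
proof -
  have jq: "jcont q" and sq: "supported q" using q by (auto simp: admissible_def)
  note tb = transport_bound[OF q]
  have "\<bar>picard b q t r\<bar> \<le> \<kappa> / cone_weight t r" for t r
    using tb(2)[of t r] tb(2)[of t "- r"] unfolding picard_def cone_weight_minus by argo
  moreover have "\<bar>prim (picard b q t) r\<bar> \<le> \<kappa> / cone_weight t r" for t r
    using tb(1)[of t r] tb(1)[of t "- r"] unfolding prim_picard[OF DERIV_a cont_b jq] cone_weight_minus by argo
  moreover have "picard b q t r = 0 \<and> prim (picard b q t) r = 0" if "0 \<le> t" "t + R < \<bar>r\<bar>" for t r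
    unfolding prim_picard[OF DERIV_a cont_b jq] unfolding picard_def
    using that transport_supported[of "src q" a t] transport_supported[of "dsrc q" b t]
      supported_sources[OF sq] a_support b_support by simp
  ultimately show ?thesis
    using jcont_picard[OF cont_b jq] by (simp add: admissible_def near_def supported_def)
qed

text \<open>The iterates form a geometric Cauchy sequence in the weighted norm. Their limit is uniform, so it is jointly
continuous, and the bounds, the support and the fixed point equation pass to it.\<close>

lemma picard_fixed_point:
  obtains q where "admissible \<kappa> q" "picard b q = q"
proof -
  define qn where "qn n = (picard b ^^ n) (\<lambda>t r. 0)" for n
  have qn_Suc: "qn (Suc n) = picard b (qn n)" for n by (simp add: qn_def)
  have adm: "admissible \<kappa> (qn n)" for n
    by (induction n) (simp_all add: qn_def admissible_zero \<kappa>_nonneg admissible_picard)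
  have step: "near (\<kappa> / 2 ^ n) (qn n) (qn (Suc n))" for n
  proof (induction n)
    case 0
    have "near \<kappa> (qn 1) (\<lambda>t r. 0)" using adm[of 1] by (simp add: admissible_def)
    from near_sym[OF this] show ?case by (simp add: qn_def)
  next
    case (Suc n)
    from picard_near[OF adm adm Suc] \<kappa>_nonneg show ?case by (simp add: qn_Suc mult.commute)
  qed
  have far: "near (2 * \<kappa> / 2 ^ n - 2 * \<kappa> / 2 ^ (n + k)) (qn n) (qn (n + k))" for n k
  proof (induction k)
    case 0
    then show ?case by (simp add: near_def)
  next
    case (Suc k)
    from near_trans[OF Suc step] show ?case by (simp add: field_simps)
  qed
  have far': "\<bar>qn n t r - qn m t r\<bar> \<le> 2 * \<kappa> / 2 ^ n / cone_weight t r"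
    "\<bar>prim (qn n t) r - prim (qn m t) r\<bar> \<le> 2 * \<kappa> / 2 ^ n / cone_weight t r" if nm: "n \<le> m" for n m t r
  proof -
    obtain k where m: "m = n + k" using le_Suc_ex[OF nm] by blast
    have "(2 * \<kappa> / 2 ^ n - 2 * \<kappa> / 2 ^ (n + k)) / cone_weight t r \<le> 2 * \<kappa> / 2 ^ n / cone_weight t r"
      using cone_weight_pos \<kappa>_nonneg by (intro divide_right_mono) (auto simp: less_imp_le)
    then show "\<bar>qn n t r - qn m t r\<bar> \<le> 2 * \<kappa> / 2 ^ n / cone_weight t r"
      "\<bar>prim (qn n t) r - prim (qn m t) r\<bar> \<le> 2 * \<kappa> / 2 ^ n / cone_weight t r"
      using far[of n k] order_trans unfolding near_def m by blast+
  qed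
  have pow: "(\<lambda>n. c / 2 ^ n) \<longlonglongrightarrow> 0" for c :: real
    using tendsto_mult_right_zero[OF LIMSEQ_power_zero[of "1 / 2 :: real"], of c]
    by (simp add: power_divide)
  have "Cauchy (\<lambda>n. qn n t r)" for t r
  proof (rule CauchyI)
    fix e :: real assume e: "0 < e"
    have "\<forall>\<^sub>F n in sequentially. (4 * \<kappa> / cone_weight t r) / 2 ^ n < e"
      using order_tendstoD(2)[OF pow e] .
    then obtain N where N: "(4 * \<kappa> / cone_weight t r) / 2 ^ N < e" by (auto simp: eventually_sequentially)
    have "\<bar>qn m t r - qn n t r\<bar> < e" if "N \<le> m" "N \<le> n" for m n
    proof -
      have "\<bar>qn m t r - qn n t r\<bar> \<le> 2 * \<kappa> / 2 ^ N / cone_weight t r + 2 * \<kappa> / 2 ^ N / cone_weight t r"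
        using far'(1)[OF that(1), of t r] far'(1)[OF that(2), of t r] by linarith
      also have "\<dots> = (4 * \<kappa> / cone_weight t r) / 2 ^ N" by simp
      finally show ?thesis using N by linarith
    qed
    then show "\<exists>M. \<forall>m\<ge>M. \<forall>n\<ge>M. norm (qn m t r - qn n t r) < e" by auto
  qed
  then have "\<exists>l. (\<lambda>n. qn n t r) \<longlonglongrightarrow> l" for t r
    using Cauchy_convergent convergent_def by blast
  then obtain q where lim: "(\<lambda>n. qn n t r) \<longlonglongrightarrow> q t r" for t r by metis
  have dist: "\<bar>qn n t r - q t r\<bar> \<le> 2 * \<kappa> / 2 ^ n / cone_weight t r" for n t r
  proof (rule LIMSEQ_le_const2)
    show "(\<lambda>m. \<bar>qn n t r - qn m t r\<bar>) \<longlonglongrightarrow> \<bar>qn n t r - q t r\<bar>"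
      by (intro tendsto_intros lim)
    show "\<exists>N. \<forall>m\<ge>N. \<bar>qn n t r - qn m t r\<bar> \<le> 2 * \<kappa> / 2 ^ n / cone_weight t r"
      using far'(1)[of n] by blast
  qed
  have distR: "\<bar>qn n t r - q t r\<bar> \<le> (2 * \<kappa> / R) / 2 ^ n" for n t r
  proof -
    have "2 * \<kappa> / 2 ^ n / cone_weight t r \<le> 2 * \<kappa> / 2 ^ n / R"
      using cone_weight_ge[of t r] cone_weight_pos[of t r] R_pos \<kappa>_nonneg by (intro divide_left_mono) auto
    with dist[of n t r] show ?thesis by (simp add: mult.commute)
  qed
  have jq: "jcont q"
    unfolding jcont_def
  proof (rule uniform_limit_theorem[where F = sequentially])
    show "\<forall>\<^sub>F n in sequentially. continuous_on UNIV (\<lambda>z. qn n (fst z) (snd z))"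
      using adm by (auto simp: admissible_def jcont_def)
    show "uniform_limit UNIV (\<lambda>n z. qn n (fst z) (snd z)) (\<lambda>z. q (fst z) (snd z)) sequentially"
    proof (rule uniform_limitI)
      fix e :: real assume "0 < e"
      from order_tendstoD(2)[OF pow this]
      have "\<forall>\<^sub>F n in sequentially. (2 * \<kappa> / R) / 2 ^ n < e" .
      then show "\<forall>\<^sub>F n in sequentially. \<forall>z\<in>UNIV. dist (qn n (fst z) (snd z)) (q (fst z) (snd z)) < e"
        by eventually_elim (auto simp: dist_real_def intro: le_less_trans[OF distR])
    qed
  qed simp
  have plim: "(\<lambda>n. prim (qn n t) r) \<longlonglongrightarrow> prim (q t) r" for t r
  proof -
    have "norm (prim (qn n t) r - prim (q t) r) \<le> \<bar>r\<bar> * (2 * \<kappa> / R) / 2 ^ n" for n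
    proof -
      have jn: "jcont (qn n)" using adm by (simp add: admissible_def)
      have "\<bar>avg (\<lambda>r. qn n t r - q t r) r\<bar> \<le> (2 * \<kappa> / R) / 2 ^ n"
        by (intro avg_bound continuous_on_diff jcont_section jn jq distR)
      then have "\<bar>r\<bar> * \<bar>avg (\<lambda>r. qn n t r - q t r) r\<bar> \<le> \<bar>r\<bar> * ((2 * \<kappa> / R) / 2 ^ n)"
        by (rule mult_left_mono) simp
      then show ?thesis
        by (simp add: avg_diff jcont_section jn jq prim_def abs_mult flip: right_diff_distrib)
    qed
    then have "(\<lambda>n. prim (qn n t) r - prim (q t) r) \<longlonglongrightarrow> 0"
      by (intro Lim_null_comparison[OF _ pow] always_eventually allI)
    then show ?thesis by (simp add: LIM_zero_iff)
  qed
  have near_q: "near (2 * \<kappa> / 2 ^ n) (qn n) q" for n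
    unfolding near_def
  proof (intro allI conjI dist)
    fix t r
    show "\<bar>prim (qn n t) r - prim (q t) r\<bar> \<le> 2 * \<kappa> / 2 ^ n / cone_weight t r"
    proof (rule LIMSEQ_le_const2)
      show "(\<lambda>m. \<bar>prim (qn n t) r - prim (qn m t) r\<bar>) \<longlonglongrightarrow> \<bar>prim (qn n t) r - prim (q t) r\<bar>"
        by (intro tendsto_intros plim)
      show "\<exists>N. \<forall>m\<ge>N. \<bar>prim (qn n t) r - prim (qn m t) r\<bar> \<le> 2 * \<kappa> / 2 ^ n / cone_weight t r"
        using far'(2)[of n] by blast
    qed
  qed
  have nn: "\<bar>qn n t r\<bar> \<le> \<kappa> / cone_weight t r" "\<bar>prim (qn n t) r\<bar> \<le> \<kappa> / cone_weight t r" for n t r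
    using adm[of n] by (auto simp: admissible_def near_def)
  have "near \<kappa> q (\<lambda>t r. 0)"
    unfolding near_def
  proof (intro allI conjI)
    fix t r
    show "\<bar>q t r - 0\<bar> \<le> \<kappa> / cone_weight t r"
      using LIMSEQ_le_const2[OF tendsto_rabs[OF lim[of t r]]] nn(1) by auto
    show "\<bar>prim (q t) r - prim (\<lambda>r. 0) r\<bar> \<le> \<kappa> / cone_weight t r"
      using LIMSEQ_le_const2[OF tendsto_rabs[OF plim[of t r]]] nn(2) by auto
  qed
  moreover have "supported q"
    unfolding supported_def
  proof (intro allI impI conjI)
    fix t r :: real assume tr: "0 \<le> t" "t + R < \<bar>r\<bar>"
    then have "qn n t r = 0" "prim (qn n t) r = 0" for n
      using adm[of n] by (auto simp: admissible_def supported_def)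
    then show "q t r = 0" "prim (q t) r = 0"
      using lim[of t r] plim[of t r] by (auto simp: LIMSEQ_const_iff)
  qed
  ultimately have q: "admissible \<kappa> q" using jq by (simp add: admissible_def)
  have "picard b q t r = q t r" for t r
  proof -
    have "(\<lambda>n. picard b (qn n) t r) \<longlonglongrightarrow> picard b q t r"
    proof -
      have "norm (picard b (qn n) t r - picard b q t r) \<le> (\<kappa> / cone_weight t r) / 2 ^ n" for n
        using picard_near[OF adm[of n] q near_q] \<kappa>_nonneg by (simp add: near_def mult.commute)
      then have "(\<lambda>n. picard b (qn n) t r - picard b q t r) \<longlonglongrightarrow> 0"
        by (intro Lim_null_comparison[OF _ pow] always_eventually allI)
      then show ?thesis by (simp add: LIM_zero_iff)
    qed
    moreover have "(\<lambda>n. picard b (qn n) t r) \<longlonglongrightarrow> q t r"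
      using LIMSEQ_Suc[OF lim[of t r]] by (simp add: qn_Suc)
    ultimately show ?thesis by (rule LIMSEQ_unique)
  qed
  then have "picard b q = q" by (intro ext)
  with q that show ?thesis by blast
qed

end

section \<open>From the fixed point to the solution\<close>

context dini_data begin

text \<open>The functions attached to a fixed point \<open>q\<close>, for \<open>v = r u\<close>: \<open>V = v_r\<close>, \<open>w = v_t\<close>, \<open>Y = v_rr\<close>,
\<open>q = v_tr = v_rt\<close> and \<open>U' = u_r\<close>. Outside the cone \<open>r \<le> t + R\<close> one has \<open>v_t = 0\<close>, so \<open>u\<close> keeps its
initial value there.\<close>

lemma fixed_point_solution:
  obtains u V Y w q U' where
    "\<And>t r. (V t has_real_derivative Y t r) (at r)"
    "\<And>t r. ((\<lambda>t. V t r) has_real_derivative q t r) (at t)"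
    "\<And>t r. (w t has_real_derivative q t r) (at r)"
    "\<And>t r. ((\<lambda>t. w t r) has_real_derivative Y t r + r * G (avg (q t) r)) (at t)"
    "\<And>t r. ((\<lambda>r. r * u t r) has_real_derivative V t r) (at r)"
    "\<And>t r. ((\<lambda>t. r * u t r) has_real_derivative w t r) (at t)"
    "\<And>t r. (u t has_real_derivative U' t r) (at r)"
    "\<And>t r. ((\<lambda>t. u t r) has_real_derivative avg (q t) r) (at t)"
    "jcont V" "jcont Y" "jcont q" "jcont w" "jcont (\<lambda>t r. r * G (avg (q t) r))" "jcont u" "jcont U'"
    "jcont (\<lambda>t. avg (q t))"
    "\<And>t r. u t r = avg (V t) r" "\<And>t r. U' t r = integral {0..1} (\<lambda>\<theta>. \<theta> * Y t (\<theta> * r))"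
    "\<And>t r. w t r = r * avg (q t) r"
    "\<And>t r. \<bar>V t r\<bar> \<le> \<kappa> / cone_weight t r" "\<And>t r. \<bar>Y t r\<bar> \<le> \<kappa> / cone_weight t r" "\<And>t r. \<bar>q t r\<bar> \<le> \<kappa> / cone_weight t r"
    "\<And>t r. \<bar>w t r\<bar> \<le> \<kappa> / cone_weight t r"
    "\<And>t r. \<bar>r * G (avg (q t) r)\<bar> \<le> source_const * \<kappa> * \<kappa> * (profile r / (cone_weight t r)\<^sup>2)"
    "\<And>t r. 0 \<le> t \<Longrightarrow> t + R < r \<Longrightarrow> u t r = u 0 r"
    "\<And>r. V 0 r = (a r + a (- r)) / 2" "\<And>r. w 0 r = (a r - a (- r)) / 2" "q 0 0 = b 0"
proof -
  obtain q where q: "admissible \<kappa> q" and fix_q: "picard b q = q"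
    by (rule picard_fixed_point)
  have jq: "jcont q" and sq: "supported q" and nq: "near \<kappa> q (\<lambda>t r. 0)"
    using q by (auto simp: admissible_def)
  define P where "P = transport a (src q)"
  define Q where "Q = transport b (dsrc q)"
  define V where "V t r = (P t r + P t (- r)) / 2" for t r
  define Y where "Y t r = (Q t r - Q t (- r)) / 2" for t r
  define w where "w t = prim (q t)" for t
  define u where "u t = avg (V t)" for t
  define U' where "U' t r = integral {0..1} (\<lambda>\<theta>. \<theta> * Y t (\<theta> * r))" for t r
  have ca: "continuous_on UNIV a"
    by (intro continuous_at_imp_continuous_on ballI DERIV_isCont[OF DERIV_a])
  have qQ: "q t r = (Q t r + Q t (- r)) / 2" for t r
    using fun_cong[OF fun_cong[OF fix_q], of t r] by (simp add: picard_def Q_def)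
  have wP: "w t r = (P t r - P t (- r)) / 2" for t r
    unfolding w_def using prim_picard[OF DERIV_a cont_b jq, of t r] by (simp add: fix_q P_def)
  have even: "q t (- r) = q t r" for t r by (simp add: qQ)
  have "avg (q t) (- r) = avg (q t) r" for t r
    using avg_minus[of "q t" r] by (simp add: even)
  then have odd: "src q t (- r) = - src q t r" for t r by (simp add: src_def)
  have dPr: "(P t has_real_derivative Q t r) (at r)" for t r
    unfolding P_def Q_def by (intro DERIV_transport_r jcont_src jcont_dsrc jq DERIV_src DERIV_a)
  have dPr': "((\<lambda>r. P t (- r)) has_real_derivative - Q t (- r)) (at r)" for t r
  proof -
    have "((\<lambda>r. - r) has_real_derivative - 1) (at r)" by (auto intro!: derivative_eq_intros)
    from DERIV_chain2[OF dPr this] show ?thesis by simp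
  qed
  have dPt: "((\<lambda>t. P t r) has_real_derivative Q t r + src q t r) (at t)" for t r
    unfolding P_def Q_def by (intro DERIV_transport_t jcont_src jcont_dsrc jq DERIV_src DERIV_a)
  have jP: "jcont P" and jQ: "jcont Q"
    unfolding P_def Q_def
    by (intro jcont_transport jcont_src jcont_dsrc jq ca cont_b)+
  have jneg: "jcont (\<lambda>t r. f t (- r))" if "jcont f" for f
    using jcont_compose[OF that, of UNIV fst "\<lambda>z. - snd z"]
    by (simp add: jcont_def continuous_on_fst continuous_on_snd continuous_on_minus)
  have jV: "jcont V"
    using jP jneg[OF jP] unfolding jcont_def V_def
    by (intro continuous_on_divide continuous_on_add continuous_on_const) auto
  have jY: "jcont Y"
    using jQ jneg[OF jQ] unfolding jcont_def Y_def
    by (intro continuous_on_divide continuous_on_diff continuous_on_const) auto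
  have dVr: "(V t has_real_derivative Y t r) (at r)" for t r
    unfolding V_def[abs_def] Y_def
    by (auto intro!: derivative_eq_intros dPr dPr')
  have dVt: "((\<lambda>t. V t r) has_real_derivative q t r) (at t)" for t r
    unfolding V_def[abs_def] qQ
    by (auto intro!: derivative_eq_intros dPt simp: odd)
  have dwr: "(w t has_real_derivative q t r) (at r)" for t r
    unfolding w_def by (intro DERIV_prim jcont_section jq)
  have dwt: "((\<lambda>t. w t r) has_real_derivative Y t r + r * G (avg (q t) r)) (at t)" for t r
  proof -
    have "((\<lambda>t. (P t r - P t (- r)) / 2) has_real_derivative
        (Q t r + src q t r - (Q t (- r) + src q t (- r))) / 2) (at t)"
      by (intro DERIV_cdivide DERIV_diff dPt)
    moreover have "(Q t r + src q t r - (Q t (- r) + src q t (- r))) / 2 = Y t r + r * G (avg (q t) r)"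
      unfolding odd Y_def src_def[symmetric] by (simp add: field_simps)
    ultimately show ?thesis by (simp add: wP)
  qed
  have jU': "jcont U'"
  proof -
    have "continuous_on (UNIV \<times> cbox 0 1) (\<lambda>(z::real \<times> real, \<theta>::real). \<theta> * Y (fst z) (\<theta> * snd z))"
      unfolding split_beta by (intro continuous_on_mult jcont_compose[OF jY] continuous_intros)
    from integral_continuous_on_param[OF this] show ?thesis
      by (intro jcontI) (simp add: U'_def cbox_interval)
  qed
  have bP: "\<bar>P t r\<bar> \<le> \<kappa> / cone_weight t r" "\<bar>P t (- r)\<bar> \<le> \<kappa> / cone_weight t r"
    "\<bar>Q t r\<bar> \<le> \<kappa> / cone_weight t r" "\<bar>Q t (- r)\<bar> \<le> \<kappa> / cone_weight t r" for t r
    unfolding P_def Q_def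
    using transport_bound[OF q, of t r] transport_bound[OF q, of t "- r"] by auto
  have sP: "P t r = 0" if "0 \<le> t" "t + R < \<bar>r\<bar>" for t r
    unfolding P_def by (intro transport_supported a_support supported_sources sq that)
  show ?thesis
  proof (rule that[where u = u and V = V and Y = Y and w = w and q = q and U' = U'])
    show "((\<lambda>r. r * u t r) has_real_derivative V t r) (at r)" for t r
      using DERIV_prim[OF jcont_section[OF jV]] by (simp add: u_def prim_def[abs_def])
    have dut: "((\<lambda>t. u t r) has_real_derivative avg (q t) r) (at t)" for t r
      unfolding u_def by (intro DERIV_avg_param dVt jV jq)
    then show "((\<lambda>t. u t r) has_real_derivative avg (q t) r) (at t)" for t r .
    show "((\<lambda>t. r * u t r) has_real_derivative w t r) (at t)" for t r
      using DERIV_cmult[OF dut] by (simp add: w_def prim_def)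
    show "(u t has_real_derivative U' t r) (at r)" for t r
      unfolding u_def U'_def by (intro DERIV_avg_C1 dVr jcont_section jY)
    show "jcont w" unfolding w_def by (intro jcont_prim jq)
    show "jcont (\<lambda>t r. r * G (avg (q t) r))" using jcont_src[OF jq] by (simp add: src_def[abs_def])
    show "jcont u" unfolding u_def by (intro jcont_avg jV)
    show "\<bar>V t r\<bar> \<le> \<kappa> / cone_weight t r" for t r using bP[of t r] unfolding V_def by argo
    show "\<bar>Y t r\<bar> \<le> \<kappa> / cone_weight t r" for t r using bP[of t r] unfolding Y_def by argo
    show "\<bar>q t r\<bar> \<le> \<kappa> / cone_weight t r" for t r using bP[of t r] unfolding qQ by argo
    show "\<bar>w t r\<bar> \<le> \<kappa> / cone_weight t r" for t r using bP[of t r] unfolding wP by argo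
    show "\<bar>r * G (avg (q t) r)\<bar> \<le> source_const * \<kappa> * \<kappa> * (profile r / (cone_weight t r)\<^sup>2)" for t r
      using source_near(1)[OF q admissible_zero nq] \<kappa>_small by (simp add: src_def small_def)
    show "u t r = u 0 r" if tr: "0 \<le> t" "t + R < r" for t r
    proof (cases "t = 0")
      case False
      have "\<exists>z>0. z < t \<and> r * u t r - r * u 0 r = (t - 0) * w z r"
      proof (rule MVT2)
        show "((\<lambda>t. r * u t r) has_real_derivative w s r) (at s)" for s
          using DERIV_cmult[OF dut] by (simp add: w_def prim_def)
      qed (use False tr in simp)
      moreover have "w z r = 0" if "0 < z" "z < t" for z
        using sq tr that R_pos by (auto simp: w_def supported_def)
      ultimately have "r * u t r = r * u 0 r" by auto
      moreover have "r \<noteq> 0" using tr R_pos by auto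
      ultimately show ?thesis by simp
    qed simp
    show "V 0 r = (a r + a (- r)) / 2" for r by (simp add: V_def P_def transport_def)
    show "w 0 r = (a r - a (- r)) / 2" for r by (simp add: wP P_def transport_def)
    show "q 0 0 = b 0" by (simp add: qQ Q_def transport_def)
  qed (use dVr dVt dwr dwt jV jY jq jU' jcont_avg[OF jq] in
      \<open>simp_all add: u_def U'_def w_def prim_def\<close>)
qed

end

section \<open>Calculus on the closed quadrant and uniqueness\<close>

lemma at_within_atLeast_not_bot: "0 \<le> x \<Longrightarrow> at x within {0::real..} \<noteq> bot"
proof -
  assume "0 \<le> x"
  have "x islimpt {0..}"
  proof (rule connected_imp_perfect)
    show "{0..} \<noteq> {y}" for y :: real
    proof
      assume "{0..} = {y}"
      then have "0 \<in> {y}" "1 \<in> {y}" by (metis atLeast_iff order_refl zero_le_one)+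
      then show False by simp
    qed
  qed (use \<open>0 \<le> x\<close> in auto)
  then show ?thesis by (simp add: trivial_limit_within)
qed

lemma deriv_on_eq:
  assumes "(f has_real_derivative d) (at x within {0..})" "0 \<le> x"
  shows "deriv_on {0..} f x = d"
  unfolding deriv_on_def
  using vector_derivative_within[OF at_within_atLeast_not_bot] assms
  by (simp add: has_real_derivative_iff_has_vector_derivative)

lemma DERIV_deriv_on:
  assumes "f differentiable (at x within S)"
  shows "(f has_real_derivative deriv_on S f x) (at x within S)"
  unfolding deriv_on_def has_real_derivative_iff_has_vector_derivative
  using assms vector_derivative_works by blast

lemma deriv_on_cong:
  assumes "\<And>s. 0 \<le> s \<Longrightarrow> f s = h s" "f differentiable (at x within {0..})" "0 \<le> x"
  shows "deriv_on {0..} f x = deriv_on {0..} h x"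
proof -
  have "(h has_real_derivative deriv_on {0..} f x) (at x within {0..})"
    by (rule has_field_derivative_transform_within[OF DERIV_deriv_on[OF assms(2)], of 1])
       (use assms in auto)
  from deriv_on_eq[OF this assms(3)] show ?thesis by simp
qed

lemma at_within_atLeast_interior: "0 < x \<Longrightarrow> at x within {0::real..} = at x"
  by (rule Elementary_Topology.at_within_interior) simp

lemma Ck_quadrant_SucD:
  assumes "Ck_quadrant (Suc k) h"
  shows "continuous_on ({0..} \<times> {0..}) (\<lambda>z. h (fst z) (snd z))"
    and "\<And>t r. 0 \<le> t \<Longrightarrow> 0 \<le> r \<Longrightarrow> ((\<lambda>s. h s r) has_real_derivative partial_t h t r) (at t within {0..})"
    and "\<And>t r. 0 \<le> t \<Longrightarrow> 0 \<le> r \<Longrightarrow> (h t has_real_derivative partial_r h t r) (at r within {0..})"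
    and "Ck_quadrant k (partial_t h)" "Ck_quadrant k (partial_r h)"
proof -
  show "continuous_on ({0..} \<times> {0..}) (\<lambda>z. h (fst z) (snd z))"
    and "Ck_quadrant k (partial_t h)" "Ck_quadrant k (partial_r h)"
    using assms by (auto simp: split_beta')
  show "((\<lambda>s. h s r) has_real_derivative partial_t h t r) (at t within {0..})"
    "(h t has_real_derivative partial_r h t r) (at r within {0..})" if "0 \<le> t" "0 \<le> r" for t r
    using assms that unfolding partial_t_def partial_r_def by (auto intro!: DERIV_deriv_on)
qed

lemma Ck_quadrant_cont:
  assumes "Ck_quadrant k h"
  shows "continuous_on ({0..} \<times> {0..}) (\<lambda>z. h (fst z) (snd z))"
  using assms by (cases k) (auto simp: split_beta')

lemma continuous_on_quadrant_compose:
  assumes "continuous_on ({0..} \<times> {0..}) (\<lambda>z. h (fst z) (snd z))"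
    and "continuous_on S \<alpha>" "continuous_on S \<beta>"
    and "\<And>x. x \<in> S \<Longrightarrow> (0::real) \<le> \<alpha> x" "\<And>x. x \<in> S \<Longrightarrow> (0::real) \<le> \<beta> x"
  shows "continuous_on S (\<lambda>x. h (\<alpha> x) (\<beta> x))"
  using continuous_on_compose2[OF assms(1) continuous_on_Pair[OF assms(2,3)]] assms(4,5) by auto

text \<open>Along \<open>r' = \<mp> 1\<close> the derivative of \<open>v_t \<plusminus> v_r\<close> is \<open>v_tt - v_rr\<close>, because the mixed derivatives cancel.\<close>

lemma characteristic_derivatives:
  assumes v: "Ck_quadrant 2 v"
    and s: "0 < s" "0 < r" and \<beta>: "\<beta> s = r"
  shows "(\<beta> has_real_derivative -1) (at s) \<Longrightarrow>
      ((\<lambda>s. partial_t v s (\<beta> s) + partial_r v s (\<beta> s)) has_real_derivative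
        partial_t (partial_t v) s r - partial_r (partial_r v) s r) (at s)"
    and "(\<beta> has_real_derivative 1) (at s) \<Longrightarrow>
      ((\<lambda>s. partial_t v s (\<beta> s) - partial_r v s (\<beta> s)) has_real_derivative
        partial_t (partial_t v) s r - partial_r (partial_r v) s r) (at s)"
proof -
  note v2 = v[unfolded numeral_2_eq_2]
  note D = Ck_quadrant_SucD[OF v2]
  note Dt = Ck_quadrant_SucD[OF D(4)]
  note Dr = Ck_quadrant_SucD[OF D(5)]
  have sub: "{0<..} \<times> {0<..} \<subseteq> {0::real..} \<times> {0::real..}" by auto
  have mixed: "partial_r (partial_t v) s r = partial_t (partial_r v) s r"
  proof (rule mixed_partials_eq[where f = v and X = "{0<..}" and Y = "{0<..}" and fx = "partial_t v"
        and fy = "partial_r v" and fxy = "partial_r (partial_t v)" and fyx = "partial_t (partial_r v)"])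
    show "((\<lambda>x. v x y) has_real_derivative partial_t v x y) (at x)"
      "((\<lambda>y. v x y) has_real_derivative partial_r v x y) (at y)"
      "((\<lambda>y. partial_t v x y) has_real_derivative partial_r (partial_t v) x y) (at y)"
      "((\<lambda>x. partial_r v x y) has_real_derivative partial_t (partial_r v) x y) (at x)"
      if "x \<in> {0<..}" "y \<in> {0<..}" for x y
      using that D(2,3)[of x y] Dt(3)[of x y] Dr(2)[of x y] by (simp_all add: at_within_atLeast_interior)
    show "continuous_on ({0<..} \<times> {0<..}) (\<lambda>z. partial_r (partial_t v) (fst z) (snd z))"
      "continuous_on ({0<..} \<times> {0<..}) (\<lambda>z. partial_t (partial_r v) (fst z) (snd z))"
      using Ck_quadrant_cont[OF Dt(5)] Ck_quadrant_cont[OF Dr(4)] continuous_on_subset[OF _ sub] by blast+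
  qed (use s in auto)
  have t_along: "((\<lambda>s. partial_t v s (\<beta> s)) has_real_derivative
      1 * partial_t (partial_t v) s (\<beta> s) + b' * partial_r (partial_t v) s (\<beta> s)) (at s)"
    if "(\<beta> has_real_derivative b') (at s)" for b'
  proof (rule DERIV_two_variables[where X = "{0<..}" and Y = "{0<..}" and f = "partial_t v"
        and fx = "partial_t (partial_t v)" and fy = "partial_r (partial_t v)" and \<alpha> = "\<lambda>s. s"])
    show "continuous_on ({0<..} \<times> {0<..}) (\<lambda>z. partial_r (partial_t v) (fst z) (snd z))"
      using Ck_quadrant_cont[OF Dt(5)] continuous_on_subset[OF _ sub] by blast
    show "((\<lambda>x. partial_t v x y) has_real_derivative partial_t (partial_t v) x y) (at x)"
      "((\<lambda>y. partial_t v x y) has_real_derivative partial_r (partial_t v) x y) (at y)"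
      if "x \<in> {0<..}" "y \<in> {0<..}" for x y
      using that Dt(2,3)[of x y] by (simp_all add: at_within_atLeast_interior)
  qed (use s \<beta> that in auto)
  have r_along: "((\<lambda>s. partial_r v s (\<beta> s)) has_real_derivative
      1 * partial_t (partial_r v) s (\<beta> s) + b' * partial_r (partial_r v) s (\<beta> s)) (at s)"
    if "(\<beta> has_real_derivative b') (at s)" for b'
  proof (rule DERIV_two_variables[where X = "{0<..}" and Y = "{0<..}" and f = "partial_r v"
        and fx = "partial_t (partial_r v)" and fy = "partial_r (partial_r v)" and \<alpha> = "\<lambda>s. s"])
    show "continuous_on ({0<..} \<times> {0<..}) (\<lambda>z. partial_r (partial_r v) (fst z) (snd z))"
      using Ck_quadrant_cont[OF Dr(5)] continuous_on_subset[OF _ sub] by blast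
    show "((\<lambda>x. partial_r v x y) has_real_derivative partial_t (partial_r v) x y) (at x)"
      "((\<lambda>y. partial_r v x y) has_real_derivative partial_r (partial_r v) x y) (at y)"
      if "x \<in> {0<..}" "y \<in> {0<..}" for x y
      using that Dr(2,3)[of x y] by (simp_all add: at_within_atLeast_interior)
  qed (use s \<beta> that in auto)
  show "((\<lambda>s. partial_t v s (\<beta> s) + partial_r v s (\<beta> s)) has_real_derivative
        partial_t (partial_t v) s r - partial_r (partial_r v) s r) (at s)"
    if "(\<beta> has_real_derivative -1) (at s)"
    using DERIV_add[OF t_along[OF that] r_along[OF that]] by (simp add: \<beta> mixed)
  show "((\<lambda>s. partial_t v s (\<beta> s) - partial_r v s (\<beta> s)) has_real_derivative
        partial_t (partial_t v) s r - partial_r (partial_r v) s r) (at s)"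
    if "(\<beta> has_real_derivative 1) (at s)"
    using DERIV_diff[OF t_along[OF that] r_along[OF that]] by (simp add: \<beta> mixed)
qed

lemma partials_times_r:
  assumes u: "Ck_quadrant 1 u" and tr: "0 \<le> t" "0 \<le> r"
  shows "partial_t (times_r u) t r = r * partial_t u t r"
    and "partial_r (times_r u) t r = u t r + r * partial_r u t r"
proof -
  note D = Ck_quadrant_SucD[OF u[unfolded One_nat_def]]
  have "((\<lambda>s. r * u s r) has_real_derivative r * partial_t u t r) (at t within {0..})"
    by (rule DERIV_cmult[OF D(2)[OF tr]])
  from deriv_on_eq[OF this tr(1)] show "partial_t (times_r u) t r = r * partial_t u t r"
    by (simp add: partial_t_def times_r_def)
  have "((\<lambda>s. s * u t s) has_real_derivative 1 * u t r + partial_r u t r * r) (at r within {0..})"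
    by (rule DERIV_mult[OF DERIV_ident D(3)[OF tr]])
  from deriv_on_eq[OF this tr(2)] show "partial_r (times_r u) t r = u t r + r * partial_r u t r"
    by (simp add: partial_r_def times_r_def mult.commute)
qed

lemma bounded_on_triangle:
  fixes h :: "real \<Rightarrow> real \<Rightarrow> real"
  assumes "continuous_on ({0..} \<times> {0..}) (\<lambda>z. h (fst z) (snd z))"
  obtains B where "0 \<le> B" "\<And>t r. 0 \<le> t \<Longrightarrow> 0 \<le> r \<Longrightarrow> t + r \<le> T \<Longrightarrow> \<bar>h t r\<bar> \<le> B"
proof -
  have "compact ({0..T} \<times> {0..T})" by (intro compact_Times compact_Icc)
  moreover have "continuous_on ({0..T} \<times> {0..T}) (\<lambda>z. h (fst z) (snd z))"
    by (rule continuous_on_subset[OF assms]) auto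
  ultimately have "bounded ((\<lambda>z. h (fst z) (snd z)) ` ({0..T} \<times> {0..T}))"
    by (intro compact_imp_bounded compact_continuous_image)
  then obtain B where B: "0 < B" "\<And>z. z \<in> {0..T} \<times> {0..T} \<Longrightarrow> \<bar>h (fst z) (snd z)\<bar> \<le> B"
    by (auto simp: bounded_pos)
  show ?thesis
    by (rule that[of B]) (use B(1) B(2)[of "(_, _)"] in auto)
qed

context nonlinearity begin

lemma G_locally_lipschitz:
  obtains L where "0 \<le> L" "\<And>p p'. \<bar>p\<bar> \<le> N \<Longrightarrow> \<bar>p'\<bar> \<le> N \<Longrightarrow> \<bar>G p - G p'\<bar> \<le> L * \<bar>p - p'\<bar>"
proof -
  have "bounded (g ` {-N..N})"
    by (intro compact_imp_bounded compact_continuous_image continuous_on_subset[OF cont_g]) auto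
  then obtain L where L: "0 < L" "\<And>x. x \<in> {-N..N} \<Longrightarrow> \<bar>g x\<bar> \<le> L"
    by (auto simp: bounded_pos)
  have "norm (G p - G p') \<le> L * norm (p - p')" if "\<bar>p\<bar> \<le> N" "\<bar>p'\<bar> \<le> N" for p p'
  proof (rule field_differentiable_bound)
    show "(G has_field_derivative g x) (at x within {-N..N})" for x
      using DERIV_G by (rule has_field_derivative_at_within)
  qed (use L that in auto)
  with L(1) show ?thesis by (intro that[of L]) auto
qed

text \<open>An induction on \<open>n\<close> improves the bound \<open>M (L t)^n / n!\<close> on \<open>d = v1_t - v2_t\<close> by integrating it along the
incoming and the outgoing characteristic. An outgoing one that starts on the axis \<open>r = 0\<close> is continued by an
incoming one, since \<open>d = 0\<close> there.\<close>

lemma classical_solution_unique: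
  assumes G: "\<And>p. G p = \<bar>p\<bar>\<^sup>2 * \<mu> \<bar>p\<bar>"
    and 1: "classical_solution \<mu> g0 g1 u1" and 2: "classical_solution \<mu> g0 g1 u2"
    and tr: "0 \<le> t" "0 \<le> r"
  shows "u1 t r = u2 t r"
proof -
  define v1 v2 where "v1 = times_r u1" and "v2 = times_r u2"
  have C1: "Ck_quadrant 1 u1" "Ck_quadrant 1 u2" and C2: "Ck_quadrant 2 v1" "Ck_quadrant 2 v2"
    using 1 2 by (auto simp: classical_solution_def v1_def v2_def)
  note D1 = Ck_quadrant_SucD[OF C2(1)[unfolded numeral_2_eq_2]]
  note D2 = Ck_quadrant_SucD[OF C2(2)[unfolded numeral_2_eq_2]]
  note E1 = Ck_quadrant_SucD[OF C1(1)[unfolded One_nat_def]]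
  note E2 = Ck_quadrant_SucD[OF C1(2)[unfolded One_nat_def]]
  define d where "d t r = partial_t v1 t r - partial_t v2 t r" for t r
  define e where "e t r = partial_r v1 t r - partial_r v2 t r" for t r
  have dc: "continuous_on ({0..} \<times> {0..}) (\<lambda>z. d (fst z) (snd z))"
    and ec: "continuous_on ({0..} \<times> {0..}) (\<lambda>z. e (fst z) (snd z))"
    unfolding d_def e_def
    by (intro continuous_on_diff Ck_quadrant_cont[OF D1(4)] Ck_quadrant_cont[OF D2(4)]
        Ck_quadrant_cont[OF D1(5)] Ck_quadrant_cont[OF D2(5)])+
  have du: "d t r = r * (partial_t u1 t r - partial_t u2 t r)" if "0 \<le> t" "0 \<le> r" for t r
    using partials_times_r(1)[OF C1(1) that] partials_times_r(1)[OF C1(2) that]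
    by (simp add: d_def v1_def v2_def right_diff_distrib)
  have partials: "partial (1, 0) h = partial_t h" "partial (2, 0) h = partial_t (partial_t h)"
    "partial (0, 2) h = partial_r (partial_r h)" for h
    by (simp_all add: partial_def numeral_2_eq_2)
  have eq1: "partial_t (partial_t v1) t r - partial_r (partial_r v1) t r = r * G (partial_t u1 t r)"
    and eq2: "partial_t (partial_t v2) t r - partial_r (partial_r v2) t r = r * G (partial_t u2 t r)"
    if "0 < t" "0 \<le> r" for t r
    using 1 2 that by (simp_all add: classical_solution_def v1_def v2_def partials G del: One_nat_def)
  have init: "u1 0 r = g0 r" "u2 0 r = g0 r" "partial_t u1 0 r = g1 r" "partial_t u2 0 r = g1 r"
    if "0 \<le> r" for r
    using 1 2 that by (simp_all add: classical_solution_def partials del: One_nat_def)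
  have d0: "d 0 r = 0" if "0 \<le> r" for r
    using du[of 0 r] init that by simp
  have dr0: "d t 0 = 0" if "0 \<le> t" for t
    using du[of t 0] that by simp
  have e0: "e 0 r = 0" if "0 \<le> r" for r
  proof -
    have "partial_r v1 0 r = partial_r v2 0 r"
      unfolding partial_r_def
    proof (rule deriv_on_cong[OF _ _ that])
      show "(\<lambda>s. v1 0 s) differentiable at r within {0..}"
        using D1(3)[of 0 r] that by (auto simp: real_differentiable_def)
    qed (use init in \<open>simp add: v1_def v2_def times_r_def\<close>)
    then show ?thesis by (simp add: e_def)
  qed
  have d_zero: "d t r = 0" if tr: "0 \<le> t" "0 \<le> r" for t r
  proof -
    define T where "T = t + r"
    obtain N1 where N1: "\<And>t r. 0 \<le> t \<Longrightarrow> 0 \<le> r \<Longrightarrow> t + r \<le> T \<Longrightarrow> \<bar>partial_t u1 t r\<bar> \<le> N1"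
      using bounded_on_triangle[OF Ck_quadrant_cont[OF E1(4)]] by blast
    obtain N2 where N2: "\<And>t r. 0 \<le> t \<Longrightarrow> 0 \<le> r \<Longrightarrow> t + r \<le> T \<Longrightarrow> \<bar>partial_t u2 t r\<bar> \<le> N2"
      using bounded_on_triangle[OF Ck_quadrant_cont[OF E2(4)]] by blast
    obtain M where M: "0 \<le> M" "\<And>t r. 0 \<le> t \<Longrightarrow> 0 \<le> r \<Longrightarrow> t + r \<le> T \<Longrightarrow> \<bar>d t r\<bar> \<le> M"
      using bounded_on_triangle[OF dc] by blast
    obtain L where L: "0 \<le> L"
      "\<And>p p'. \<bar>p\<bar> \<le> max N1 N2 \<Longrightarrow> \<bar>p'\<bar> \<le> max N1 N2 \<Longrightarrow> \<bar>G p - G p'\<bar> \<le> L * \<bar>p - p'\<bar>"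
      using G_locally_lipschitz by blast
    have source: "\<bar>r * G (partial_t u1 t r) - r * G (partial_t u2 t r)\<bar> \<le> L * \<bar>d t r\<bar>"
      if "0 \<le> t" "0 \<le> r" "t + r \<le> T" for t r
    proof -
      have "\<bar>G (partial_t u1 t r) - G (partial_t u2 t r)\<bar> \<le> L * \<bar>partial_t u1 t r - partial_t u2 t r\<bar>"
        using N1[OF that] N2[OF that] by (intro L(2)) auto
      then have "r * \<bar>G (partial_t u1 t r) - G (partial_t u2 t r)\<bar>
          \<le> r * (L * \<bar>partial_t u1 t r - partial_t u2 t r\<bar>)"
        using that by (intro mult_left_mono) auto
      then show ?thesis
        using that by (simp add: du abs_mult mult.left_commute flip: right_diff_distrib)
    qed
    have iter: "\<bar>d t r\<bar> \<le> M * (L * t) ^ n / fact n" if "0 \<le> t" "0 \<le> r" "t + r \<le> T" for n t r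
      using that
    proof (induction n arbitrary: t r)
      case 0
      then show ?case using M(2) by simp
    next
      case (Suc n)
      define \<phi> where "\<phi> s = M * (L * s) ^ Suc n / fact (Suc n)" for s
      define \<phi>' where "\<phi>' s = L * (M * (L * s) ^ n / fact n)" for s
      have \<phi>0: "\<phi> 0 = 0" by (simp add: \<phi>_def)
      have d\<phi>: "(\<phi> has_real_derivative \<phi>' s) (at s)" for s
      proof -
        have "(\<phi> has_real_derivative M * (real (Suc n) * (L * s) ^ n * L) / fact (Suc n)) (at s)"
          unfolding \<phi>_def
          by (auto intro!: derivative_eq_intros simp del: power_Suc fact_Suc simp: mult.commute)
        moreover have "M * (real (Suc n) * (L * s) ^ n * L) / fact (Suc n) = \<phi>' s"
          by (simp add: \<phi>'_def fact_Suc del: of_nat_Suc)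
        ultimately show ?thesis by simp
      qed
      have \<phi>c: "continuous_on S \<phi>" for S
        by (intro continuous_at_imp_continuous_on ballI DERIV_isCont[OF d\<phi>])
      have along: "\<bar>h b - h a\<bar> \<le> \<phi> b - \<phi> a"
        if ab: "0 \<le> a" "a \<le> b" and hc: "continuous_on {a..b} h"
          and dh: "\<And>s. a < s \<Longrightarrow> s < b \<Longrightarrow> (h has_real_derivative
            (partial_t (partial_t v1) s (\<beta> s) - partial_r (partial_r v1) s (\<beta> s))
            - (partial_t (partial_t v2) s (\<beta> s) - partial_r (partial_r v2) s (\<beta> s))) (at s)"
          and \<beta>: "\<And>s. a < s \<Longrightarrow> s < b \<Longrightarrow> 0 \<le> \<beta> s \<and> s + \<beta> s \<le> T"
        for a b h \<beta>
      proof (cases "a = b")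
        case False
        then have "a < b" using ab by simp
        then have "norm (h b - h a) \<le> \<phi> b - \<phi> a"
        proof (rule differentiable_bound_general[OF _ hc \<phi>c])
          fix s assume s: "a < s" "s < b"
          show "(h has_vector_derivative (partial_t (partial_t v1) s (\<beta> s) - partial_r (partial_r v1) s (\<beta> s))
            - (partial_t (partial_t v2) s (\<beta> s) - partial_r (partial_r v2) s (\<beta> s))) (at s)"
            using dh[OF s] by (simp add: has_real_derivative_iff_has_vector_derivative)
          show "(\<phi> has_vector_derivative \<phi>' s) (at s)"
            using d\<phi> by (simp add: has_real_derivative_iff_has_vector_derivative)
          have sb: "0 < s" "0 \<le> \<beta> s" "s + \<beta> s \<le> T" using s \<beta>[OF s] ab by auto
          have "\<bar>\<beta> s * G (partial_t u1 s (\<beta> s)) - \<beta> s * G (partial_t u2 s (\<beta> s))\<bar> \<le> L * \<bar>d s (\<beta> s)\<bar>"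
            using sb by (intro source) auto
          also have "\<dots> \<le> \<phi>' s"
            unfolding \<phi>'_def using sb by (intro mult_left_mono Suc.IH L) auto
          finally show "norm ((partial_t (partial_t v1) s (\<beta> s) - partial_r (partial_r v1) s (\<beta> s))
            - (partial_t (partial_t v2) s (\<beta> s) - partial_r (partial_r v2) s (\<beta> s))) \<le> \<phi>' s"
            using sb by (simp add: eq1 eq2)
        qed
        then show ?thesis by simp
      qed simp
      have incoming: "\<bar>d t r + e t r\<bar> \<le> \<phi> t" if "0 \<le> t" "0 \<le> r" "t + r \<le> T" for t r
      proof -
        define \<beta> where "\<beta> s = t + r - s" for s
        have "\<bar>(d t (\<beta> t) + e t (\<beta> t)) - (d 0 (\<beta> 0) + e 0 (\<beta> 0))\<bar> \<le> \<phi> t - \<phi> 0"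
        proof (rule along[where h = "\<lambda>s. d s (\<beta> s) + e s (\<beta> s)" and \<beta> = \<beta>])
          show "continuous_on {0..t} (\<lambda>s. d s (\<beta> s) + e s (\<beta> s))"
            using that unfolding \<beta>_def
            by (intro continuous_on_add continuous_on_quadrant_compose[OF dc]
                continuous_on_quadrant_compose[OF ec] continuous_intros) auto
          fix s assume s: "0 < s" "s < t"
          have \<beta>: "0 < \<beta> s" using s that by (simp add: \<beta>_def)
          have d\<beta>: "(\<beta> has_real_derivative -1) (at s)"
            unfolding \<beta>_def by (auto intro!: derivative_eq_intros)
          show "((\<lambda>s. d s (\<beta> s) + e s (\<beta> s)) has_real_derivative
            (partial_t (partial_t v1) s (\<beta> s) - partial_r (partial_r v1) s (\<beta> s))
            - (partial_t (partial_t v2) s (\<beta> s) - partial_r (partial_r v2) s (\<beta> s))) (at s)"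
            using DERIV_diff[OF characteristic_derivatives(1)[OF C2(1) s(1) \<beta> refl d\<beta>]
                characteristic_derivatives(1)[OF C2(2) s(1) \<beta> refl d\<beta>]]
            by (simp add: d_def e_def algebra_simps)
          show "0 \<le> \<beta> s \<and> s + \<beta> s \<le> T" using \<beta> that by (simp add: \<beta>_def)
        qed (use that in auto)
        then show ?thesis using d0[of "t + r"] e0[of "t + r"] that by (simp add: \<beta>_def \<phi>0)
      qed
      have outgoing: "\<bar>(d t r - e t r) - (d a (r - t + a) - e a (r - t + a))\<bar> \<le> \<phi> t - \<phi> a"
        if "0 \<le> a" "a \<le> t" "t - r \<le> a" "0 \<le> r" "t + r \<le> T" for a t r
      proof -
        define \<beta> where "\<beta> s = r - t + s" for s
        have "\<bar>(d t (\<beta> t) - e t (\<beta> t)) - (d a (\<beta> a) - e a (\<beta> a))\<bar> \<le> \<phi> t - \<phi> a"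
        proof (rule along[where h = "\<lambda>s. d s (\<beta> s) - e s (\<beta> s)" and \<beta> = \<beta>])
          show "continuous_on {a..t} (\<lambda>s. d s (\<beta> s) - e s (\<beta> s))"
            using that unfolding \<beta>_def
            by (intro continuous_on_diff continuous_on_quadrant_compose[OF dc]
                continuous_on_quadrant_compose[OF ec] continuous_intros) auto
          fix s assume s: "a < s" "s < t"
          have \<beta>: "0 < \<beta> s" "0 < s" using s that by (auto simp: \<beta>_def)
          have d\<beta>: "(\<beta> has_real_derivative 1) (at s)"
            unfolding \<beta>_def by (auto intro!: derivative_eq_intros)
          show "((\<lambda>s. d s (\<beta> s) - e s (\<beta> s)) has_real_derivative
            (partial_t (partial_t v1) s (\<beta> s) - partial_r (partial_r v1) s (\<beta> s))
            - (partial_t (partial_t v2) s (\<beta> s) - partial_r (partial_r v2) s (\<beta> s))) (at s)"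
            using DERIV_diff[OF characteristic_derivatives(2)[OF C2(1) \<beta>(2,1) refl d\<beta>]
                characteristic_derivatives(2)[OF C2(2) \<beta>(2,1) refl d\<beta>]]
            by (simp add: d_def e_def algebra_simps)
          show "0 \<le> \<beta> s \<and> s + \<beta> s \<le> T" using \<beta> s that by (simp add: \<beta>_def)
        qed (use that in auto)
        then show ?thesis by (simp add: \<beta>_def)
      qed
      have out: "\<bar>d t r - e t r\<bar> \<le> \<phi> t"
      proof (cases "t \<le> r")
        case True
        then show ?thesis
          using outgoing[of 0 t r] Suc.prems d0[of "r - t"] e0[of "r - t"] by (simp add: \<phi>0)
      next
        case False
        have "\<bar>d (t - r) 0 + e (t - r) 0\<bar> \<le> \<phi> (t - r)"
          using False Suc.prems by (intro incoming) auto
        moreover have "\<bar>(d t r - e t r) - (d (t - r) 0 - e (t - r) 0)\<bar> \<le> \<phi> t - \<phi> (t - r)"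
          using outgoing[of "t - r" t r] False Suc.prems by simp
        moreover have "d (t - r) 0 = 0" using False by (intro dr0) simp
        ultimately show ?thesis by linarith
      qed
      have "\<bar>d t r\<bar> \<le> \<phi> t" using incoming[OF Suc.prems] out by linarith
      then show ?case by (simp only: \<phi>_def)
    qed
    have "(\<lambda>n. (L * t) ^ n / fact n) \<longlonglongrightarrow> 0"
      using summable_LIMSEQ_zero[OF summable_exp[of "L * t"]] by (simp add: divide_inverse mult.commute)
    then have "(\<lambda>n. M * ((L * t) ^ n / fact n)) \<longlonglongrightarrow> M * 0"
      by (intro tendsto_mult tendsto_const)
    moreover have "\<bar>d t r\<bar> \<le> M * ((L * t) ^ n / fact n)" for n
      using iter[of t r n] tr by (simp add: T_def)
    ultimately have "\<bar>d t r\<bar> \<le> M * 0" by (intro LIMSEQ_le_const) auto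
    then show ?thesis by simp
  qed
  have v_eq: "v1 t r = v2 t r" if tr: "0 \<le> t" "0 \<le> r" for t r
  proof -
    have "((\<lambda>s. v1 s r - v2 s r) has_field_derivative 0) (at s within {0..})" if "s \<in> {0..}" for s
      using DERIV_diff[OF D1(2)[of s r] D2(2)[of s r]] d_zero[of s r] that tr by (simp add: d_def)
    from has_field_derivative_zero_constant[OF _ this] obtain c where "v1 s r - v2 s r = c" if "0 \<le> s" for s
      by auto
    moreover have "v1 0 r - v2 0 r = 0" using init tr by (simp add: v1_def v2_def times_r_def)
    ultimately show ?thesis using tr by force
  qed
  show ?thesis
  proof (cases "r = 0")
    case False
    then show ?thesis using v_eq[OF tr] by (simp add: v1_def v2_def times_r_def)
  next
    case True
    have "partial_r v1 t 0 = partial_r v2 t 0"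
      unfolding partial_r_def
    proof (rule deriv_on_cong)
      show "(\<lambda>s. v1 t s) differentiable at 0 within {0..}"
        using D1(3)[of t 0] tr by (auto simp: real_differentiable_def)
    qed (use v_eq tr in auto)
    then show ?thesis
      using partials_times_r(2)[OF C1(1) tr(1), of 0] partials_times_r(2)[OF C1(2) tr(1), of 0] True
      by (simp add: v1_def v2_def)
  qed
qed

end

section \<open>The initial data and their norm\<close>

lemma filterlim_abs_at_0: "filterlim (\<lambda>x::real. \<bar>x\<bar>) (at 0 within {0..}) (at 0)"
proof -
  have "((\<lambda>x::real. \<bar>x\<bar>) \<longlongrightarrow> 0) (at 0)" by (intro tendsto_eq_intros) auto
  then show ?thesis
    by (auto simp: filterlim_at eventually_at_filter)
qed

text \<open>At \<open>0\<close> the difference quotient of the odd extension at \<open>y\<close> is that of \<open>h\<close> at \<open>|y|\<close>. For the even extension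
below it carries the sign of \<open>y\<close> in addition, so that it converges only to \<open>0\<close>.\<close>

lemma DERIV_odd_extension:
  assumes d: "\<And>x. 0 \<le> x \<Longrightarrow> (h has_real_derivative h' x) (at x within {0..})" and h0: "h 0 = 0"
  shows "((\<lambda>x. sgn x * h \<bar>x\<bar>) has_real_derivative h' \<bar>x\<bar>) (at x)"
proof -
  have pos: "(h has_real_derivative h' x) (at x)" if "0 < x" for x
    using d[of x] that by (simp add: at_within_atLeast_interior)
  consider "0 < x" | "x < 0" | "x = 0" by linarith
  then show ?thesis
  proof cases
    case 1
    have "\<forall>\<^sub>F y in nhds x. y \<in> {0<..}" using 1 by (intro eventually_nhds_in_open) auto
    then have "\<forall>\<^sub>F y in nhds x. sgn y * h \<bar>y\<bar> = h y" by eventually_elim simp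
    from DERIV_cong_ev[OF refl this refl, of "h' x"] show ?thesis using pos[OF 1] 1 by simp
  next
    case 2
    have "\<forall>\<^sub>F y in nhds x. y \<in> {..<0}" using 2 by (intro eventually_nhds_in_open) auto
    then have ev: "\<forall>\<^sub>F y in nhds x. sgn y * h \<bar>y\<bar> = - h (- y)" by eventually_elim simp
    have "((\<lambda>y. h (- y)) has_real_derivative h' (- x) * - 1) (at x)"
      by (rule DERIV_chain2[OF pos]) (use 2 in \<open>auto intro!: derivative_eq_intros\<close>)
    from DERIV_minus[OF this] DERIV_cong_ev[OF refl ev refl, of "h' (- x)"] show ?thesis
      using 2 by simp
  next
    case 3
    have "((\<lambda>y. (h y - h 0) / (y - 0)) \<longlongrightarrow> h' 0) (at 0 within {0..})"
      using d[of 0] by (simp add: has_field_derivative_iff)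
    from filterlim_compose[OF this filterlim_abs_at_0]
    have "((\<lambda>y. h \<bar>y\<bar> / \<bar>y\<bar>) \<longlongrightarrow> h' 0) (at 0)" by (simp add: h0)
    moreover have "h \<bar>y\<bar> / \<bar>y\<bar> = (sgn y * h \<bar>y\<bar> - sgn 0 * h \<bar>0\<bar>) / (y - 0)" for y :: real
      by (simp add: sgn_if)
    ultimately have "((\<lambda>y. (sgn y * h \<bar>y\<bar> - sgn 0 * h \<bar>0\<bar>) / (y - 0)) \<longlongrightarrow> h' 0) (at 0)" by simp
    with 3 show ?thesis by (simp add: has_field_derivative_iff)
  qed
qed

lemma DERIV_even_extension:
  assumes d: "\<And>x. 0 \<le> x \<Longrightarrow> (h has_real_derivative h' x) (at x within {0..})" and h'0: "h' 0 = 0"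
  shows "((\<lambda>x. h \<bar>x\<bar>) has_real_derivative sgn x * h' \<bar>x\<bar>) (at x)"
proof -
  have pos: "(h has_real_derivative h' x) (at x)" if "0 < x" for x
    using d[of x] that by (simp add: at_within_atLeast_interior)
  consider "0 < x" | "x < 0" | "x = 0" by linarith
  then show ?thesis
  proof cases
    case 1
    have "\<forall>\<^sub>F y in nhds x. y \<in> {0<..}" using 1 by (intro eventually_nhds_in_open) auto
    then have "\<forall>\<^sub>F y in nhds x. h \<bar>y\<bar> = h y" by eventually_elim simp
    from DERIV_cong_ev[OF refl this refl, of "h' x"] show ?thesis using pos[OF 1] 1 by simp
  next
    case 2
    have "\<forall>\<^sub>F y in nhds x. y \<in> {..<0}" using 2 by (intro eventually_nhds_in_open) auto
    then have ev: "\<forall>\<^sub>F y in nhds x. h \<bar>y\<bar> = h (- y)" by eventually_elim simp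
    have "((\<lambda>y. h (- y)) has_real_derivative h' (- x) * - 1) (at x)"
      by (rule DERIV_chain2[OF pos]) (use 2 in \<open>auto intro!: derivative_eq_intros\<close>)
    with DERIV_cong_ev[OF refl ev refl, of "- h' (- x)"] show ?thesis
      using 2 by simp
  next
    case 3
    have "((\<lambda>y. (h y - h 0) / (y - 0)) \<longlongrightarrow> 0) (at 0 within {0..})"
      using d[of 0] by (simp add: has_field_derivative_iff h'0)
    from filterlim_compose[OF this filterlim_abs_at_0]
    have "((\<lambda>y. (h \<bar>y\<bar> - h 0) / \<bar>y\<bar>) \<longlongrightarrow> 0) (at 0)" by simp
    then have "((\<lambda>y. norm ((h \<bar>y\<bar> - h 0) / y)) \<longlongrightarrow> 0) (at 0)"
      using tendsto_norm_zero by fastforce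
    then have "((\<lambda>y. (h \<bar>y\<bar> - h 0) / y) \<longlongrightarrow> 0) (at 0)"
      by (rule tendsto_norm_zero_cancel)
    with 3 show ?thesis by (simp add: has_field_derivative_iff)
  qed
qed

lemma continuous_on_even_extension:
  assumes "continuous_on {0..} (h :: real \<Rightarrow> real)"
  shows "continuous_on UNIV (\<lambda>x. h \<bar>x\<bar>)"
  by (rule continuous_on_compose2[OF assms]) (auto intro!: continuous_intros)

lemma continuous_on_odd_extension:
  assumes h: "continuous_on {0..} (h :: real \<Rightarrow> real)" and h0: "h 0 = 0"
  shows "continuous_on UNIV (\<lambda>x. sgn x * h \<bar>x\<bar>)"
proof -
  have "continuous_on ({0..} \<union> {..0}) (\<lambda>x. if 0 \<le> x then h x else - h (- x))"
  proof (rule continuous_on_cases)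
    show "continuous_on {..0} (\<lambda>x. - h (- x))"
      by (intro continuous_on_minus continuous_on_compose2[OF h]) (auto intro!: continuous_intros)
  qed (use h h0 in auto)
  moreover have U: "{0..} \<union> {..0} = (UNIV :: real set)" by auto
  moreover have e: "(\<lambda>x. if 0 \<le> x then h x else - h (- x)) = (\<lambda>x. sgn x * h \<bar>x\<bar>)"
    using h0 by (auto simp: fun_eq_iff sgn_if)
  ultimately show ?thesis unfolding U e by blast
qed

lemma deriv_on_eq_0:
  assumes R: "0 < R" and y: "R < y" and h: "\<And>x. R < x \<Longrightarrow> h x = 0"
    and d: "h differentiable (at y within {0..})"
  shows "deriv_on {0..} h y = 0"
proof -
  have "0 < y" using y R by simp
  then have "(h has_real_derivative deriv_on {0..} h y) (at y)"
    using DERIV_deriv_on[OF d] by (simp add: at_within_atLeast_interior)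
  moreover have "\<forall>\<^sub>F x in nhds y. x \<in> {R<..}" using y by (intro eventually_nhds_in_open) auto
  then have "\<forall>\<^sub>F x in nhds y. h x = 0" by eventually_elim (simp add: h)
  from DERIV_cong_ev[OF refl this refl] have
    "(h has_real_derivative deriv_on {0..} h y) (at y) \<longleftrightarrow> ((\<lambda>x. 0) has_real_derivative deriv_on {0..} h y) (at y)" .
  ultimately show ?thesis using DERIV_unique DERIV_const by blast
qed

text \<open>The essential supremum bounds a continuous function at every point, because an excess at one point would
persist on an interval. Compact support makes it finite, so that the conversion from
the extended reals loses nothing.\<close>

lemma data_norm_ge:
  assumes f0: "Ck_on 2 {0..} f0" and f1: "Ck_on 1 {0..} f1"
    and s0: "\<And>r. R < r \<Longrightarrow> f0 r = 0" and s1: "\<And>r. R < r \<Longrightarrow> f1 r = 0" and R: "0 < R" and r: "0 \<le> r"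
  shows "norm (f0 r, deriv_on {0..} f0 r, (deriv_on {0..} ^^ 2) f0 r, f1 r, deriv_on {0..} f1 r)
    \<le> data_norm f0 f1"
proof -
  define N where "N r = norm (f0 r, deriv_on {0..} f0 r, (deriv_on {0..} ^^ 2) f0 r, f1 r, deriv_on {0..} f1 r)"
    for r
  define M where "M = restrict_space lborel {0::real..}"
  define S where "S = esssup M (\<lambda>r. ereal (N r))"
  have diff: "f0 differentiable (at x within {0..})" "deriv_on {0..} f0 differentiable (at x within {0..})"
    "f1 differentiable (at x within {0..})" if "0 \<le> x" for x
    using f0 f1 that by (auto simp: numeral_2_eq_2)
  have "continuous_on {0..} f0" "continuous_on {0..} (deriv_on {0..} f0)" "continuous_on {0..} f1"
    using diff by (auto simp: continuous_on_eq_continuous_within intro!: differentiable_imp_continuous_within)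
  moreover have "continuous_on {0..} ((deriv_on {0..} ^^ 2) f0)" "continuous_on {0..} (deriv_on {0..} f1)"
    using f0 f1 by (auto simp: numeral_2_eq_2)
  ultimately have Nc: "continuous_on {0..} N"
    unfolding N_def by (intro continuous_on_norm continuous_on_Pair)
  have "(\<lambda>r. ereal (N r)) \<in> borel_measurable (restrict_space borel {0..})"
    by (intro borel_measurable_continuous_on_restrict continuous_on_compose2[OF continuous_on_ereal Nc]) auto
  then have meas: "(\<lambda>r. ereal (N r)) \<in> borel_measurable M"
    unfolding M_def by (simp add: measurable_def space_restrict_space sets_restrict_space)
  have derivs0: "deriv_on {0..} f0 x = 0" "(deriv_on {0..} ^^ 2) f0 x = 0" "deriv_on {0..} f1 x = 0" if "R < x" for x
  proof -
    have x0: "0 \<le> x" using that R by simp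
    have 1: "deriv_on {0..} f0 y = 0" if "R < y" for y
      using that R by (intro deriv_on_eq_0[OF R] s0 diff) auto
    show "deriv_on {0..} f0 x = 0" by (rule 1[OF that])
    show "(deriv_on {0..} ^^ 2) f0 x = 0"
      using deriv_on_eq_0[OF R that 1 diff(2)[OF x0]] by (simp add: numeral_2_eq_2)
    show "deriv_on {0..} f1 x = 0" by (rule deriv_on_eq_0[OF R that s1 diff(3)[OF x0]])
  qed
  have N0: "N x = 0" if "R < x" for x
    using that derivs0[OF that] s0 s1 by (simp add: N_def)
  have "bounded (N ` {0..R})"
    by (intro compact_imp_bounded compact_continuous_image continuous_on_subset[OF Nc]) auto
  then obtain B where B: "0 < B" "\<And>x. x \<in> {0..R} \<Longrightarrow> \<bar>N x\<bar> \<le> B" by (auto simp: bounded_pos)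
  have NB: "N x \<le> B" if "0 \<le> x" for x
    using B(1) B(2)[of x] N0[of x] that by (cases "x \<le> R") auto
  have "S \<le> ereal B"
    unfolding S_def by (rule esssup_I[OF meas], rule AE_I2) (simp add: NB M_def space_restrict_space)
  \<comment> \<open>a strict excess at \<open>x\<close> would hold on an interval to the right of \<open>x\<close>, which has positive measure\<close>
  have ge: "ereal (N x) \<le> S" if x: "0 \<le> x" for x
  proof (rule ccontr)
    assume "\<not> ereal (N x) \<le> S"
    then have less: "S < ereal (N x)" by simp
    have "((\<lambda>y. ereal (N y)) \<longlongrightarrow> ereal (N x)) (at x within {0..})"
      using Nc x by (auto simp: continuous_on_def intro!: tendsto_intros)
    from order_tendstoD(1)[OF this less]
    obtain e where e: "0 < e" "\<And>y. y \<in> {0..} \<Longrightarrow> y \<noteq> x \<Longrightarrow> dist y x < e \<Longrightarrow> S < ereal (N y)"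
      by (auto simp: eventually_at)
    have sub: "{x<..<x + e} \<subseteq> {y \<in> space M. S < ereal (N y)}"
      using e x by (auto simp: M_def space_restrict_space dist_real_def)
    have "{y \<in> space M. S < ereal (N y)} \<in> sets M"
      using meas by measurable
    then have "emeasure M {x<..<x + e} \<le> emeasure M {y \<in> space M. S < ereal (N y)}"
      by (intro emeasure_mono sub)
    also have "\<dots> = 0" unfolding S_def by (rule esssup_zero_measure)
    finally have "emeasure M {x<..<x + e} = 0" by simp
    moreover have "emeasure M {x<..<x + e} = ennreal e"
      using x e by (simp add: M_def emeasure_restrict_space subset_iff)
    ultimately show False using e by simp
  qed
  have "ereal 0 \<le> S" using ge[of 0] order_trans[of "ereal 0" "ereal (N 0)" S] by (simp add: N_def)
  with \<open>S \<le> ereal B\<close> obtain s where s: "S = ereal s" by (cases S) auto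
  have "data_norm f0 f1 = s" using s by (simp add: data_norm_def S_def M_def N_def[abs_def])
  with ge[OF r] s show ?thesis by (simp add: N_def)
qed

lemma integral_le_nn_integral:
  fixes h :: "real \<Rightarrow> real"
  assumes c: "continuous_on {y..z} h" and h: "\<And>x. x \<in> {y..z} \<Longrightarrow> 0 \<le> h x" and sub: "{y..z} \<subseteq> A"
    and fin: "(\<integral>\<^sup>+x\<in>A. ennreal (h x) \<partial>lborel) < \<infinity>"
  shows "integral {y..z} h \<le> enn2real (\<integral>\<^sup>+x\<in>A. ennreal (h x) \<partial>lborel)"
proof -
  have si: "set_integrable lborel {y..z} h" by (rule borel_integrable_atLeastAtMost'[OF c])
  have nn: "0 \<le> integral {y..z} h" by (rule integral_nonneg[OF integrable_continuous_real[OF c] h])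
  have "ennreal (integral {y..z} h) = (\<integral>\<^sup>+x. ennreal (indicator {y..z} x *\<^sub>R h x) \<partial>lborel)"
    using set_borel_integral_eq_integral(2)[OF si] nn_integral_eq_integral[OF si[unfolded set_integrable_def]] h
    by (auto simp: set_lebesgue_integral_def indicator_def)
  also have "\<dots> \<le> (\<integral>\<^sup>+x\<in>A. ennreal (h x) \<partial>lborel)"
    using sub by (intro nn_integral_mono) (auto simp: indicator_def)
  finally show ?thesis using fin nn by (metis enn2real_mono enn2real_ennreal infinity_ennreal_def)
qed

section \<open>Moduli of continuity as Dini nonlinearities\<close>

text \<open>Writing \<open>k\<close> for the derivative of \<open>p^2 \<mu>(p)\<close> on the half-line, \<open>k' = 2 \<mu> + 4 p \<mu>' + p^2 \<mu>''\<close> is at most a multiple of \<open>\<mu>\<close>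
near \<open>0\<close> by the bounds on \<open>\<mu>'\<close> and \<open>\<mu>''\<close>. Thus \<open>k\<close> is Lipschitz on \<open>[0, m]\<close> with a constant proportional to
\<open>\<mu> m\<close>, and so is its odd extension \<open>G'\<close> on \<open>[-m, m]\<close>.\<close>

lemma dini_nonlinearity_of_modulus:
  assumes R: "0 < R" and mod: "modulus_of_continuity \<mu>" and C2: "Ck_on 2 {0<..} \<mu>"
    and bounds: "\<exists>\<tau>1>0. \<forall>k\<in>{1, 2}. \<exists>C>0. \<forall>\<tau>\<in>{0<..<\<tau>1}.
           \<bar>(deriv_on {0<..} ^^ k) \<mu> \<tau>\<bar> \<le> C * (\<mu> \<tau> / \<tau> ^ k)"
    and dini: "Dini_condition \<mu>"
  obtains G g m0 D Lam where "dini_nonlinearity G g R m0 D Lam" "\<And>p. G p = \<bar>p\<bar>\<^sup>2 * \<mu> \<bar>p\<bar>"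
proof -
  define \<mu>1 where "\<mu>1 = deriv_on {0<..} \<mu>"
  define \<mu>2 where "\<mu>2 = deriv_on {0<..} \<mu>1"
  have \<mu>_nonneg: "0 \<le> \<mu> x" if "0 \<le> x" for x using mod that by (simp add: modulus_of_continuity_def)
  have \<mu>_0: "\<mu> 0 = 0" and \<mu>_cont: "continuous_on {0..} \<mu>" and "mono_on {0..} \<mu>"
    using mod by (auto simp: modulus_of_continuity_def)
  then have \<mu>_mono: "\<mu> x \<le> \<mu> y" if "0 \<le> x" "x \<le> y" for x y
    using that by (auto simp: mono_on_def)
  have d\<mu>: "(\<mu> has_real_derivative \<mu>1 x) (at x)" and d\<mu>1: "(\<mu>1 has_real_derivative \<mu>2 x) (at x)"
    if "0 < x" for x
  proof -
    have x: "x \<in> {0<..}" using that by simp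
    then have "\<mu> differentiable (at x within {0<..})" "\<mu>1 differentiable (at x within {0<..})"
      using C2 unfolding \<mu>1_def numeral_2_eq_2 Ck_on.simps by blast+
    from this[THEN DERIV_deriv_on]
    show "(\<mu> has_real_derivative \<mu>1 x) (at x)" "(\<mu>1 has_real_derivative \<mu>2 x) (at x)"
      unfolding at_within_open[OF x open_greaterThan] \<mu>2_def by (simp_all only: \<mu>1_def)
  qed
  obtain \<tau>1 where \<tau>1: "0 < \<tau>1" and B: "\<forall>k\<in>{1, 2}. \<exists>C>0. \<forall>\<tau>\<in>{0<..<\<tau>1}.
           \<bar>(deriv_on {0<..} ^^ k) \<mu> \<tau>\<bar> \<le> C * (\<mu> \<tau> / \<tau> ^ k)"
    using bounds by blast
  obtain c1 where c1: "0 < c1" "\<And>\<tau>. 0 < \<tau> \<Longrightarrow> \<tau> < \<tau>1 \<Longrightarrow> \<bar>\<mu>1 \<tau>\<bar> \<le> c1 * (\<mu> \<tau> / \<tau>)"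
    using bspec[OF B, of 1] by (auto simp: \<mu>1_def)
  obtain c2 where c2: "0 < c2" "\<And>\<tau>. 0 < \<tau> \<Longrightarrow> \<tau> < \<tau>1 \<Longrightarrow> \<bar>\<mu>2 \<tau>\<bar> \<le> c2 * (\<mu> \<tau> / \<tau>\<^sup>2)"
    using bspec[OF B, of 2] by (auto simp: \<mu>1_def \<mu>2_def numeral_2_eq_2)
  obtain \<tau>0 where \<tau>0: "0 < \<tau>0" "(\<integral>\<^sup>+\<tau>\<in>{0<..<\<tau>0}. ennreal (\<mu> \<tau> / \<tau>) \<partial>lborel) < \<infinity>"
    using dini by (auto simp: Dini_condition_def)
  define A where "A = 2 + 4 * c1 + c2"
  have A: "0 < A" using c1 c2 by (simp add: A_def)
  define m0 where "m0 = min \<tau>0 \<tau>1 / 2"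
  have m0: "0 < m0" "m0 < \<tau>0" "m0 < \<tau>1" using \<tau>0 \<tau>1 by (auto simp: m0_def min_def)
  define h where "h x = x\<^sup>2 * \<mu> x" for x
  define k where "k x = 2 * x * \<mu> x + x\<^sup>2 * \<mu>1 x" for x
  define k' where "k' x = 2 * \<mu> x + 4 * (x * \<mu>1 x) + x\<^sup>2 * \<mu>2 x" for x
  have k0: "k 0 = 0" by (simp add: k_def)
  have dk: "(k has_real_derivative k' x) (at x)" if "0 < x" for x
  proof -
    have "(k has_real_derivative 2 * 1 * \<mu> x + \<mu>1 x * (2 * x) + (real 2 * (1 * x ^ (2 - Suc 0)) * \<mu>1 x + \<mu>2 x * x\<^sup>2)) (at x)"
      unfolding k_def
      by (intro DERIV_add DERIV_mult DERIV_cmult DERIV_power DERIV_ident d\<mu> d\<mu>1 that)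
    then show ?thesis by (simp add: k'_def algebra_simps)
  qed
  have k1: "x * \<bar>\<mu>1 x\<bar> \<le> c1 * \<mu> x" and k2: "x\<^sup>2 * \<bar>\<mu>2 x\<bar> \<le> c2 * \<mu> x" if "0 < x" "x < \<tau>1" for x
    using c1(2)[OF that] c2(2)[OF that] that by (simp_all add: pos_le_divide_eq mult.commute)
  have k'_bound: "\<bar>k' x\<bar> \<le> A * \<mu> x" if "0 < x" "x < \<tau>1" for x
  proof -
    have "\<bar>k' x\<bar> \<le> \<bar>2 * \<mu> x\<bar> + \<bar>4 * (x * \<mu>1 x)\<bar> + \<bar>x\<^sup>2 * \<mu>2 x\<bar>"
      unfolding k'_def by linarith
    also have "\<dots> = 2 * \<mu> x + 4 * (x * \<bar>\<mu>1 x\<bar>) + x\<^sup>2 * \<bar>\<mu>2 x\<bar>"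
      using that \<mu>_nonneg[of x] by (simp add: abs_mult)
    also have "\<dots> \<le> A * \<mu> x" using k1[OF that] k2[OF that] by (simp add: A_def algebra_simps)
    finally show ?thesis .
  qed
  have lim\<mu>: "(\<mu> \<longlongrightarrow> 0) (at 0 within {0..})"
    using bspec[OF \<mu>_cont[unfolded continuous_on_def], of 0] \<mu>_0 by simp
  have limx\<mu>: "((\<lambda>x. c * (x * \<mu> x)) \<longlongrightarrow> 0) (at 0 within {0..})" for c
    by (rule tendsto_eq_intros lim\<mu> refl)+ simp
  have kc: "continuous_on {0..} k"
    unfolding continuous_on_def
  proof
    fix x :: real assume x: "x \<in> {0..}"
    show "(k \<longlongrightarrow> k x) (at x within {0..})"
    proof (cases "x = 0")
      case True
      have "\<forall>\<^sub>F y in at 0 within {0..}. norm (k y) \<le> (2 + c1) * (y * \<mu> y)"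
        unfolding eventually_at
      proof (intro exI[of _ \<tau>1] conjI ballI impI \<tau>1)
        fix y :: real assume y: "y \<in> {0..}" "y \<noteq> 0 \<and> dist y 0 < \<tau>1"
        then have "\<bar>k y\<bar> \<le> \<bar>2 * y * \<mu> y\<bar> + \<bar>y * (y * \<mu>1 y)\<bar>"
          unfolding k_def power2_eq_square mult.assoc by linarith
        also have "\<dots> = 2 * y * \<mu> y + y * (y * \<bar>\<mu>1 y\<bar>)"
          using y \<mu>_nonneg[of y] by (simp add: abs_mult)
        also have "\<dots> \<le> 2 * y * \<mu> y + y * (c1 * \<mu> y)"
          using y k1[of y] by (intro add_left_mono mult_left_mono) (auto simp: dist_real_def)
        finally show "norm (k y) \<le> (2 + c1) * (y * \<mu> y)" by (simp add: algebra_simps)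
      qed
      from Lim_null_comparison[OF this limx\<mu>] True k0 show ?thesis by simp
    next
      case False
      then have "isCont k x" using dk[of x] x by (intro DERIV_isCont) auto
      then show ?thesis
        using continuous_at_imp_continuous_at_within by (auto simp: continuous_within)
    qed
  qed
  define G where "G p = h \<bar>p\<bar>" for p
  define g where "g p = sgn p * k \<bar>p\<bar>" for p
  have dh: "(h has_real_derivative k x) (at x within {0..})" if "0 \<le> x" for x
  proof (cases "x = 0")
    case True
    have "((\<lambda>y. (h y - h 0) / (y - 0)) \<longlongrightarrow> 0) (at 0 within {0..})"
    proof (rule Lim_transform_eventually)
      show "((\<lambda>x. 1 * (x * \<mu> x)) \<longlongrightarrow> 0) (at 0 within {0..})" by (rule limx\<mu>)
      show "\<forall>\<^sub>F y in at 0 within {0..}. 1 * (y * \<mu> y) = (h y - h 0) / (y - 0)"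
        by (simp add: eventually_at_filter h_def power2_eq_square)
    qed
    then show ?thesis using True k0 by (simp add: has_field_derivative_iff)
  next
    case False
    with that have "0 < x" by simp
    then have "(h has_real_derivative real 2 * (1 * x ^ (2 - Suc 0)) * \<mu> x + \<mu>1 x * x\<^sup>2) (at x)"
      unfolding h_def by (intro DERIV_mult DERIV_power DERIV_ident d\<mu>)
    then have "(h has_real_derivative k x) (at x)" by (simp add: k_def mult.commute)
    then show ?thesis by (rule has_field_derivative_at_within)
  qed
  have k_lip: "\<bar>k y - k x\<bar> \<le> A * \<mu> m * (y - x)" if "0 \<le> x" "x \<le> y" "y \<le> m" "m \<le> m0" for x y m
  proof (cases "x = y")
    case False
    then have "x < y" using that by simp
    then have "norm (k y - k x) \<le> A * \<mu> m * y - A * \<mu> m * x"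
    proof (rule differentiable_bound_general[where \<phi> = "\<lambda>s. A * \<mu> m * s"])
      show "continuous_on {x..y} k" by (rule continuous_on_subset[OF kc]) (use that in auto)
      fix s assume s: "x < s" "s < y"
      show "(k has_vector_derivative k' s) (at s)"
        using dk[of s] s that by (simp add: has_real_derivative_iff_has_vector_derivative)
      show "((\<lambda>s. A * \<mu> m * s) has_vector_derivative A * \<mu> m) (at s)"
        using DERIV_cmult_Id[of "A * \<mu> m"] by (simp add: has_real_derivative_iff_has_vector_derivative)
      have "\<bar>k' s\<bar> \<le> A * \<mu> s" using s that m0 by (intro k'_bound) auto
      also have "\<dots> \<le> A * \<mu> m" using s that A by (intro mult_left_mono \<mu>_mono) auto
      finally show "norm (k' s) \<le> A * \<mu> m" by simp
    qed (auto intro!: continuous_intros)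
    then show ?thesis by (simp add: right_diff_distrib)
  qed simp
  have g_lip: "\<bar>g p - g p'\<bar> \<le> A * \<mu> m * \<bar>p - p'\<bar>" if "m \<le> m0" "\<bar>p\<bar> \<le> m" "\<bar>p'\<bar> \<le> m" for m p p'
  proof -
    have K: "\<bar>k \<bar>p\<bar> - k \<bar>p'\<bar>\<bar> \<le> A * \<mu> m * \<bar>\<bar>p\<bar> - \<bar>p'\<bar>\<bar>"
      using k_lip[of "\<bar>p\<bar>" "\<bar>p'\<bar>" m] k_lip[of "\<bar>p'\<bar>" "\<bar>p\<bar>" m] that
      by (cases "\<bar>p\<bar> \<le> \<bar>p'\<bar>") (auto simp: abs_minus_commute)
    have z: "\<bar>k \<bar>x\<bar>\<bar> \<le> A * \<mu> m * \<bar>x\<bar>" if "\<bar>x\<bar> \<le> m" for x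
      using k_lip[of 0 "\<bar>x\<bar>" m] that \<open>m \<le> m0\<close> by (simp add: k0)
    \<comment> \<open>for opposite signs \<open>|p - p'| = |p| + |p'|\<close>, so it suffices to compare both values with \<open>g 0 = 0\<close>\<close>
    consider "0 \<le> p" "0 \<le> p'" | "p \<le> 0" "p' \<le> 0" | "0 \<le> p" "p' \<le> 0" | "p \<le> 0" "0 \<le> p'" by linarith
    then show ?thesis
    proof cases
      case 1
      then have "g p = k \<bar>p\<bar>" "g p' = k \<bar>p'\<bar>" by (auto simp: g_def sgn_if k0)
      with K 1 show ?thesis by simp
    next
      case 2
      then have "g p = - k \<bar>p\<bar>" "g p' = - k \<bar>p'\<bar>" by (auto simp: g_def sgn_if k0)
      moreover have "\<bar>\<bar>p\<bar> - \<bar>p'\<bar>\<bar> = \<bar>p - p'\<bar>" using 2 by simp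
      ultimately show ?thesis using K by (simp add: abs_minus_commute)
    next
      case 3
      then have "g p = k \<bar>p\<bar>" "g p' = - k \<bar>p'\<bar>" by (auto simp: g_def sgn_if k0)
      moreover have "\<bar>p - p'\<bar> = \<bar>p\<bar> + \<bar>p'\<bar>" using 3 by simp
      ultimately show ?thesis
        using z[OF that(2)] z[OF that(3)] by (simp only: distrib_left) linarith
    next
      case 4
      then have "g p = - k \<bar>p\<bar>" "g p' = k \<bar>p'\<bar>" by (auto simp: g_def sgn_if k0)
      moreover have "\<bar>p - p'\<bar> = \<bar>p\<bar> + \<bar>p'\<bar>" using 4 by simp
      ultimately show ?thesis
        using z[OF that(2)] z[OF that(3)] by (simp only: distrib_left) linarith
    qed
  qed
  define D where "D = A * enn2real (\<integral>\<^sup>+\<tau>\<in>{0<..<\<tau>0}. ennreal (\<mu> \<tau> / \<tau>) \<partial>lborel)"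
  have "dini_nonlinearity G g R m0 D (\<lambda>\<tau>. A * \<mu> \<tau>)"
  proof
    show "(G has_real_derivative g p) (at p)" for p
      unfolding G_def g_def by (rule DERIV_even_extension[OF dh k0])
    show "continuous_on UNIV g"
      unfolding g_def by (rule continuous_on_odd_extension[OF kc k0])
    show "continuous_on {0..m0} (\<lambda>\<tau>. A * \<mu> \<tau>)"
      by (intro continuous_on_mult continuous_on_const continuous_on_subset[OF \<mu>_cont]) auto
    show "integral {y..m0} (\<lambda>\<tau>. A * \<mu> \<tau> / \<tau>) \<le> D" if y: "0 < y" "y \<le> m0" for y
    proof -
      have "integral {y..m0} (\<lambda>\<tau>. \<mu> \<tau> / \<tau>) \<le> enn2real (\<integral>\<^sup>+\<tau>\<in>{0<..<\<tau>0}. ennreal (\<mu> \<tau> / \<tau>) \<partial>lborel)"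
      proof (rule integral_le_nn_integral)
        show "continuous_on {y..m0} (\<lambda>\<tau>. \<mu> \<tau> / \<tau>)"
          using y by (intro continuous_on_divide continuous_on_subset[OF \<mu>_cont] continuous_on_id) auto
        show "{y..m0} \<subseteq> {0<..<\<tau>0}" using y m0 by auto
      qed (use y \<mu>_nonneg \<tau>0 in auto)
      then have "A * integral {y..m0} (\<lambda>\<tau>. \<mu> \<tau> / \<tau>) \<le> D"
        unfolding D_def using A by (intro mult_left_mono) auto
      moreover have "integral {y..m0} (\<lambda>\<tau>. A * (\<mu> \<tau> / \<tau>)) = A * integral {y..m0} (\<lambda>\<tau>. \<mu> \<tau> / \<tau>)"
        by (rule integral_mult_right)
      ultimately show ?thesis by simp
    qed
  qed (use R m0 A \<mu>_nonneg \<mu>_mono g_lip in \<open>auto simp: G_def h_def g_def k0\<close>)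
  then show ?thesis by (rule that) (simp add: G_def h_def)
qed

lemma DERIV_imp_differentiable_within:
  "(f has_real_derivative D) (at x within S) \<Longrightarrow> f differentiable (at x within S)"
  by (auto simp: real_differentiable_def)

lemma partial_t_eq:
  assumes "\<And>s. 0 \<le> s \<Longrightarrow> h s r = k s r" "((\<lambda>s. k s r) has_real_derivative d) (at t)" "0 \<le> t"
  shows "((\<lambda>s. h s r) has_real_derivative d) (at t within {0..})" "partial_t h t r = d"
proof -
  show *: "((\<lambda>s. h s r) has_real_derivative d) (at t within {0..})"
    by (rule has_field_derivative_transform_within[OF has_field_derivative_at_within[OF assms(2)], of 1])
       (use assms in auto)
  show "partial_t h t r = d" unfolding partial_t_def by (rule deriv_on_eq[OF * assms(3)])
qed

lemma partial_r_eq: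
  assumes "\<And>s. 0 \<le> s \<Longrightarrow> h t s = k t s" "(k t has_real_derivative d) (at r)" "0 \<le> r"
  shows "(h t has_real_derivative d) (at r within {0..})" "partial_r h t r = d"
proof -
  show *: "(h t has_real_derivative d) (at r within {0..})"
    by (rule has_field_derivative_transform_within[OF has_field_derivative_at_within[OF assms(2)], of 1])
       (use assms in auto)
  show "partial_r h t r = d" unfolding partial_r_def using deriv_on_eq[OF * assms(3)] by simp
qed

lemma Ck_quadrant_0I:
  assumes "jcont k" "\<And>t r. 0 \<le> t \<Longrightarrow> 0 \<le> r \<Longrightarrow> h t r = k t r"
  shows "Ck_quadrant 0 h"
proof -
  have "continuous_on ({0..} \<times> {0..}) (\<lambda>z. k (fst z) (snd z))"
    using assms(1) continuous_on_subset unfolding jcont_def by blast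
  then have "continuous_on ({0..} \<times> {0..}) (\<lambda>z. h (fst z) (snd z))"
    by (rule continuous_on_eq) (use assms(2) in auto)
  then show ?thesis by (simp add: split_beta')
qed

lemma Ck_quadrant_1I:
  assumes eq: "\<And>t r. 0 \<le> t \<Longrightarrow> 0 \<le> r \<Longrightarrow> h t r = k t r"
    and dt: "\<And>t r. ((\<lambda>t. k t r) has_real_derivative kt t r) (at t)"
    and dr: "\<And>t r. (k t has_real_derivative kr t r) (at r)"
    and c: "jcont k" "jcont kt" "jcont kr"
  shows "Ck_quadrant (Suc 0) h"
proof -
  have pt: "((\<lambda>s. h s r) has_real_derivative kt t r) (at t within {0..})" "partial_t h t r = kt t r"
    and pr: "(h t has_real_derivative kr t r) (at r within {0..})" "partial_r h t r = kr t r"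
    if "0 \<le> t" "0 \<le> r" for t r
    using partial_t_eq[of h r k, OF _ dt] partial_r_eq[of h t k, OF _ dr] eq that by auto
  have "Ck_quadrant 0 (partial_t h)" by (rule Ck_quadrant_0I[OF c(2) pt(2)])
  moreover have "Ck_quadrant 0 (partial_r h)" by (rule Ck_quadrant_0I[OF c(3) pr(2)])
  moreover have "Ck_quadrant 0 h" by (rule Ck_quadrant_0I[OF c(1) eq])
  moreover have "(\<lambda>s. h s r) differentiable at t within {0..}" "h t differentiable at r within {0..}"
    if "0 \<le> t" "0 \<le> r" for t r
    using DERIV_imp_differentiable_within[OF pt(1)[OF that]]
      DERIV_imp_differentiable_within[OF pr(1)[OF that]] .
  ultimately show ?thesis by simp
qed

lemma Ck_quadrant_2I:
  assumes dt: "\<And>t r. ((\<lambda>t. k t r) has_real_derivative kt t r) (at t)"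
    and dr: "\<And>t r. (k t has_real_derivative kr t r) (at r)"
    and dtt: "\<And>t r. ((\<lambda>t. kt t r) has_real_derivative ktt t r) (at t)"
    and dtr: "\<And>t r. (kt t has_real_derivative ktr t r) (at r)"
    and drt: "\<And>t r. ((\<lambda>t. kr t r) has_real_derivative krt t r) (at t)"
    and drr: "\<And>t r. (kr t has_real_derivative krr t r) (at r)"
    and c: "jcont k" "jcont kt" "jcont kr" "jcont ktt" "jcont ktr" "jcont krt" "jcont krr"
  shows "Ck_quadrant 2 k"
    and "\<And>t r. 0 \<le> t \<Longrightarrow> 0 \<le> r \<Longrightarrow> partial_t k t r = kt t r \<and> partial_r k t r = kr t r \<and>
      partial_t (partial_t k) t r = ktt t r \<and> partial_t (partial_r k) t r = krt t r \<and>
      partial_r (partial_r k) t r = krr t r"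
proof -
  note pt = partial_t_eq[where h = k and k = k, OF refl dt]
  note pr = partial_r_eq[where h = k and k = k, OF refl dr]
  have "Ck_quadrant (Suc 0) (partial_t k)"
    by (rule Ck_quadrant_1I[OF pt(2) dtt dtr c(2,4,5)])
  moreover have "Ck_quadrant (Suc 0) (partial_r k)"
    by (rule Ck_quadrant_1I[OF pr(2) drt drr c(3,6,7)])
  moreover have "Ck_quadrant 0 k" by (rule Ck_quadrant_0I[OF c(1) refl])
  moreover have "(\<lambda>s. k s r) differentiable at t within {0..}" "k t differentiable at r within {0..}"
    if "0 \<le> t" "0 \<le> r" for t r
    using DERIV_imp_differentiable_within[OF pt(1)[OF that(1)]]
      DERIV_imp_differentiable_within[OF pr(1)[OF that(2)]] .
  ultimately have "Ck_quadrant (Suc (Suc 0)) k"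
    unfolding Ck_quadrant.simps(2)[of "Suc 0" k] Ck_quadrant.simps(1) by blast
  then show "Ck_quadrant 2 k" by (simp only: numeral_2_eq_2)
  fix t r :: real assume tr: "0 \<le> t" "0 \<le> r"
  have "partial_t (partial_t k) t r = ktt t r"
    by (rule partial_t_eq(2)[where k = kt]) (use pt(2) dtt tr in auto)
  moreover have "partial_t (partial_r k) t r = krt t r"
    by (rule partial_t_eq(2)[where k = kr]) (use pr(2) drt tr in auto)
  moreover have "partial_r (partial_r k) t r = krr t r"
    by (rule partial_r_eq(2)[where k = kr]) (use pr(2) drr tr in auto)
  ultimately show "partial_t k t r = kt t r \<and> partial_r k t r = kr t r \<and>
      partial_t (partial_t k) t r = ktt t r \<and> partial_t (partial_r k) t r = krt t r \<and>
      partial_r (partial_r k) t r = krr t r"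
    using pt(2)[OF tr(1)] pr(2)[OF tr(2)] by simp
qed

section \<open>Global existence with decay\<close>

context dini_nonlinearity begin

definition decay_const :: real where
  "decay_const = 2 * (1 + source_const * small_bound * Lam m0 / R\<^sup>2)"

lemma decay_const_ge: "2 \<le> decay_const"
  using source_const_pos small_bound_pos Lam_m0_nonneg by (simp add: decay_const_def)

end

context dini_data begin

text \<open>Means over \<open>[0, r]\<close> of \<open>v_r\<close>, \<open>v_tr\<close> and \<open>v_rr\<close> are \<open>u\<close>, \<open>u_t\<close> and (up to a factor at most \<open>1\<close>) \<open>u_r\<close>; they inherit
the decay because \<open>t - r + 2 R\<close> only grows when \<open>r\<close> decreases. Only \<open>v_tt = v_rr + F\<close> needs a bound on the source.\<close>

lemma classical_solution_exists:
  assumes G: "\<And>p. G p = \<bar>p\<bar>\<^sup>2 * \<mu> \<bar>p\<bar>" and \<kappa>: "\<kappa> \<le> small_bound"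
    and g0: "\<And>x. ((\<lambda>x. x * g0 \<bar>x\<bar>) has_real_derivative (a x + a (- x)) / 2) (at x)"
    and g1: "\<And>r. 0 \<le> r \<Longrightarrow> (a r - a (- r)) / 2 = r * g1 r"
    and a_0: "a 0 = g0 0" and b_0: "b 0 = g1 0"
    and g0_support: "\<And>r. R < r \<Longrightarrow> g0 r = 0"
  obtains u where "classical_solution \<mu> g0 g1 u"
    "\<And>t r. 0 \<le> t \<Longrightarrow> t + R < r \<Longrightarrow> u t r = 0"
    "\<And>t r \<alpha>. 0 \<le> t \<Longrightarrow> 0 \<le> r \<Longrightarrow> r \<le> t + R \<Longrightarrow> fst \<alpha> + snd \<alpha> \<in> {0, 1} \<Longrightarrow>
       \<bar>partial \<alpha> u t r\<bar> \<le> decay_const * \<kappa> / (t - r + 2 * R)"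
    "\<And>t r \<alpha>. 0 \<le> t \<Longrightarrow> 0 \<le> r \<Longrightarrow> r \<le> t + R \<Longrightarrow> fst \<alpha> + snd \<alpha> \<in> {1, 2} \<Longrightarrow>
       \<bar>partial \<alpha> (times_r u) t r\<bar> \<le> decay_const * \<kappa> / (t - r + 2 * R)"
proof -
  obtain u V Y w q U' where
    dVr: "\<And>t r. (V t has_real_derivative Y t r) (at r)" and
    dVt: "\<And>t r. ((\<lambda>t. V t r) has_real_derivative q t r) (at t)" and
    dwr: "\<And>t r. (w t has_real_derivative q t r) (at r)" and
    dwt: "\<And>t r. ((\<lambda>t. w t r) has_real_derivative Y t r + r * G (avg (q t) r)) (at t)" and
    dvr: "\<And>t r. ((\<lambda>r. r * u t r) has_real_derivative V t r) (at r)" and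
    dvt: "\<And>t r. ((\<lambda>t. r * u t r) has_real_derivative w t r) (at t)" and
    dur: "\<And>t r. (u t has_real_derivative U' t r) (at r)" and
    dut: "\<And>t r. ((\<lambda>t. u t r) has_real_derivative avg (q t) r) (at t)" and
    jc: "jcont V" "jcont Y" "jcont q" "jcont w" "jcont (\<lambda>t r. r * G (avg (q t) r))" "jcont u" "jcont U'"
      "jcont (\<lambda>t. avg (q t))" and
    u_def: "\<And>t r. u t r = avg (V t) r" and
    U'_def: "\<And>t r. U' t r = integral {0..1} (\<lambda>\<theta>. \<theta> * Y t (\<theta> * r))" and
    w_def: "\<And>t r. w t r = r * avg (q t) r" and
    bound: "\<And>t r. \<bar>V t r\<bar> \<le> \<kappa> / cone_weight t r" "\<And>t r. \<bar>Y t r\<bar> \<le> \<kappa> / cone_weight t r" "\<And>t r. \<bar>q t r\<bar> \<le> \<kappa> / cone_weight t r"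
      "\<And>t r. \<bar>w t r\<bar> \<le> \<kappa> / cone_weight t r" and
    F_bound: "\<And>t r. \<bar>r * G (avg (q t) r)\<bar> \<le> source_const * \<kappa> * \<kappa> * (profile r / (cone_weight t r)\<^sup>2)" and
    supp: "\<And>t r. 0 \<le> t \<Longrightarrow> t + R < r \<Longrightarrow> u t r = u 0 r" and
    init: "\<And>r. V 0 r = (a r + a (- r)) / 2" "\<And>r. w 0 r = (a r - a (- r)) / 2" "q 0 0 = b 0"
    by (rule fixed_point_solution) blast
  have jv: "jcont (times_r u)"
    using jc(6) unfolding jcont_def times_r_def
    by (intro continuous_on_mult continuous_on_snd continuous_on_id) auto
  have jYF: "jcont (\<lambda>t r. Y t r + r * G (avg (q t) r))"
    using jc(2,5) unfolding jcont_def by (rule continuous_on_add)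
  have v_derivs: "((\<lambda>t. times_r u t r) has_real_derivative w t r) (at t)"
    "(times_r u t has_real_derivative V t r) (at r)" for t r
    using dvt dvr by (simp_all add: times_r_def[abs_def])
  note v = Ck_quadrant_2I[where k = "times_r u", OF v_derivs dwt dwr dVt dVr jv jc(4,1) jYF jc(3,3,2)]
  have Cu: "Ck_quadrant (Suc 0) u"
    by (rule Ck_quadrant_1I[OF refl dut dur jc(6,8,7)])
  have pu: "partial_t u t r = avg (q t) r" if "0 \<le> t" for t r
    using partial_t_eq(2)[OF refl dut that] .
  have pu': "partial_r u t r = U' t r" if "0 \<le> r" for t r
    using partial_r_eq(2)[OF refl dur that] .
  have partials: "partial (0, 0) h = h" "partial (Suc 0, 0) h = partial_t h" "partial (0, Suc 0) h = partial_r h"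
    "partial (2, 0) h = partial_t (partial_t h)" "partial (0, 2) h = partial_r (partial_r h)"
    "partial (Suc 0, Suc 0) h = partial_t (partial_r h)" for h
    by (simp_all add: partial_def numeral_2_eq_2)
  have u0: "u 0 r = g0 r" if r: "0 \<le> r" for r
  proof -
    have prim0: "prim (V 0) x = x * g0 \<bar>x\<bar>" for x
      using prim_eqI[OF g0[folded init(1)] jcont_section[OF jc(1)], of x] by simp
    show ?thesis
    proof (cases "r = 0")
      case False
      with prim0[of r] r show ?thesis by (simp add: prim_def u_def)
    next
      case True
      then show ?thesis using a_0 by (simp add: u_def init(1))
    qed
  qed
  have ut0: "avg (q 0) r = g1 r" if r: "0 \<le> r" for r
  proof (cases "r = 0")
    case True
    then show ?thesis using init(3) b_0 by simp
  next
    case False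
    then show ?thesis using init(2)[of r] g1[OF r] by (simp add: w_def)
  qed
  have sol: "classical_solution \<mu> g0 g1 u"
    unfolding classical_solution_def
    using Cu v u0 ut0 pu by (simp add: partials G algebra_simps)
  have weight: "c * \<kappa> / cone_weight t s \<le> 2 * c * \<kappa> / (t - r + 2 * R)"
    if "0 \<le> t" "0 \<le> s" "s \<le> r" "r \<le> t + R" "0 \<le> c" for c t r s
  proof -
    have "t - r + 2 * R \<le> 2 * cone_weight t s" using that R_pos unfolding cone_weight_def by (smt (verit))
    then have "c * \<kappa> / cone_weight t s \<le> c * \<kappa> / ((t - r + 2 * R) / 2)"
      using that R_pos \<kappa>_nonneg cone_weight_pos by (intro divide_left_mono mult_nonneg_nonneg mult_pos_pos) auto
    then show ?thesis by (simp add: mult_ac)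
  qed
  have decay: "x \<le> decay_const * \<kappa> / (t - r + 2 * R)"
    if "x \<le> 2 * \<kappa> / (t - r + 2 * R)" "r \<le> t + R" for x t r
  proof -
    have "2 * \<kappa> / (t - r + 2 * R) \<le> decay_const * \<kappa> / (t - r + 2 * R)"
      using that R_pos \<kappa>_nonneg decay_const_ge by (intro divide_right_mono mult_right_mono) auto
    with that show ?thesis by linarith
  qed
  have b1: "\<bar>V t s\<bar> \<le> 2 * \<kappa> / (t - r + 2 * R)" "\<bar>Y t s\<bar> \<le> 2 * \<kappa> / (t - r + 2 * R)"
    "\<bar>q t s\<bar> \<le> 2 * \<kappa> / (t - r + 2 * R)" "\<bar>w t s\<bar> \<le> 2 * \<kappa> / (t - r + 2 * R)"
    if "0 \<le> t" "0 \<le> s" "s \<le> r" "r \<le> t + R" for t r s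
    using weight[OF that, of 1] bound[of t s] by auto
  have b2: "\<bar>Y t r + r * G (avg (q t) r)\<bar> \<le> decay_const * \<kappa> / (t - r + 2 * R)"
    if "0 \<le> t" "0 \<le> r" "r \<le> t + R" for t r
  proof -
    define c where "c = source_const * small_bound * Lam m0 / R\<^sup>2"
    have c: "0 \<le> c" using source_const_pos small_bound_pos Lam_m0_nonneg by (simp add: c_def)
    have "profile r / (cone_weight t r)\<^sup>2 \<le> (Lam m0 / R) / (R * cone_weight t r)"
    proof (rule frac_le)
      show "profile r \<le> Lam m0 / R"
        using profile_le[of r] divide_left_mono[of R "R + \<bar>r\<bar>" "Lam m0"] Lam_m0_nonneg R_pos by auto
      show "R * cone_weight t r \<le> (cone_weight t r)\<^sup>2"
        using cone_weight_ge[of t r] cone_weight_pos[of t r] by (simp add: power2_eq_square)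
    qed (use Lam_m0_nonneg R_pos cone_weight_pos in auto)
    then have "source_const * \<kappa> * \<kappa> * (profile r / (cone_weight t r)\<^sup>2)
        \<le> source_const * small_bound * \<kappa> * ((Lam m0 / R) / (R * cone_weight t r))"
      using source_const_pos \<kappa>_nonneg \<kappa> profile_nonneg small_bound_pos
      by (intro mult_mono mult_nonneg_nonneg) auto
    also have "\<dots> = c * \<kappa> / cone_weight t r" by (simp add: c_def power2_eq_square mult_ac)
    finally have "\<bar>Y t r + r * G (avg (q t) r)\<bar> \<le> (1 + c) * \<kappa> / cone_weight t r"
      using F_bound[of r t] bound(2)[of t r] by (simp add: distrib_right add_divide_distrib)
    also have "\<dots> \<le> 2 * (1 + c) * \<kappa> / (t - r + 2 * R)"
      using that c by (intro weight) auto
    finally show ?thesis by (simp add: decay_const_def c_def)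
  qed
  have scale: "0 \<le> \<theta> * r \<and> \<theta> * r \<le> r" if "0 \<le> \<theta>" "\<theta> \<le> 1" "0 \<le> r" for \<theta> r :: real
    using that by (auto intro: mult_left_le_one_le)
  have b_u: "\<bar>u t r\<bar> \<le> 2 * \<kappa> / (t - r + 2 * R)" "\<bar>avg (q t) r\<bar> \<le> 2 * \<kappa> / (t - r + 2 * R)"
    if "0 \<le> t" "0 \<le> r" "r \<le> t + R" for t r
    unfolding u_def using that scale
    by (auto intro!: avg_bound jcont_section jc b1)
  have b_U: "\<bar>U' t r\<bar> \<le> 2 * \<kappa> / (t - r + 2 * R)" if tr: "0 \<le> t" "0 \<le> r" "r \<le> t + R" for t r
  proof -
    have "norm (U' t r) \<le> integral {0..1} (\<lambda>\<theta>::real. 2 * \<kappa> / (t - r + 2 * R))"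
      unfolding U'_def
    proof (rule integral_norm_bound_integral)
      show "(\<lambda>\<theta>. \<theta> * Y t (\<theta> * r)) integrable_on {0..1}"
        by (intro integrable_continuous_real continuous_on_mult continuous_on_id
            continuous_on_scale jcont_section jc)
      fix \<theta> :: real assume \<theta>: "\<theta> \<in> {0..1}"
      have "\<bar>\<theta>\<bar> * \<bar>Y t (\<theta> * r)\<bar> \<le> 1 * (2 * \<kappa> / (t - r + 2 * R))"
        using \<theta> tr scale[of \<theta> r] by (intro mult_mono b1) auto
      then show "norm (\<theta> * Y t (\<theta> * r)) \<le> 2 * \<kappa> / (t - r + 2 * R)" by (simp add: abs_mult)
    qed (rule integrable_const_ivl)
    then show ?thesis by simp
  qed
  show ?thesis
  proof (rule that[OF sol])
    show "u t r = 0" if "0 \<le> t" "t + R < r" for t r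
      using supp[OF that] u0[of r] g0_support[of r] that R_pos by simp
    fix t r :: real and \<alpha> :: "nat \<times> nat"
    assume tr: "0 \<le> t" "0 \<le> r" "r \<le> t + R"
    show "\<bar>partial \<alpha> u t r\<bar> \<le> decay_const * \<kappa> / (t - r + 2 * R)" if "fst \<alpha> + snd \<alpha> \<in> {0, 1}"
    proof -
      have "\<alpha> = (0, 0) \<or> \<alpha> = (Suc 0, 0) \<or> \<alpha> = (0, Suc 0)" using that by (cases \<alpha>) auto
      then show ?thesis
        using tr b_u[OF tr] b_U[OF tr] by (auto simp: partials pu pu' intro: decay)
    qed
    show "\<bar>partial \<alpha> (times_r u) t r\<bar> \<le> decay_const * \<kappa> / (t - r + 2 * R)" if "fst \<alpha> + snd \<alpha> \<in> {1, 2}"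
    proof -
      have "\<alpha> = (Suc 0, 0) \<or> \<alpha> = (0, Suc 0) \<or> \<alpha> = (2, 0) \<or> \<alpha> = (Suc 0, Suc 0) \<or> \<alpha> = (0, 2)"
        using that by (cases \<alpha>) auto
      then show ?thesis
        using tr b1[OF tr(1,2) order_refl tr(3)] b2[OF tr] v(2)[OF tr(1,2)]
        by (auto simp: partials intro: decay)
    qed
  qed
qed

end

theorem theorem2p2:
  fixes f0 f1 \<mu> :: "real \<Rightarrow> real" and R :: real
  assumes "R > 0"
    and "Ck_on 2 {0..} f0" and "Ck_on 1 {0..} f1"
    and "closure (support_on {0..} f0) \<subseteq> {0..R}"
    and "closure (support_on {0..} f1) \<subseteq> {0..R}"
    and "deriv_on {0..} f0 0 = 0"
    and "modulus_of_continuity \<mu>"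
    and "Ck_on 2 {0<..} \<mu>"
    and "\<exists>\<tau>1>0. \<forall>k\<in>{1, 2}. \<exists>C>0. \<forall>\<tau>\<in>{0<..<\<tau>1}.
           \<bar>(deriv_on {0<..} ^^ k) \<mu> \<tau>\<bar> \<le> C * (\<mu> \<tau> / \<tau> ^ k)"
    and "Dini_condition \<mu>"
  shows "\<exists>\<epsilon>0>0. \<exists>C>0. \<forall>\<epsilon>\<in>{0<..\<epsilon>0}. \<exists>u :: real \<Rightarrow> real \<Rightarrow> real.
           classical_solution \<mu> (\<lambda>r. \<epsilon> * f0 r) (\<lambda>r. \<epsilon> * f1 r) u \<and>
           (\<forall>w. classical_solution \<mu> (\<lambda>r. \<epsilon> * f0 r) (\<lambda>r. \<epsilon> * f1 r) w \<longrightarrow>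
                (\<forall>t\<ge>0. \<forall>r\<ge>0. w t r = u t r)) \<and>
           closure (support_on ({0..} \<times> {0..}) (\<lambda>(t, r). u t r))
             \<subseteq> {(t, r). 0 \<le> t \<and> 0 \<le> r \<and> r \<le> t + R} \<and>
           (\<forall>t\<ge>0. \<forall>r\<ge>0. r \<le> t + R \<longrightarrow>
              (\<forall>\<alpha>. fst \<alpha> + snd \<alpha> \<in> {0, 1} \<longrightarrow>
                 \<bar>partial \<alpha> u t r\<bar> \<le> C * (\<epsilon> * data_norm f0 f1 * inverse (t - r + 2 * R))) \<and>
              (\<forall>\<alpha>. fst \<alpha> + snd \<alpha> \<in> {1, 2} \<longrightarrow>
                 \<bar>partial \<alpha> (times_r u) t r\<bar>
                   \<le> C * (\<epsilon> * data_norm f0 f1 * inverse (t - r + 2 * R))))"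
proof -
  obtain G g m0 D Lam where nl: "dini_nonlinearity G g R m0 D Lam" and G: "\<And>p. G p = \<bar>p\<bar>\<^sup>2 * \<mu> \<bar>p\<bar>"
    using dini_nonlinearity_of_modulus[OF assms(1,7,8,9,10)] by blast
  interpret dini_nonlinearity G g R m0 D Lam by (rule nl)
  define N where "N = data_norm f0 f1"
  define f0' f0'' f1' where "f0' = deriv_on {0..} f0" and "f0'' = (deriv_on {0..} ^^ 2) f0"
    and "f1' = deriv_on {0..} f1"
  have df: "(f0 has_real_derivative f0' x) (at x within {0..})"
    "(f0' has_real_derivative f0'' x) (at x within {0..})"
    "(f1 has_real_derivative f1' x) (at x within {0..})" if "0 \<le> x" for x
    using assms(2,3) that by (auto simp: f0'_def f0''_def f1'_def numeral_2_eq_2 intro!: DERIV_deriv_on)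
  have cf: "continuous_on {0..} f0" "continuous_on {0..} f0'" "continuous_on {0..} f0''"
    "continuous_on {0..} f1" "continuous_on {0..} f1'"
  proof -
    show "continuous_on {0..} f0" "continuous_on {0..} f0'" "continuous_on {0..} f1"
      unfolding continuous_on_eq_continuous_within
      by (intro ballI DERIV_continuous[OF df(1)] DERIV_continuous[OF df(2)] DERIV_continuous[OF df(3)], simp)+
    show "continuous_on {0..} f0''" "continuous_on {0..} f1'"
      using assms(2,3) by (simp_all add: f0''_def f1'_def numeral_2_eq_2)
  qed
  have s0: "f0 r = 0" and s1: "f1 r = 0" if "R < r" for r
  proof -
    have "r \<notin> support_on {0..} f0" "r \<notin> support_on {0..} f1"
      using that assms(4,5) closure_subset[of "support_on {0..} f0"] closure_subset[of "support_on {0..} f1"]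
        atLeastAtMost_iff[of r 0 R] by (meson not_le subsetD)+
    then show "f0 r = 0" "f1 r = 0" using that assms(1) by (simp_all add: support_on_def)
  qed
  have le_N: "\<bar>f0 r\<bar> \<le> N" "\<bar>f0' r\<bar> \<le> N" "\<bar>f0'' r\<bar> \<le> N" "\<bar>f1 r\<bar> \<le> N" "\<bar>f1' r\<bar> \<le> N" if "0 \<le> r" for r
  proof -
    note ge = data_norm_ge[OF assms(2,3) s0 s1 assms(1) that, folded N_def f0'_def f0''_def f1'_def]
    note tail = order_trans[OF norm_snd_le ge]
    note tail2 = order_trans[OF norm_snd_le tail]
    note tail3 = order_trans[OF norm_snd_le tail2]
    show "\<bar>f0 r\<bar> \<le> N" "\<bar>f0' r\<bar> \<le> N" "\<bar>f0'' r\<bar> \<le> N" "\<bar>f1 r\<bar> \<le> N" "\<bar>f1' r\<bar> \<le> N"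
      using order_trans[OF norm_fst_le ge] order_trans[OF norm_fst_le tail]
        order_trans[OF norm_fst_le tail2] order_trans[OF norm_fst_le tail3]
        order_trans[OF norm_snd_le tail3] by simp_all
  qed
  have N: "0 \<le> N" using le_N(1)[of 0] by simp
  define h1 where "h1 x = f0 x + x * f0' x" for x
  define h1' where "h1' x = 2 * f0' x + x * f0'' x" for x
  define h2 where "h2 x = x * f1 x" for x
  define h2' where "h2' x = f1 x + x * f1' x" for x
  have dh1: "(h1 has_real_derivative h1' x) (at x within {0..})"
    and dh2: "(h2 has_real_derivative h2' x) (at x within {0..})"
    and dh3: "((\<lambda>x. x * f0 x) has_real_derivative h1 x) (at x within {0..})" if "0 \<le> x" for x
    using df[OF that] unfolding h1_def h1'_def h2_def h2'_def
    by (auto intro!: derivative_eq_intros simp: algebra_simps)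
  have h0: "h1' 0 = 0" "h2 0 = 0"
    using assms(6) by (simp_all add: h1'_def h2_def f0'_def)
  define a where "a x = h1 \<bar>x\<bar> + sgn x * h2 \<bar>x\<bar>" for x
  define b where "b x = sgn x * h1' \<bar>x\<bar> + h2' \<bar>x\<bar>" for x
  have da: "(a has_real_derivative b x) (at x)" for x
    unfolding a_def b_def
    by (intro DERIV_add DERIV_even_extension DERIV_odd_extension dh1 dh2 h0)
  have cb: "continuous_on UNIV b"
    unfolding b_def
  proof (intro continuous_on_add continuous_on_odd_extension continuous_on_even_extension h0)
    show "continuous_on {0..} h1'" "continuous_on {0..} h2'"
      unfolding h1'_def h2'_def by (intro continuous_intros cf)+
  qed
  have a_even: "(a x + a (- x)) / 2 = h1 \<bar>x\<bar>" and a_odd: "(a x - a (- x)) / 2 = sgn x * h2 \<bar>x\<bar>" for x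
    by (simp_all add: a_def sgn_minus)
  have f0'_0: "f0' r = 0" if "R < r" for r
    unfolding f0'_def using that assms(1,2) by (intro deriv_on_eq_0[OF assms(1)] s0) (auto simp: numeral_2_eq_2)
  have a_support: "a x = 0" if "R < \<bar>x\<bar>" for x
    using that by (simp add: a_def h1_def h2_def s0 s1 f0'_0)
  have b_support: "b x = 0" if "R < \<bar>x\<bar>" for x
    by (rule vanishing_derivative[OF da a_support that])
  \<comment> \<open>On \<open>|x| \<le> R\<close> both data are bounded by \<open>(3 + 2 R) N\<close>, and \<open>2 R \<ge> R + |x|\<close> there.\<close>
  define A where "A = (3 + 2 * R) * N * (2 * R)"
  have A: "0 \<le> A" using N assms(1) by (simp add: A_def)
  have weighted: "y \<le> A / (R + \<bar>x\<bar>)" if "y \<le> (3 + 2 * R) * N" "\<bar>x\<bar> \<le> R" for x y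
  proof -
    have "(3 + 2 * R) * N * (R + \<bar>x\<bar>) \<le> A"
      unfolding A_def using that N assms(1) by (intro mult_left_mono) auto
    then have "(3 + 2 * R) * N \<le> A / (R + \<bar>x\<bar>)"
      using assms(1) by (simp add: pos_le_divide_eq)
    with that show ?thesis by linarith
  qed
  have prod_le: "\<bar>x * y\<bar> \<le> R * N" if "\<bar>x\<bar> \<le> R" "\<bar>y\<bar> \<le> N" for x y
    unfolding abs_mult using that assms(1) by (intro mult_mono) auto
  have sgn_le: "\<bar>sgn x * y\<bar> \<le> \<bar>y\<bar>" for x y :: real
    by (simp add: abs_mult sgn_if)
  have a_bound: "\<bar>a x\<bar> \<le> A / (R + \<bar>x\<bar>)" and b_bound: "\<bar>b x\<bar> \<le> A / (R + \<bar>x\<bar>)" for x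
  proof -
    let ?x = "\<bar>x\<bar>"
    have "\<bar>a x\<bar> \<le> A / (R + \<bar>x\<bar>) \<and> \<bar>b x\<bar> \<le> A / (R + \<bar>x\<bar>)"
    proof (cases "?x \<le> R")
      case True
      then have xR: "\<bar>?x\<bar> \<le> R" by simp
      note le = le_N[of ?x, OF abs_ge_zero]
      have "\<bar>h1 ?x\<bar> \<le> N + R * N"
        unfolding h1_def
        by (rule order_trans[OF abs_triangle_ineq add_mono[OF le(1) prod_le[OF xR le(2)]]])
      moreover have "\<bar>sgn x * h2 ?x\<bar> \<le> R * N"
        unfolding h2_def by (rule order_trans[OF sgn_le prod_le[OF xR le(4)]])
      ultimately have "\<bar>a x\<bar> \<le> (N + R * N) + R * N"
        unfolding a_def by (intro order_trans[OF abs_triangle_ineq] add_mono)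
      also have "\<dots> \<le> (3 + 2 * R) * N" using N by (simp add: algebra_simps)
      finally have a_le: "\<bar>a x\<bar> \<le> (3 + 2 * R) * N" .
      have "\<bar>2 * f0' ?x\<bar> \<le> 2 * N" using le(2) by (simp add: abs_mult)
      then have "\<bar>h1' ?x\<bar> \<le> 2 * N + R * N"
        unfolding h1'_def by (rule order_trans[OF abs_triangle_ineq add_mono[OF _ prod_le[OF xR le(3)]]])
      then have "\<bar>sgn x * h1' ?x\<bar> \<le> 2 * N + R * N"
        by (rule order_trans[OF sgn_le])
      moreover have "\<bar>h2' ?x\<bar> \<le> N + R * N"
        unfolding h2'_def
        by (rule order_trans[OF abs_triangle_ineq add_mono[OF le(4) prod_le[OF xR le(5)]]])
      ultimately have "\<bar>b x\<bar> \<le> (2 * N + R * N) + (N + R * N)"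
        unfolding b_def by (intro order_trans[OF abs_triangle_ineq] add_mono)
      also have "\<dots> = (3 + 2 * R) * N" by (simp add: algebra_simps)
      finally show ?thesis using weighted[OF a_le True] weighted[OF _ True] by blast
    next
      case False
      then show ?thesis using a_support[of x] b_support[of x] A assms(1) by simp
    qed
    then show "\<bar>a x\<bar> \<le> A / (R + \<bar>x\<bar>)" "\<bar>b x\<bar> \<le> A / (R + \<bar>x\<bar>)" by auto
  qed
  define \<epsilon>0 where "\<epsilon>0 = small_bound / (2 * A + 1)"
  define C where "C = decay_const * (2 * ((3 + 2 * R) * (2 * R)))"
  have \<epsilon>0: "0 < \<epsilon>0" using small_bound_pos A by (simp add: \<epsilon>0_def)
  have C: "0 < C" using decay_const_ge assms(1) by (simp add: C_def)
  show ?thesis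
  proof (rule exI[of _ \<epsilon>0], intro conjI \<epsilon>0, rule exI[of _ C], intro conjI ballI C)
    fix \<epsilon> assume "\<epsilon> \<in> {0<..\<epsilon>0}"
    then have \<epsilon>: "0 < \<epsilon>" "\<epsilon> \<le> \<epsilon>0" by auto
    define \<kappa> where "\<kappa> = 2 * \<epsilon> * A"
    have \<kappa>0: "0 \<le> \<kappa>" using \<epsilon> A by (simp add: \<kappa>_def)
    have \<kappa>: "\<kappa> \<le> small_bound"
    proof -
      have "\<epsilon> * (2 * A + 1) \<le> small_bound"
        using \<epsilon>(2) A by (simp add: \<epsilon>0_def pos_le_divide_eq)
      moreover have "\<kappa> \<le> \<epsilon> * (2 * A + 1)" using \<epsilon> by (simp add: \<kappa>_def algebra_simps)
      ultimately show ?thesis by linarith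
    qed
    interpret dd: dini_data G g R m0 D Lam "\<lambda>x. \<epsilon> * a x" "\<lambda>x. \<epsilon> * b x" \<kappa>
    proof
      show "((\<lambda>x. \<epsilon> * a x) has_real_derivative \<epsilon> * b x) (at x)" for x by (rule DERIV_cmult[OF da])
      show "continuous_on UNIV (\<lambda>x. \<epsilon> * b x)" by (intro continuous_on_mult continuous_on_const cb)
      show "\<bar>\<epsilon> * a x\<bar> \<le> \<kappa> / 2 / (R + \<bar>x\<bar>)" "\<bar>\<epsilon> * b x\<bar> \<le> \<kappa> / 2 / (R + \<bar>x\<bar>)" for x
        using mult_left_mono[OF a_bound[of x], of \<epsilon>] mult_left_mono[OF b_bound[of x], of \<epsilon>] \<epsilon>
        by (simp_all add: \<kappa>_def abs_mult)
      show "small \<kappa>" by (rule smallI[OF \<kappa>0 \<kappa>])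
    qed (simp add: a_support)
    have init0: "((\<lambda>x. x * (\<epsilon> * f0 \<bar>x\<bar>)) has_real_derivative (\<epsilon> * a x + \<epsilon> * a (- x)) / 2) (at x)" for x
    proof -
      have "((\<lambda>x. sgn x * (\<bar>x\<bar> * f0 \<bar>x\<bar>)) has_real_derivative h1 \<bar>x\<bar>) (at x)"
        by (rule DERIV_odd_extension[OF dh3]) simp_all
      moreover have "sgn x * (\<bar>x\<bar> * f0 \<bar>x\<bar>) = x * f0 \<bar>x\<bar>" for x
        by (simp add: sgn_if)
      ultimately have "((\<lambda>x. \<epsilon> * (x * f0 \<bar>x\<bar>)) has_real_derivative \<epsilon> * ((a x + a (- x)) / 2)) (at x)"
        unfolding a_even by (intro DERIV_cmult) simp
      moreover have "(\<lambda>x. \<epsilon> * (x * f0 \<bar>x\<bar>)) = (\<lambda>x. x * (\<epsilon> * f0 \<bar>x\<bar>))" by (simp add: fun_eq_iff)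
      moreover have "\<epsilon> * ((a x + a (- x)) / 2) = (\<epsilon> * a x + \<epsilon> * a (- x)) / 2" by (simp add: distrib_left)
      ultimately show ?thesis by simp
    qed
    have init1: "(\<epsilon> * a r - \<epsilon> * a (- r)) / 2 = r * (\<epsilon> * f1 r)" if "0 \<le> r" for r
    proof -
      have "(\<epsilon> * a r - \<epsilon> * a (- r)) / 2 = \<epsilon> * (sgn r * h2 \<bar>r\<bar>)"
        unfolding a_odd[symmetric] by (simp add: right_diff_distrib)
      then show ?thesis using that by (simp add: h2_def sgn_if)
    qed
    obtain u where sol: "classical_solution \<mu> (\<lambda>r. \<epsilon> * f0 r) (\<lambda>r. \<epsilon> * f1 r) u"
      and supp: "\<And>t r. 0 \<le> t \<Longrightarrow> t + R < r \<Longrightarrow> u t r = 0"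
      and est1: "\<And>t r \<alpha>. 0 \<le> t \<Longrightarrow> 0 \<le> r \<Longrightarrow> r \<le> t + R \<Longrightarrow> fst \<alpha> + snd \<alpha> \<in> {0, 1} \<Longrightarrow>
        \<bar>partial \<alpha> u t r\<bar> \<le> decay_const * \<kappa> / (t - r + 2 * R)"
      and est2: "\<And>t r \<alpha>. 0 \<le> t \<Longrightarrow> 0 \<le> r \<Longrightarrow> r \<le> t + R \<Longrightarrow> fst \<alpha> + snd \<alpha> \<in> {1, 2} \<Longrightarrow>
        \<bar>partial \<alpha> (times_r u) t r\<bar> \<le> decay_const * \<kappa> / (t - r + 2 * R)"
    proof (rule dd.classical_solution_exists[OF G \<kappa>, of "\<lambda>r. \<epsilon> * f0 r" "\<lambda>r. \<epsilon> * f1 r"])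
      show "\<epsilon> * a 0 = \<epsilon> * f0 0" by (simp add: a_def h1_def)
      show "\<epsilon> * b 0 = \<epsilon> * f1 0" by (simp add: b_def h2'_def)
    qed (use init0 init1 s0 in auto)
    have const: "decay_const * \<kappa> / (t - r + 2 * R) = C * (\<epsilon> * data_norm f0 f1 * inverse (t - r + 2 * R))" for t r
      by (simp add: C_def \<kappa>_def A_def N_def divide_inverse mult_ac)
    have "closure (support_on ({0..} \<times> {0..}) (\<lambda>(t, r). u t r))
        \<subseteq> {z. 0 \<le> fst z \<and> 0 \<le> snd z \<and> snd z \<le> fst z + R}"
    proof (rule closure_minimal)
      show "support_on ({0..} \<times> {0..}) (\<lambda>(t, r). u t r) \<subseteq> {z. 0 \<le> fst z \<and> 0 \<le> snd z \<and> snd z \<le> fst z + R}"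
      proof
        fix z assume "z \<in> support_on ({0..} \<times> {0..}) (\<lambda>(t, r). u t r)"
        then have "0 \<le> fst z" "0 \<le> snd z" "u (fst z) (snd z) \<noteq> 0"
          by (auto simp: support_on_def)
        then show "z \<in> {z. 0 \<le> fst z \<and> 0 \<le> snd z \<and> snd z \<le> fst z + R}"
          using supp[of "fst z" "snd z"] by force
      qed
      show "closed {z. 0 \<le> fst z \<and> 0 \<le> snd z \<and> snd z \<le> fst z + R}"
        by (intro closed_Collect_conj closed_Collect_le continuous_intros)
    qed
    also have "\<dots> = {(t, r). 0 \<le> t \<and> 0 \<le> r \<and> r \<le> t + R}" by auto
    finally have closure: "closure (support_on ({0..} \<times> {0..}) (\<lambda>(t, r). u t r))
        \<subseteq> {(t, r). 0 \<le> t \<and> 0 \<le> r \<and> r \<le> t + R}" .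
    show "\<exists>u. classical_solution \<mu> (\<lambda>r. \<epsilon> * f0 r) (\<lambda>r. \<epsilon> * f1 r) u \<and>
           (\<forall>w. classical_solution \<mu> (\<lambda>r. \<epsilon> * f0 r) (\<lambda>r. \<epsilon> * f1 r) w \<longrightarrow>
                (\<forall>t\<ge>0. \<forall>r\<ge>0. w t r = u t r)) \<and>
           closure (support_on ({0..} \<times> {0..}) (\<lambda>(t, r). u t r))
             \<subseteq> {(t, r). 0 \<le> t \<and> 0 \<le> r \<and> r \<le> t + R} \<and>
           (\<forall>t\<ge>0. \<forall>r\<ge>0. r \<le> t + R \<longrightarrow>
              (\<forall>\<alpha>. fst \<alpha> + snd \<alpha> \<in> {0, 1} \<longrightarrow>
                 \<bar>partial \<alpha> u t r\<bar> \<le> C * (\<epsilon> * data_norm f0 f1 * inverse (t - r + 2 * R))) \<and>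
              (\<forall>\<alpha>. fst \<alpha> + snd \<alpha> \<in> {1, 2} \<longrightarrow>
                 \<bar>partial \<alpha> (times_r u) t r\<bar>
                   \<le> C * (\<epsilon> * data_norm f0 f1 * inverse (t - r + 2 * R))))"
    proof (intro exI[of _ u] conjI allI impI sol closure)
      show "w t r = u t r" if "classical_solution \<mu> (\<lambda>r. \<epsilon> * f0 r) (\<lambda>r. \<epsilon> * f1 r) w" "0 \<le> t" "0 \<le> r"
        for w t r
        by (rule classical_solution_unique[OF G that(1) sol that(2,3)])
    qed (use est1 est2 in \<open>simp_all only: const\<close>)
  qed
qed

end
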